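(* Let $P:\mathcal{C}^{\mathrm{op}}\to\mathbf{Hey}$ be a Gödel first-order hyperdoctrine. Then there is an equivalence of exact categories $$\mathsf{T}_P\equiv \mathbf{Pred}(P^{\exists\text{-free}})_{\mathsf{ex}/\mathsf{lex}}.$$
   Context: A doctrine is a functor $P:\mathcal{C}^{\mathrm{op}}\to\mathbf{Pos}$, where $\mathcal{C}$ has finite products and $\mathbf{Pos}$ is the category of posets and monotone maps. For $f:A\to B$ in $\mathcal{C}$ write $P_f:P(B)\to P(A)$. Elements of $P(A)$ are called predicates. $P$ is existential (resp. universal) if for every product projection $\pi_i:A_1\times A_2\to A_i$ the map $P_{\pi_i}$ has a left adjoint $\exists_{\pi_i}$ (resp. a right adjoint $\forall_{\pi_i}$) and the Beck-Chevalley condition holds: for every pullback square $\pi f'=f\pi'$ with $\pi:X\to A$ and $\pi':X'\to A'$ projections, $f:A'\to A$, $f':X'\to X$, and every $\beta\in P(X)$, $\exists_{\pi'}P_{f'}\beta=P_f\exists_\pi\beta$ (resp. $\forall_{\pi'}P_{f'}\beta=P_f\forall_\pi\beta$). Internal language: $a:A\mid\phi(a)\vdash\psi(a)$ means $\phi\le\psi$ in $P(A)$ (a context with several variables denotes the product of the types). For $\alpha\in P(A\times B)$, $\exists b:B.\,\alpha(a,b)$ and $\forall b:B.\,\alpha(a,b)$ denote $\exists_{\pi_A}\alpha$ and $\forall_{\pi_A}\alpha$ in $P(A)$. Terms are arrows of $\mathcal{C}$ and substitution is reindexing, e.g. $\alpha(a,g(a))$ is $P_{\langle 1_A,g\rangle}\alpha$.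 Propositional connectives are interpreted by the operations of the fibres. Let $P$ be existential. $\alpha\in P(A)$ is an existential splitting if for every object $B$ and every $\beta\in P(A\times B)$ with $\alpha(a)\vdash\exists b:B.\,\beta(a,b)$ there is $g:A\to B$ with $\alpha(a)\vdash\beta(a,g(a))$. $\alpha\in P(I)$ is existential-free if $P_f(\alpha)$ is an existential splitting for every arrow $f:A\to I$. $P$ has enough existential-free predicates if for every $I$ and $\alpha\in P(I)$ there are an object $A$ and an existential-free $\beta\in P(I\times A)$ with $\alpha=\exists_{\pi_I}\beta$. $P^{\exists\text{-free}}$ denotes the subdoctrine of $P$ (same base) whose fibre over $A$ is the set of existential-free elements of $P(A)$ with the induced order. Dually, for $P$ universal, $\alpha\in P(A)$ is a universal splitting if for every $B$ and every $\beta\in P(A\times B)$ with $\forall b:B.\,\beta(a,b)\vdash\alpha(a)$ there is $g:A\to B$ with $\beta(a,g(a))\vdash\alpha(a)$. $\alpha\in P(I)$ is universal-free if $P_f(\alpha)$ is a universal splitting for every $f:A\to I$. $P$ has enough universal-free predicates if for every $I$ and $\alpha\in P(I)$ there are $A$ and a universal-free $\beta\in P(I\times A)$ with $\alpha=\forall_{\pi_I}\beta$. $P$ is a Skolem doctrine if: (i) $\mathcal{C}$ is cartesian closed; (ii) $P$ is existential and universal; (iii) $P$ has enough existential-free predicates; (iv) if $\alpha\in P(A)$ is existential-free then $\forall_\pi(\alpha)$ is existential-free for every projection $\pi$ from $A$ (so $P^{\exists\text{-free}}$ is a universal doctrine, with universal quantifiers those of $P$). $P$ is a Gödel doctrine if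 it is a Skolem doctrine and the doctrine $P^{\exists\text{-free}}$ has enough universal-free predicates. A first-order hyperdoctrine is a functor $P:\mathcal{C}^{\mathrm{op}}\to\mathbf{Hey}$ from a category $\mathcal{C}$ with finite products to Heyting algebras and their homomorphisms such that for every arrow $f$ the map $P_f$ has a left adjoint $\exists_f$ and a right adjoint $\forall_f$, satisfying Beck-Chevalley for every pullback square $fh=gk$ ($h:D\to A$, $k:D\to C$, $f:A\to B$, $g:C\to B$): $\exists_kP_h=P_g\exists_f$ and $\forall_kP_h=P_g\forall_f$. It is a Gödel first-order hyperdoctrine if $P$ is a Gödel doctrine. Write $\delta_A:=\exists_{\Delta_A}(\top_A)\in P(A\times A)$ for the equality predicate of $P$, where $\Delta_A:A\to A\times A$ is the diagonal; $\delta_A$ is also written $a_1=a_2$. Tripos-to-topos: $\mathsf{T}_P$ is the category whose objects are pairs $(A,\rho)$ with $\rho\in P(A\times A)$ satisfying $\rho(a_1,a_2)\vdash\rho(a_2,a_1)$ and $\rho(a_1,a_2)\wedge\rho(a_2,a_3)\vdash\rho(a_1,a_3)$; an arrow $(A,\rho)\to(B,\sigma)$ is an element $\phi\in P(A\times B)$ such that: (1) $\phi(a,b)\vdash\rho(a,a)\wedge\sigma(b,b)$; (2) $\rho(a_1,a_2)\wedge\phi(a_1,b)\vdash\phi(a_2,b)$; (3) $\sigma(b_1,b_2)\wedge\phi(a,b_1)\vdash\phi(a,b_2)$; (4) $\phi(a,b_1)\wedge\phi(a,b_2)\vdash\sigma(b_1,b_2)$; (5) $\rho(a,a)\vdash\exists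 b:B.\,\phi(a,b)$. Composition is relational composition $\exists b:B.\,\phi(a,b)\wedge\psi(b,c)$ and the identity of $(A,\rho)$ is $\rho$. Category of predicates: for a doctrine $Q$, the category $\mathbf{Pred}(Q)$ is obtained by forming the base of the comprehension completion $Q_c$ of $Q$ (objects: pairs $(A,\alpha)$ with $A$ an object of $\mathcal{C}$ and $\alpha\in Q(A)$; arrows $(A,\alpha)\to(B,\beta)$: arrows $f:A\to B$ of $\mathcal{C}$ with $\alpha(a)\vdash\beta(f(a))$) and then taking the base of the extensional reflection, i.e. identifying parallel arrows that are provably equal. Explicitly, $\mathbf{Pred}(P^{\exists\text{-free}})$ has as objects the pairs $(A,\alpha)$ with $\alpha$ an existential-free element of $P(A)$, and as arrows $(A,\alpha)\to(B,\beta)$ the equivalence classes of arrows $f:A\to B$ of $\mathcal{C}$ with $\alpha(a)\vdash\beta(f(a))$, where $f\sim g$ iff $\alpha(a)\vdash f(a)=g(a)$, the equality being the predicate $\delta_B$ of $P$. For a category $\mathcal{D}$ with finite limits, $\mathcal{D}_{\mathsf{ex}/\mathsf{lex}}$ is the exact completion of $\mathcal{D}$ as a finitely complete category (Carboni–Celia Magno, Carboni–Vitale), i.e. the free exact category on $\mathcal{D}$ with respect to finite-limit-preserving functors.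
   Formalization: Pred(P^{∃-free}) need not have finite limits, so its ex/lex completion may be undefined; the completion is taken as the Carboni–Celia Magno category of pseudo-equivalence relations, with transitivity on generalized elements, which is the usual one whenever finite limits exist. *)

theory Defs
  imports "HOL-Algebra.Lattice"
begin

section \<open>Categories\<close>

record ('o, 'm) cat =
  ob :: "'o set"
  ar :: "'m set"
  src :: "'m \<Rightarrow> 'o"
  tgt :: "'m \<Rightarrow> 'o"
  ide :: "'o \<Rightarrow> 'm"
  cmp :: "'m \<Rightarrow> 'm \<Rightarrow> 'm"  (infixl "\<odot>\<index>" 70)

text \<open>Composition is in applicative order: \<open>g \<odot>\<^bsub>C\<^esub> f\<close> is ``\<open>g\<close> after \<open>f\<close>''.
  The operations are only meaningful on \<open>ob C\<close> and \<open>ar C\<close>.\<close>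

definition Hom :: "('o, 'm, 'z) cat_scheme \<Rightarrow> 'o \<Rightarrow> 'o \<Rightarrow> 'm set" where
  "Hom C A B = {f \<in> ar C. src C f = A \<and> tgt C f = B}"

locale category =
  fixes C :: "('o, 'm, 'z) cat_scheme" (structure)
  assumes src_ob: "f \<in> ar C \<Longrightarrow> src C f \<in> ob C"
    and tgt_ob: "f \<in> ar C \<Longrightarrow> tgt C f \<in> ob C"
    and ide_Hom: "A \<in> ob C \<Longrightarrow> ide C A \<in> Hom C A A"
    and cmp_Hom: "f \<in> Hom C A B \<Longrightarrow> g \<in> Hom C B D \<Longrightarrow> g \<odot> f \<in> Hom C A D"
    and cmp_ide_left: "f \<in> Hom C A B \<Longrightarrow> ide C B \<odot> f = f"
    and cmp_ide_right: "f \<in> Hom C A B \<Longrightarrow> f \<odot> ide C A = f"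
    and cmp_assoc: "f \<in> Hom C A B \<Longrightarrow> g \<in> Hom C B D \<Longrightarrow> h \<in> Hom C D E
      \<Longrightarrow> h \<odot> (g \<odot> f) = (h \<odot> g) \<odot> f"

definition is_terminal :: "('o, 'm, 'z) cat_scheme \<Rightarrow> 'o \<Rightarrow> bool" where
  "is_terminal C T \<longleftrightarrow> T \<in> ob C \<and> (\<forall>A\<in>ob C. \<exists>!f. f \<in> Hom C A T)"

definition is_product :: "('o, 'm, 'z) cat_scheme \<Rightarrow> 'o \<Rightarrow> 'o \<Rightarrow> 'o \<Rightarrow> 'm \<Rightarrow> 'm \<Rightarrow> bool" where
  "is_product C A B X p q \<longleftrightarrow> p \<in> Hom C X A \<and> q \<in> Hom C X B \<and>
    (\<forall>Z. \<forall>f\<in>Hom C Z A. \<forall>g\<in>Hom C Z B.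
      \<exists>!h. h \<in> Hom C Z X \<and> p \<odot>\<^bsub>C\<^esub> h = f \<and> q \<odot>\<^bsub>C\<^esub> h = g)"

text \<open>\<open>is_pullback C f g h k\<close>: the square \<open>f h = g k\<close> is a pullback.\<close>

definition is_pullback :: "('o, 'm, 'z) cat_scheme \<Rightarrow> 'm \<Rightarrow> 'm \<Rightarrow> 'm \<Rightarrow> 'm \<Rightarrow> bool" where
  "is_pullback C f g h k \<longleftrightarrow>
    f \<in> ar C \<and> g \<in> ar C \<and> tgt C f = tgt C g \<and>
    h \<in> Hom C (src C h) (src C f) \<and> k \<in> Hom C (src C h) (src C g) \<and>
    f \<odot>\<^bsub>C\<^esub> h = g \<odot>\<^bsub>C\<^esub> k \<and>
    (\<forall>Z. \<forall>u\<in>Hom C Z (src C f). \<forall>v\<in>Hom C Z (src C g). f \<odot>\<^bsub>C\<^esub> u = g \<odot>\<^bsub>C\<^esub> v \<longrightarrow>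
      (\<exists>!w. w \<in> Hom C Z (src C h) \<and> h \<odot>\<^bsub>C\<^esub> w = u \<and> k \<odot>\<^bsub>C\<^esub> w = v))"

definition is_iso :: "('o, 'm, 'z) cat_scheme \<Rightarrow> 'm \<Rightarrow> bool" where
  "is_iso C f \<longleftrightarrow> f \<in> ar C \<and>
    (\<exists>g\<in>Hom C (tgt C f) (src C f).
      g \<odot>\<^bsub>C\<^esub> f = ide C (src C f) \<and> f \<odot>\<^bsub>C\<^esub> g = ide C (tgt C f))"


section \<open>Exact categories\<close>

definition has_finite_limits :: "('o, 'm, 'z) cat_scheme \<Rightarrow> bool" where
  "has_finite_limits C \<longleftrightarrow> (\<exists>T. is_terminal C T) \<and>
    (\<forall>f\<in>ar C. \<forall>g\<in>ar C. tgt C f = tgt C g \<longrightarrow> (\<exists>h k. is_pullback C f g h k))"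

definition is_coequalizer :: "('o, 'm, 'z) cat_scheme \<Rightarrow> 'm \<Rightarrow> 'm \<Rightarrow> 'm \<Rightarrow> bool" where
  "is_coequalizer C f g e \<longleftrightarrow>
    f \<in> ar C \<and> g \<in> Hom C (src C f) (tgt C f) \<and> e \<in> ar C \<and> src C e = tgt C f \<and>
    e \<odot>\<^bsub>C\<^esub> f = e \<odot>\<^bsub>C\<^esub> g \<and>
    (\<forall>Z. \<forall>u\<in>Hom C (tgt C f) Z. u \<odot>\<^bsub>C\<^esub> f = u \<odot>\<^bsub>C\<^esub> g \<longrightarrow>
      (\<exists>!w. w \<in> Hom C (tgt C e) Z \<and> w \<odot>\<^bsub>C\<^esub> e = u))"

definition regular_epi :: "('o, 'm, 'z) cat_scheme \<Rightarrow> 'm \<Rightarrow> bool" where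
  "regular_epi C e \<longleftrightarrow> (\<exists>f g. is_coequalizer C f g e)"

definition regular_category :: "('o, 'm, 'z) cat_scheme \<Rightarrow> bool" where
  "regular_category C \<longleftrightarrow> category C \<and> has_finite_limits C \<and>
    (\<forall>f p q. is_pullback C f f p q \<longrightarrow> (\<exists>e. is_coequalizer C p q e)) \<and>
    (\<forall>e f h k. regular_epi C e \<longrightarrow> is_pullback C e f h k \<longrightarrow> regular_epi C k)"

text \<open>The transitivity clause is stated on generalized elements.  As soon as the pullback of
  \<open>r2\<close> along \<open>r1\<close> exists, it says that there is one arrow from that pullback to the domain of
  \<open>r1\<close>, \<open>r2\<close> (lemma \<open>pseudo_equivalence_relation_pullback\<close>).\<close>

definition pseudo_equivalence_relation :: "('o, 'm, 'z) cat_scheme \<Rightarrow> 'm \<Rightarrow> 'm \<Rightarrow> bool" where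
  "pseudo_equivalence_relation C r1 r2 \<longleftrightarrow>
    (let R = src C r1; X = tgt C r1 in
      r1 \<in> Hom C R X \<and> r2 \<in> Hom C R X \<and>
      (\<exists>d\<in>Hom C X R. r1 \<odot>\<^bsub>C\<^esub> d = ide C X \<and> r2 \<odot>\<^bsub>C\<^esub> d = ide C X) \<and>
      (\<exists>s\<in>Hom C R R. r1 \<odot>\<^bsub>C\<^esub> s = r2 \<and> r2 \<odot>\<^bsub>C\<^esub> s = r1) \<and>
      (\<forall>Z. \<forall>u\<in>Hom C Z R. \<forall>v\<in>Hom C Z R. r2 \<odot>\<^bsub>C\<^esub> u = r1 \<odot>\<^bsub>C\<^esub> v \<longrightarrow>
        (\<exists>t\<in>Hom C Z R. r1 \<odot>\<^bsub>C\<^esub> t = r1 \<odot>\<^bsub>C\<^esub> u \<and> r2 \<odot>\<^bsub>C\<^esub> t = r2 \<odot>\<^bsub>C\<^esub> v)))"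

lemma pseudo_equivalence_relation_pullback:
  assumes "category C" and pb: "is_pullback C r2 r1 p q"
    and R: "r1 \<in> Hom C R X" "r2 \<in> Hom C R X"
  shows "pseudo_equivalence_relation C r1 r2 \<longleftrightarrow>
      (\<exists>d\<in>Hom C X R. r1 \<odot>\<^bsub>C\<^esub> d = ide C X \<and> r2 \<odot>\<^bsub>C\<^esub> d = ide C X) \<and>
      (\<exists>s\<in>Hom C R R. r1 \<odot>\<^bsub>C\<^esub> s = r2 \<and> r2 \<odot>\<^bsub>C\<^esub> s = r1) \<and>
      (\<exists>t\<in>Hom C (src C p) R. r1 \<odot>\<^bsub>C\<^esub> t = r1 \<odot>\<^bsub>C\<^esub> p \<and> r2 \<odot>\<^bsub>C\<^esub> t = r2 \<odot>\<^bsub>C\<^esub> q)"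
proof -
  interpret category C by fact
  have s: "src C r1 = R" "tgt C r1 = X" "src C r2 = R"
    using R by (auto simp: Hom_def)
  have p: "p \<in> Hom C (src C p) R" and q: "q \<in> Hom C (src C p) R"
    and pq: "r2 \<odot>\<^bsub>C\<^esub> p = r1 \<odot>\<^bsub>C\<^esub> q"
    and univ: "\<And>Z u v. u \<in> Hom C Z R \<Longrightarrow> v \<in> Hom C Z R \<Longrightarrow> r2 \<odot>\<^bsub>C\<^esub> u = r1 \<odot>\<^bsub>C\<^esub> v \<Longrightarrow>
      \<exists>w. w \<in> Hom C Z (src C p) \<and> p \<odot>\<^bsub>C\<^esub> w = u \<and> q \<odot>\<^bsub>C\<^esub> w = v"
    using pb s unfolding is_pullback_def by (simp_all only:) blast+
  have "(\<forall>Z. \<forall>u\<in>Hom C Z R. \<forall>v\<in>Hom C Z R. r2 \<odot>\<^bsub>C\<^esub> u = r1 \<odot>\<^bsub>C\<^esub> v \<longrightarrow>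
      (\<exists>t\<in>Hom C Z R. r1 \<odot>\<^bsub>C\<^esub> t = r1 \<odot>\<^bsub>C\<^esub> u \<and> r2 \<odot>\<^bsub>C\<^esub> t = r2 \<odot>\<^bsub>C\<^esub> v))
    \<longleftrightarrow> (\<exists>t\<in>Hom C (src C p) R. r1 \<odot>\<^bsub>C\<^esub> t = r1 \<odot>\<^bsub>C\<^esub> p \<and> r2 \<odot>\<^bsub>C\<^esub> t = r2 \<odot>\<^bsub>C\<^esub> q)"
    (is "?L \<longleftrightarrow> ?T")
  proof
    assume ?L then show ?T using p q pq by blast
  next
    assume ?T
    then obtain t where t: "t \<in> Hom C (src C p) R"
      "r1 \<odot>\<^bsub>C\<^esub> t = r1 \<odot>\<^bsub>C\<^esub> p" "r2 \<odot>\<^bsub>C\<^esub> t = r2 \<odot>\<^bsub>C\<^esub> q" by blast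
    show ?L
    proof (intro allI ballI impI)
      fix Z u v assume "u \<in> Hom C Z R" "v \<in> Hom C Z R" "r2 \<odot>\<^bsub>C\<^esub> u = r1 \<odot>\<^bsub>C\<^esub> v"
      then obtain w where w: "w \<in> Hom C Z (src C p)" "p \<odot>\<^bsub>C\<^esub> w = u" "q \<odot>\<^bsub>C\<^esub> w = v"
        using univ by blast
      have "r1 \<odot>\<^bsub>C\<^esub> (t \<odot>\<^bsub>C\<^esub> w) = r1 \<odot>\<^bsub>C\<^esub> u"
        using cmp_assoc[OF w(1) t(1) R(1)] cmp_assoc[OF w(1) p R(1)] t w by simp
      moreover have "r2 \<odot>\<^bsub>C\<^esub> (t \<odot>\<^bsub>C\<^esub> w) = r2 \<odot>\<^bsub>C\<^esub> v"
        using cmp_assoc[OF w(1) t(1) R(2)] cmp_assoc[OF w(1) q R(2)] t w by simp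
      ultimately show "\<exists>t\<in>Hom C Z R. r1 \<odot>\<^bsub>C\<^esub> t = r1 \<odot>\<^bsub>C\<^esub> u \<and> r2 \<odot>\<^bsub>C\<^esub> t = r2 \<odot>\<^bsub>C\<^esub> v"
        using cmp_Hom[OF w(1) t(1)] by blast
    qed
  qed
  then show ?thesis
    unfolding pseudo_equivalence_relation_def Let_def s using R by simp
qed

definition jointly_monic :: "('o, 'm, 'z) cat_scheme \<Rightarrow> 'm \<Rightarrow> 'm \<Rightarrow> bool" where
  "jointly_monic C r1 r2 \<longleftrightarrow>
    (\<forall>Z. \<forall>u\<in>Hom C Z (src C r1). \<forall>v\<in>Hom C Z (src C r1).
      r1 \<odot>\<^bsub>C\<^esub> u = r1 \<odot>\<^bsub>C\<^esub> v \<and> r2 \<odot>\<^bsub>C\<^esub> u = r2 \<odot>\<^bsub>C\<^esub> v \<longrightarrow> u = v)"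

definition equivalence_relation :: "('o, 'm, 'z) cat_scheme \<Rightarrow> 'm \<Rightarrow> 'm \<Rightarrow> bool" where
  "equivalence_relation C r1 r2 \<longleftrightarrow> pseudo_equivalence_relation C r1 r2 \<and> jointly_monic C r1 r2"

definition exact_category :: "('o, 'm, 'z) cat_scheme \<Rightarrow> bool" where
  "exact_category C \<longleftrightarrow> regular_category C \<and>
    (\<forall>r1 r2. equivalence_relation C r1 r2 \<longrightarrow> (\<exists>f. is_pullback C f f r1 r2))"

text \<open>A functor is given by its action \<open>Fo\<close> on objects and \<open>Fa\<close> on arrows.\<close>

definition is_functor ::
  "('o, 'm, 'z) cat_scheme \<Rightarrow> ('q, 'n, 'y) cat_scheme \<Rightarrow> ('o \<Rightarrow> 'q) \<Rightarrow> ('m \<Rightarrow> 'n) \<Rightarrow> bool" where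
  "is_functor C D Fo Fa \<longleftrightarrow>
    (\<forall>A\<in>ob C. Fo A \<in> ob D) \<and>
    (\<forall>f\<in>ar C. Fa f \<in> Hom D (Fo (src C f)) (Fo (tgt C f))) \<and>
    (\<forall>A\<in>ob C. Fa (ide C A) = ide D (Fo A)) \<and>
    (\<forall>f\<in>ar C. \<forall>g\<in>ar C. tgt C f = src C g \<longrightarrow> Fa (g \<odot>\<^bsub>C\<^esub> f) = Fa g \<odot>\<^bsub>D\<^esub> Fa f)"

definition exact_functor ::
  "('o, 'm, 'z) cat_scheme \<Rightarrow> ('q, 'n, 'y) cat_scheme \<Rightarrow> ('o \<Rightarrow> 'q) \<Rightarrow> ('m \<Rightarrow> 'n) \<Rightarrow> bool" where
  "exact_functor C D Fo Fa \<longleftrightarrow> is_functor C D Fo Fa \<and>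
    (\<forall>T. is_terminal C T \<longrightarrow> is_terminal D (Fo T)) \<and>
    (\<forall>f g h k. is_pullback C f g h k \<longrightarrow> is_pullback D (Fa f) (Fa g) (Fa h) (Fa k)) \<and>
    (\<forall>e. regular_epi C e \<longrightarrow> regular_epi D (Fa e))"

definition natural_iso ::
  "('o, 'm, 'z) cat_scheme \<Rightarrow> ('q, 'n, 'y) cat_scheme \<Rightarrow> ('o \<Rightarrow> 'q) \<Rightarrow> ('m \<Rightarrow> 'n)
    \<Rightarrow> ('o \<Rightarrow> 'q) \<Rightarrow> ('m \<Rightarrow> 'n) \<Rightarrow> ('o \<Rightarrow> 'n) \<Rightarrow> bool" where
  "natural_iso C D Fo Fa Go Ga \<tau> \<longleftrightarrow>
    (\<forall>A\<in>ob C. \<tau> A \<in> Hom D (Fo A) (Go A) \<and> is_iso D (\<tau> A)) \<and>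
    (\<forall>f\<in>ar C. \<tau> (tgt C f) \<odot>\<^bsub>D\<^esub> Fa f = Ga f \<odot>\<^bsub>D\<^esub> \<tau> (src C f))"

definition equivalent_exact_categories ::
  "('o, 'm, 'z) cat_scheme \<Rightarrow> ('q, 'n, 'y) cat_scheme \<Rightarrow> bool" where
  "equivalent_exact_categories C D \<longleftrightarrow> exact_category C \<and> exact_category D \<and>
    (\<exists>Fo Fa Go Ga \<eta> \<epsilon>. exact_functor C D Fo Fa \<and> exact_functor D C Go Ga \<and>
      natural_iso C C id id (Go \<circ> Fo) (Ga \<circ> Fa) \<eta> \<and>
      natural_iso D D (Fo \<circ> Go) (Fa \<circ> Ga) id id \<epsilon>)"


section \<open>The exact completion\<close>

text \<open>The construction of Carboni and Celia Magno: objects are the pseudo-equivalence relations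
  \<open>r1, r2 : R \<rightarrow> X\<close> of \<open>D\<close>; arrows to \<open>s1, s2 : S \<rightarrow> Y\<close> are the arrows \<open>f : X \<rightarrow> Y\<close> that lift to
  some \<open>R \<rightarrow> S\<close>, modulo \<open>f \<sim> g\<close> iff \<open>\<langle>f, g\<rangle>\<close> lifts along \<open>\<langle>s1, s2\<rangle>\<close>.  The formulas make sense for any
  category \<open>D\<close>; \<open>ex_lex D\<close> is the exact completion of \<open>D\<close> as a finitely complete category whenever \<open>D\<close> has
  finite limits.\<close>

type_synonym 'm ex_ob = "'m \<times> 'm"
type_synonym 'm ex_ar = "'m ex_ob \<times> 'm set \<times> 'm ex_ob"

fun ex_maps :: "('o, 'm, 'z) cat_scheme \<Rightarrow> 'm ex_ob \<Rightarrow> 'm ex_ob \<Rightarrow> 'm set" where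
  "ex_maps D (r1, r2) (s1, s2) =
    {f \<in> Hom D (tgt D r1) (tgt D s1).
      \<exists>k\<in>Hom D (src D r1) (src D s1).
        s1 \<odot>\<^bsub>D\<^esub> k = f \<odot>\<^bsub>D\<^esub> r1 \<and> s2 \<odot>\<^bsub>D\<^esub> k = f \<odot>\<^bsub>D\<^esub> r2}"

fun ex_eq :: "('o, 'm, 'z) cat_scheme \<Rightarrow> 'm ex_ob \<Rightarrow> 'm ex_ob \<Rightarrow> ('m \<times> 'm) set" where
  "ex_eq D (r1, r2) (s1, s2) =
    {(f, g). f \<in> ex_maps D (r1, r2) (s1, s2) \<and> g \<in> ex_maps D (r1, r2) (s1, s2) \<and>
      (\<exists>h\<in>Hom D (tgt D r1) (src D s1). s1 \<odot>\<^bsub>D\<^esub> h = f \<and> s2 \<odot>\<^bsub>D\<^esub> h = g)}"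

definition ex_lex :: "('o, 'm, 'z) cat_scheme \<Rightarrow> ('m ex_ob, 'm ex_ar) cat" where
  "ex_lex D =
    (let Ob = {(r1, r2). pseudo_equivalence_relation D r1 r2} in
    \<lparr> ob = Ob,
      ar = {(U, F, V). U \<in> Ob \<and> V \<in> Ob \<and> F \<in> ex_maps D U V // ex_eq D U V},
      src = (\<lambda>(U, F, V). U),
      tgt = (\<lambda>(U, F, V). V),
      ide = (\<lambda>U. (U, ex_eq D U U `` {ide D (tgt D (fst U))}, U)),
      cmp = (\<lambda>(V', G, W) (U, F, V). (U, \<Union>f\<in>F. \<Union>g\<in>G. ex_eq D U W `` {g \<odot>\<^bsub>D\<^esub> f}, W)) \<rparr>)"


section \<open>Finite products and exponentials\<close>

record ('o, 'm) fpcat = "('o, 'm) cat" +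
  one :: 'o
  prd :: "'o \<Rightarrow> 'o \<Rightarrow> 'o"
  pr1 :: "'o \<Rightarrow> 'o \<Rightarrow> 'm"
  pr2 :: "'o \<Rightarrow> 'o \<Rightarrow> 'm"

locale fp_category = category C for C :: "('o, 'm, 'z) fpcat_scheme" (structure) +
  assumes one_terminal: "is_terminal C (one C)"
    and prd_product: "A \<in> ob C \<Longrightarrow> B \<in> ob C \<Longrightarrow> is_product C A B (prd C A B) (pr1 C A B) (pr2 C A B)"

definition pair :: "('o, 'm, 'z) fpcat_scheme \<Rightarrow> 'm \<Rightarrow> 'm \<Rightarrow> 'm" where
  "pair C f g = (THE h. h \<in> Hom C (src C f) (prd C (tgt C f) (tgt C g)) \<and>
     pr1 C (tgt C f) (tgt C g) \<odot>\<^bsub>C\<^esub> h = f \<and> pr2 C (tgt C f) (tgt C g) \<odot>\<^bsub>C\<^esub> h = g)"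

text \<open>A projection is a leg of an arbitrary product cone, not just of a chosen one.  First legs
  suffice, since \<open>A \<times> B\<close> with its legs swapped is a product of \<open>B\<close> and \<open>A\<close>.\<close>

definition projection :: "('o, 'm, 'z) cat_scheme \<Rightarrow> 'm \<Rightarrow> bool" where
  "projection C \<pi> \<longleftrightarrow> (\<exists>q. is_product C (tgt C \<pi>) (tgt C q) (src C \<pi>) \<pi> q)"

definition cartesian_closed :: "('o, 'm, 'z) fpcat_scheme \<Rightarrow> bool" where
  "cartesian_closed C \<longleftrightarrow> fp_category C \<and>
    (\<forall>A\<in>ob C. \<forall>B\<in>ob C. \<exists>E\<in>ob C. \<exists>ev\<in>Hom C (prd C E A) B.
      \<forall>Z\<in>ob C. \<forall>f\<in>Hom C (prd C Z A) B.
        \<exists>!h. h \<in> Hom C Z E \<and> ev \<odot>\<^bsub>C\<^esub> pair C (h \<odot>\<^bsub>C\<^esub> pr1 C Z A) (pr2 C Z A) = f)"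


section \<open>Doctrines\<close>

text \<open>Fibres over different objects may overlap, and reindexing \<open>rei P f\<close> is only meaningful on
  the fibre over the codomain of \<open>f\<close>.\<close>

record ('o, 'm, 'p) doctr =
  base :: "('o, 'm) fpcat"
  fib :: "'o \<Rightarrow> 'p gorder"
  rei :: "'m \<Rightarrow> 'p \<Rightarrow> 'p"

abbreviation preds :: "('o, 'm, 'p) doctr \<Rightarrow> 'o \<Rightarrow> 'p set" where
  "preds P A \<equiv> carrier (fib P A)"

locale doctrine =
  fixes P :: "('o, 'm, 'p) doctr"
  assumes base_fp: "fp_category (base P)"
    and fib_poset: "A \<in> ob (base P) \<Longrightarrow> partial_order (fib P A)"
    and rei_closed: "f \<in> Hom (base P) A B \<Longrightarrow> rei P f \<in> preds P B \<rightarrow> preds P A"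
    and rei_mono: "f \<in> Hom (base P) A B \<Longrightarrow> isotone (fib P B) (fib P A) (rei P f)"
    and rei_ide: "A \<in> ob (base P) \<Longrightarrow> \<alpha> \<in> preds P A \<Longrightarrow> rei P (ide (base P) A) \<alpha> = \<alpha>"
    and rei_cmp: "f \<in> Hom (base P) A B \<Longrightarrow> g \<in> Hom (base P) B D \<Longrightarrow> \<alpha> \<in> preds P D
      \<Longrightarrow> rei P (g \<odot>\<^bsub>base P\<^esub> f) \<alpha> = rei P f (rei P g \<alpha>)"

definition has_left_adjoint :: "('o, 'm, 'p) doctr \<Rightarrow> 'm \<Rightarrow> bool" where
  "has_left_adjoint P f \<longleftrightarrow>
    (let A = src (base P) f; B = tgt (base P) f in
      \<exists>L \<in> preds P A \<rightarrow> preds P B. \<forall>\<alpha>\<in>preds P A. \<forall>\<beta>\<in>preds P B.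
        L \<alpha> \<sqsubseteq>\<^bsub>fib P B\<^esub> \<beta> \<longleftrightarrow> \<alpha> \<sqsubseteq>\<^bsub>fib P A\<^esub> rei P f \<beta>)"

definition has_right_adjoint :: "('o, 'm, 'p) doctr \<Rightarrow> 'm \<Rightarrow> bool" where
  "has_right_adjoint P f \<longleftrightarrow>
    (let A = src (base P) f; B = tgt (base P) f in
      \<exists>R \<in> preds P A \<rightarrow> preds P B. \<forall>\<alpha>\<in>preds P A. \<forall>\<beta>\<in>preds P B.
        \<beta> \<sqsubseteq>\<^bsub>fib P B\<^esub> R \<alpha> \<longleftrightarrow> rei P f \<beta> \<sqsubseteq>\<^bsub>fib P A\<^esub> \<alpha>)"

text \<open>The values of the left and right adjoint of \<open>rei P f\<close> at \<open>\<alpha>\<close>, where the adjoints exist.\<close>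

definition exq :: "('o, 'm, 'p) doctr \<Rightarrow> 'm \<Rightarrow> 'p \<Rightarrow> 'p" where
  "exq P f \<alpha> =
    (let A = src (base P) f; B = tgt (base P) f in
      THE \<gamma>. \<gamma> \<in> preds P B \<and>
        (\<forall>\<beta>\<in>preds P B. \<gamma> \<sqsubseteq>\<^bsub>fib P B\<^esub> \<beta> \<longleftrightarrow> \<alpha> \<sqsubseteq>\<^bsub>fib P A\<^esub> rei P f \<beta>))"

definition allq :: "('o, 'm, 'p) doctr \<Rightarrow> 'm \<Rightarrow> 'p \<Rightarrow> 'p" where
  "allq P f \<alpha> =
    (let A = src (base P) f; B = tgt (base P) f in
      THE \<gamma>. \<gamma> \<in> preds P B \<and>
        (\<forall>\<beta>\<in>preds P B. \<beta> \<sqsubseteq>\<^bsub>fib P B\<^esub> \<gamma> \<longleftrightarrow> rei P f \<beta> \<sqsubseteq>\<^bsub>fib P A\<^esub> \<alpha>))"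

definition existential :: "('o, 'm, 'p) doctr \<Rightarrow> bool" where
  "existential P \<longleftrightarrow> doctrine P \<and>
    (\<forall>\<pi>. projection (base P) \<pi> \<longrightarrow> has_left_adjoint P \<pi>) \<and>
    (\<forall>\<pi> f f' \<pi>'. projection (base P) \<pi> \<and> projection (base P) \<pi>' \<and> is_pullback (base P) \<pi> f f' \<pi>' \<longrightarrow>
      (\<forall>\<beta>\<in>preds P (src (base P) \<pi>). exq P \<pi>' (rei P f' \<beta>) = rei P f (exq P \<pi> \<beta>)))"

definition universal :: "('o, 'm, 'p) doctr \<Rightarrow> bool" where
  "universal P \<longleftrightarrow> doctrine P \<and>
    (\<forall>\<pi>. projection (base P) \<pi> \<longrightarrow> has_right_adjoint P \<pi>) \<and>
    (\<forall>\<pi> f f' \<pi>'. projection (base P) \<pi> \<and> projection (base P) \<pi>' \<and> is_pullback (base P) \<pi> f f' \<pi>' \<longrightarrow>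
      (\<forall>\<beta>\<in>preds P (src (base P) \<pi>). allq P \<pi>' (rei P f' \<beta>) = rei P f (allq P \<pi> \<beta>)))"


section \<open>Quantifier-free predicates, Skolem and Goedel doctrines\<close>

definition existential_splitting :: "('o, 'm, 'p) doctr \<Rightarrow> 'o \<Rightarrow> 'p \<Rightarrow> bool" where
  "existential_splitting P A \<alpha> \<longleftrightarrow> \<alpha> \<in> preds P A \<and>
    (\<forall>B\<in>ob (base P). \<forall>\<beta>\<in>preds P (prd (base P) A B).
      \<alpha> \<sqsubseteq>\<^bsub>fib P A\<^esub> exq P (pr1 (base P) A B) \<beta> \<longrightarrow>
      (\<exists>g\<in>Hom (base P) A B. \<alpha> \<sqsubseteq>\<^bsub>fib P A\<^esub> rei P (pair (base P) (ide (base P) A) g) \<beta>))"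

definition existential_free :: "('o, 'm, 'p) doctr \<Rightarrow> 'o \<Rightarrow> 'p \<Rightarrow> bool" where
  "existential_free P I \<alpha> \<longleftrightarrow> \<alpha> \<in> preds P I \<and>
    (\<forall>A\<in>ob (base P). \<forall>f\<in>Hom (base P) A I. existential_splitting P A (rei P f \<alpha>))"

definition enough_existential_free :: "('o, 'm, 'p) doctr \<Rightarrow> bool" where
  "enough_existential_free P \<longleftrightarrow>
    (\<forall>I\<in>ob (base P). \<forall>\<alpha>\<in>preds P I. \<exists>A\<in>ob (base P). \<exists>\<beta>.
      existential_free P (prd (base P) I A) \<beta> \<and> \<alpha> = exq P (pr1 (base P) I A) \<beta>)"

definition existential_free_doctrine :: "('o, 'm, 'p) doctr \<Rightarrow> ('o, 'm, 'p) doctr" where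
  "existential_free_doctrine P =
    P\<lparr>fib := \<lambda>A. (fib P A)\<lparr>carrier := {\<alpha>. existential_free P A \<alpha>}\<rparr>\<rparr>"

definition universal_splitting :: "('o, 'm, 'p) doctr \<Rightarrow> 'o \<Rightarrow> 'p \<Rightarrow> bool" where
  "universal_splitting P A \<alpha> \<longleftrightarrow> \<alpha> \<in> preds P A \<and>
    (\<forall>B\<in>ob (base P). \<forall>\<beta>\<in>preds P (prd (base P) A B).
      allq P (pr1 (base P) A B) \<beta> \<sqsubseteq>\<^bsub>fib P A\<^esub> \<alpha> \<longrightarrow>
      (\<exists>g\<in>Hom (base P) A B. rei P (pair (base P) (ide (base P) A) g) \<beta> \<sqsubseteq>\<^bsub>fib P A\<^esub> \<alpha>))"

definition universal_free :: "('o, 'm, 'p) doctr \<Rightarrow> 'o \<Rightarrow> 'p \<Rightarrow> bool" where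
  "universal_free P I \<alpha> \<longleftrightarrow> \<alpha> \<in> preds P I \<and>
    (\<forall>A\<in>ob (base P). \<forall>f\<in>Hom (base P) A I. universal_splitting P A (rei P f \<alpha>))"

definition enough_universal_free :: "('o, 'm, 'p) doctr \<Rightarrow> bool" where
  "enough_universal_free P \<longleftrightarrow>
    (\<forall>I\<in>ob (base P). \<forall>\<alpha>\<in>preds P I. \<exists>A\<in>ob (base P). \<exists>\<beta>.
      universal_free P (prd (base P) I A) \<beta> \<and> \<alpha> = allq P (pr1 (base P) I A) \<beta>)"

definition skolem_doctrine :: "('o, 'm, 'p) doctr \<Rightarrow> bool" where
  "skolem_doctrine P \<longleftrightarrow>
    cartesian_closed (base P) \<and> existential P \<and> universal P \<and> enough_existential_free P \<and>
    (\<forall>\<pi> \<alpha>. projection (base P) \<pi> \<and> existential_free P (src (base P) \<pi>) \<alpha> \<longrightarrow>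
      existential_free P (tgt (base P) \<pi>) (allq P \<pi> \<alpha>))"

definition goedel_doctrine :: "('o, 'm, 'p) doctr \<Rightarrow> bool" where
  "goedel_doctrine P \<longleftrightarrow>
    skolem_doctrine P \<and> enough_universal_free (existential_free_doctrine P)"


section \<open>First-order hyperdoctrines\<close>

definition is_implication :: "('p, 'z) gorder_scheme \<Rightarrow> 'p \<Rightarrow> 'p \<Rightarrow> 'p \<Rightarrow> bool" where
  "is_implication L x y z \<longleftrightarrow> z \<in> carrier L \<and>
    (\<forall>w\<in>carrier L. w \<sqsubseteq>\<^bsub>L\<^esub> z \<longleftrightarrow> w \<sqinter>\<^bsub>L\<^esub> x \<sqsubseteq>\<^bsub>L\<^esub> y)"

definition implication :: "('p, 'z) gorder_scheme \<Rightarrow> 'p \<Rightarrow> 'p \<Rightarrow> 'p" where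
  "implication L x y = (THE z. is_implication L x y z)"

locale heyting_algebra = bounded_lattice +
  assumes implication_exists:
    "x \<in> carrier L \<Longrightarrow> y \<in> carrier L \<Longrightarrow> \<exists>z. is_implication L x y z"

definition heyting_hom ::
  "('p, 'z) gorder_scheme \<Rightarrow> ('q, 'y) gorder_scheme \<Rightarrow> ('p \<Rightarrow> 'q) \<Rightarrow> bool" where
  "heyting_hom L M h \<longleftrightarrow> h \<in> carrier L \<rightarrow> carrier M \<and>
    h \<top>\<^bsub>L\<^esub> = \<top>\<^bsub>M\<^esub> \<and> h \<bottom>\<^bsub>L\<^esub> = \<bottom>\<^bsub>M\<^esub> \<and>
    (\<forall>x\<in>carrier L. \<forall>y\<in>carrier L.
      h (x \<sqinter>\<^bsub>L\<^esub> y) = h x \<sqinter>\<^bsub>M\<^esub> h y \<and>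
      h (x \<squnion>\<^bsub>L\<^esub> y) = h x \<squnion>\<^bsub>M\<^esub> h y \<and>
      h (implication L x y) = implication M (h x) (h y))"

locale first_order_hyperdoctrine = doctrine P for P :: "('o, 'm, 'p) doctr" +
  assumes fib_heyting: "A \<in> ob (base P) \<Longrightarrow> heyting_algebra (fib P A)"
    and rei_heyting: "f \<in> Hom (base P) A B \<Longrightarrow> heyting_hom (fib P B) (fib P A) (rei P f)"
    and Ex_adjoint: "f \<in> ar (base P) \<Longrightarrow> has_left_adjoint P f"
    and All_adjoint: "f \<in> ar (base P) \<Longrightarrow> has_right_adjoint P f"
    and Ex_beck_chevalley: "is_pullback (base P) f g h k \<Longrightarrow> \<alpha> \<in> preds P (src (base P) f)
      \<Longrightarrow> exq P k (rei P h \<alpha>) = rei P g (exq P f \<alpha>)"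
    and All_beck_chevalley: "is_pullback (base P) f g h k \<Longrightarrow> \<alpha> \<in> preds P (src (base P) f)
      \<Longrightarrow> allq P k (rei P h \<alpha>) = rei P g (allq P f \<alpha>)"

definition goedel_first_order_hyperdoctrine :: "('o, 'm, 'p) doctr \<Rightarrow> bool" where
  "goedel_first_order_hyperdoctrine P \<longleftrightarrow> first_order_hyperdoctrine P \<and> goedel_doctrine P"


section \<open>The category of existential-free predicates\<close>

definition eq_pred :: "('o, 'm, 'p) doctr \<Rightarrow> 'o \<Rightarrow> 'p" where
  "eq_pred P A = exq P (pair (base P) (ide (base P) A) (ide (base P) A)) \<top>\<^bsub>fib P A\<^esub>"

text \<open>\<open>sub2 P \<phi> f g\<close> is the substitution \<open>\<phi>(f(x), g(x))\<close>.\<close>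

definition sub2 :: "('o, 'm, 'p) doctr \<Rightarrow> 'p \<Rightarrow> 'm \<Rightarrow> 'm \<Rightarrow> 'p" where
  "sub2 P \<phi> f g = rei P (pair (base P) f g) \<phi>"

type_synonym ('o, 'p) pred_ob = "'o \<times> 'p"
type_synonym ('o, 'm, 'p) pred_ar = "('o, 'p) pred_ob \<times> 'm set \<times> ('o, 'p) pred_ob"

fun pred_maps :: "('o, 'm, 'p) doctr \<Rightarrow> ('o, 'p) pred_ob \<Rightarrow> ('o, 'p) pred_ob \<Rightarrow> 'm set" where
  "pred_maps P (A, \<alpha>) (B, \<beta>) = {f \<in> Hom (base P) A B. \<alpha> \<sqsubseteq>\<^bsub>fib P A\<^esub> rei P f \<beta>}"

fun pred_eq :: "('o, 'm, 'p) doctr \<Rightarrow> ('o, 'p) pred_ob \<Rightarrow> ('o, 'p) pred_ob \<Rightarrow> ('m \<times> 'm) set" where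
  "pred_eq P (A, \<alpha>) (B, \<beta>) =
    {(f, g). f \<in> pred_maps P (A, \<alpha>) (B, \<beta>) \<and> g \<in> pred_maps P (A, \<alpha>) (B, \<beta>) \<and>
      \<alpha> \<sqsubseteq>\<^bsub>fib P A\<^esub> sub2 P (eq_pred P B) f g}"

definition Pred_existential_free ::
  "('o, 'm, 'p) doctr \<Rightarrow> (('o, 'p) pred_ob, ('o, 'm, 'p) pred_ar) cat" where
  "Pred_existential_free P =
    (let Ob = {(A, \<alpha>). A \<in> ob (base P) \<and> existential_free P A \<alpha>} in
    \<lparr> ob = Ob,
      ar = {(X, F, Y). X \<in> Ob \<and> Y \<in> Ob \<and> F \<in> pred_maps P X Y // pred_eq P X Y},
      src = (\<lambda>(X, F, Y). X),
      tgt = (\<lambda>(X, F, Y). Y),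
      ide = (\<lambda>X. (X, pred_eq P X X `` {ide (base P) (fst X)}, X)),
      cmp = (\<lambda>(Y', G, Z) (X, F, Y).
        (X, \<Union>f\<in>F. \<Union>g\<in>G. pred_eq P X Z `` {g \<odot>\<^bsub>base P\<^esub> f}, Z)) \<rparr>)"


section \<open>The tripos-to-topos construction\<close>

text \<open>Contexts with three variables are left-nested products: a context \<open>a:A, b:B, c:D\<close> is
  \<open>(A \<times> B) \<times> D\<close>, with the variables given by the following projections.\<close>

definition var1 :: "('o, 'm, 'z) fpcat_scheme \<Rightarrow> 'o \<Rightarrow> 'o \<Rightarrow> 'o \<Rightarrow> 'm" where
  "var1 C A B D = pr1 C A B \<odot>\<^bsub>C\<^esub> pr1 C (prd C A B) D"

definition var2 :: "('o, 'm, 'z) fpcat_scheme \<Rightarrow> 'o \<Rightarrow> 'o \<Rightarrow> 'o \<Rightarrow> 'm" where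
  "var2 C A B D = pr2 C A B \<odot>\<^bsub>C\<^esub> pr1 C (prd C A B) D"

definition var3 :: "('o, 'm, 'z) fpcat_scheme \<Rightarrow> 'o \<Rightarrow> 'o \<Rightarrow> 'o \<Rightarrow> 'm" where
  "var3 C A B D = pr2 C (prd C A B) D"

definition partial_equivalence :: "('o, 'm, 'p) doctr \<Rightarrow> 'o \<Rightarrow> 'p \<Rightarrow> bool" where
  "partial_equivalence P A \<rho> \<longleftrightarrow>
    (let C = base P in
      \<rho> \<in> preds P (prd C A A) \<and>
      \<rho> \<sqsubseteq>\<^bsub>fib P (prd C A A)\<^esub> sub2 P \<rho> (pr2 C A A) (pr1 C A A) \<and>
      (let L = fib P (prd C (prd C A A) A);
           a1 = var1 C A A A; a2 = var2 C A A A; a3 = var3 C A A A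
       in sub2 P \<rho> a1 a2 \<sqinter>\<^bsub>L\<^esub> sub2 P \<rho> a2 a3 \<sqsubseteq>\<^bsub>L\<^esub> sub2 P \<rho> a1 a3))"

definition functional_relation ::
  "('o, 'm, 'p) doctr \<Rightarrow> 'o \<times> 'p \<Rightarrow> 'o \<times> 'p \<Rightarrow> 'p \<Rightarrow> bool" where
  "functional_relation P X Y \<phi> \<longleftrightarrow>
    (case X of (A, \<rho>) \<Rightarrow> case Y of (B, \<sigma>) \<Rightarrow> let C = base P in
      \<phi> \<in> preds P (prd C A B) \<and>
      (let L = fib P (prd C A B); a = pr1 C A B; b = pr2 C A B
       in \<phi> \<sqsubseteq>\<^bsub>L\<^esub> sub2 P \<rho> a a \<sqinter>\<^bsub>L\<^esub> sub2 P \<sigma> b b) \<and>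
      (let L = fib P (prd C (prd C A A) B);
           a1 = var1 C A A B; a2 = var2 C A A B; b = var3 C A A B
       in sub2 P \<rho> a1 a2 \<sqinter>\<^bsub>L\<^esub> sub2 P \<phi> a1 b \<sqsubseteq>\<^bsub>L\<^esub> sub2 P \<phi> a2 b) \<and>
      (let L = fib P (prd C (prd C A B) B);
           a = var1 C A B B; b1 = var2 C A B B; b2 = var3 C A B B
       in sub2 P \<sigma> b1 b2 \<sqinter>\<^bsub>L\<^esub> sub2 P \<phi> a b1 \<sqsubseteq>\<^bsub>L\<^esub> sub2 P \<phi> a b2 \<and>
          sub2 P \<phi> a b1 \<sqinter>\<^bsub>L\<^esub> sub2 P \<phi> a b2 \<sqsubseteq>\<^bsub>L\<^esub> sub2 P \<sigma> b1 b2) \<and>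
      sub2 P \<rho> (ide C A) (ide C A) \<sqsubseteq>\<^bsub>fib P A\<^esub> exq P (pr1 C A B) \<phi>)"

text \<open>The composite \<open>\<exists>b:B. \<phi>(a,b) \<and> \<psi>(b,c)\<close> is formed in the context \<open>a:A, c:D, b:B\<close> and
  quantified along its projection to \<open>A \<times> D\<close>.\<close>

definition relational_composite ::
  "('o, 'm, 'p) doctr \<Rightarrow> 'o \<Rightarrow> 'o \<Rightarrow> 'o \<Rightarrow> 'p \<Rightarrow> 'p \<Rightarrow> 'p" where
  "relational_composite P A B D \<phi> \<psi> =
    (let C = base P; a = var1 C A D B; c = var2 C A D B; b = var3 C A D B
     in exq P (pr1 C (prd C A D) B)
          (sub2 P \<phi> a b \<sqinter>\<^bsub>fib P (prd C (prd C A D) B)\<^esub> sub2 P \<psi> b c))"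

type_synonym ('o, 'p) per_ob = "'o \<times> 'p"
type_synonym ('o, 'p) per_ar = "('o, 'p) per_ob \<times> 'p \<times> ('o, 'p) per_ob"

definition tripos_to_topos ::
  "('o, 'm, 'p) doctr \<Rightarrow> (('o, 'p) per_ob, ('o, 'p) per_ar) cat" where
  "tripos_to_topos P =
    (let Ob = {(A, \<rho>). A \<in> ob (base P) \<and> partial_equivalence P A \<rho>} in
    \<lparr> ob = Ob,
      ar = {(X, \<phi>, Y). X \<in> Ob \<and> Y \<in> Ob \<and> functional_relation P X Y \<phi>},
      src = (\<lambda>(X, \<phi>, Y). X),
      tgt = (\<lambda>(X, \<phi>, Y). Y),
      ide = (\<lambda>X. (X, snd X, X)),
      cmp = (\<lambda>(Y', \<psi>, Z) (X, \<phi>, Y).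
        (X, relational_composite P (fst X) (fst Y) (fst Z) \<phi> \<psi>, Z)) \<rparr>)"

end

theory Submission
  imports Defs
begin

text \<open>A stage is an existential-free predicate \<open>(Z, \<zeta>)\<close>, and a predicate \<open>\<phi>\<close> over \<open>A\<close> holds at that stage of a
  generalized element \<open>a : Z \<rightarrow> A\<close> when \<open>\<zeta> \<turnstile> \<phi>(a)\<close>.  Conjunction is computed pointwise in this semantics and,
  by existential-freeness of \<open>\<zeta>\<close>, so is the existential quantifier; as there are enough existential-free
  predicates, entailment is detected by the stages.  Regular logic in \<open>P\<close> thus becomes reasoning about
  ordinary relations, one for each stage, which makes the exactness of the tripos-to-topos construction
  elementary.  Sending \<open>(A, \<alpha>)\<close> to \<open>A\<close> with the partial equivalence relation \<open>\<alpha>(a) \<and> a = a'\<close> is a full and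
  faithful functor \<open>J\<close> whose values are projective, because \<open>(A, \<alpha>)\<close> is itself a stage carrying a generic
  element, and they cover every object.  An exact category with such a projective cover is the exact
  completion of the cover: a pseudo-equivalence relation is sent to the quotient of its image under \<open>J\<close>.
  All limits are formed in the exact category and then covered by values of \<open>J\<close>, so that finite limits of
  existential-free predicates never enter.\<close>


section \<open>Equivalences of categories\<close>

text \<open>In Kripke-Joyal semantics an existential statement holds at a stage only after passing
  to a cover of that stage. Existential-free stages are projective in this sense: splitting yields
  the witness at the stage itself, as an arrow of the base. So no covers of stages occur, a
  functional relation really assigns values, and surjectivity is plain surjectivity at each stage.
  The price is that a stage-indexed family of relations need not be a predicate, so each relation
  from which an object or arrow is built must be shown definable; truth, conjunction and the
  existential quantifier suffice. Implication enters once, in Leibniz' law with a parameter, where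
  it does the work of Frobenius reciprocity. On the categorical side the functor is built from the
  exact completion to the topos. Neither the category laws nor the exactness of the completion is
  checked on representatives: the laws come back along a faithful assignment, exactness along the
  equivalence. The quasi-inverse is chosen afterwards and, being an equivalence too, is exact by the
  same lemma.\<close>

context category
begin

section \<open>Composition, universal properties and isomorphisms in a category\<close>

lemma HomD:
  assumes "f \<in> Hom C A B"
  shows "f \<in> ar C" "src C f = A" "tgt C f = B" "A \<in> ob C" "B \<in> ob C"
  using assms src_ob tgt_ob by (auto simp: Hom_def)

lemma ar_Hom: "f \<in> ar C \<Longrightarrow> f \<in> Hom C (src C f) (tgt C f)"
  by (simp add: Hom_def)

lemma cmp_simps [simp]:
  assumes "f \<in> ar C" "g \<in> ar C" "tgt C f = src C g"
  shows "g \<odot> f \<in> ar C" "src C (g \<odot> f) = src C f" "tgt C (g \<odot> f) = tgt C g"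
  using cmp_Hom[of f "src C f" "tgt C f" g "tgt C g"] assms by (auto simp: Hom_def)

lemma ide_simps [simp]:
  "A \<in> ob C \<Longrightarrow> ide C A \<in> ar C" "A \<in> ob C \<Longrightarrow> src C (ide C A) = A" "A \<in> ob C \<Longrightarrow> tgt C (ide C A) = A"
  "f \<in> ar C \<Longrightarrow> tgt C f = B \<Longrightarrow> ide C B \<odot> f = f" "f \<in> ar C \<Longrightarrow> src C f = A \<Longrightarrow> f \<odot> ide C A = f"
  using ide_Hom cmp_ide_left cmp_ide_right by (auto simp: Hom_def)

text \<open>Endpoint conditions are stated with \<open>src\<close> and \<open>tgt\<close>, so that
  simplification discharges them once \<open>Hom_def\<close> is unfolded. \<open>assocl\<close>
  nests composites to the left, \<open>assocr\<close> to the right; a simplifier call uses one of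
  the two.\<close>

lemma assocl:
  assumes "f \<in> ar C" "g \<in> ar C" "h \<in> ar C" "tgt C f = src C g" "tgt C g = src C h"
  shows "h \<odot> (g \<odot> f) = h \<odot> g \<odot> f"
  using cmp_assoc[of f "src C f" "src C g" g "src C h" h "tgt C h"] assms by (simp add: Hom_def)

lemmas assocr = assocl[symmetric]

text \<open>The unique existence in \<open>is_pullback_def\<close> is split into existence of a
  mediating arrow and joint monicity of the legs; the latter is what makes the mediating arrow
  unique.\<close>

lemma pullbackI:
  assumes "f \<in> Hom C A D" "g \<in> Hom C B D" "h \<in> Hom C W A" "k \<in> Hom C W B" "f \<odot> h = g \<odot> k"
    and "\<And>V u v. u \<in> Hom C V A \<Longrightarrow> v \<in> Hom C V B \<Longrightarrow> f \<odot> u = g \<odot> v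
      \<Longrightarrow> \<exists>w\<in>Hom C V W. h \<odot> w = u \<and> k \<odot> w = v"
    and "\<And>V w w'. w \<in> Hom C V W \<Longrightarrow> w' \<in> Hom C V W \<Longrightarrow> h \<odot> w = h \<odot> w' \<Longrightarrow> k \<odot> w = k \<odot> w'
      \<Longrightarrow> w = w'"
  shows "is_pullback C f g h k"
proof -
  have "src C h = W" "src C f = A" "src C g = B" "tgt C f = tgt C g" "f \<in> ar C" "g \<in> ar C"
    using assms(1-4) by (auto simp: Hom_def)
  then show ?thesis
    unfolding is_pullback_def using assms by (simp, metis)
qed

lemma pullbackE:
  assumes "is_pullback C f g h k"
  obtains A B D W where "f \<in> Hom C A D" "g \<in> Hom C B D" "h \<in> Hom C W A" "k \<in> Hom C W B"
    "f \<odot> h = g \<odot> k"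
    and "\<And>V u v. u \<in> Hom C V A \<Longrightarrow> v \<in> Hom C V B \<Longrightarrow> f \<odot> u = g \<odot> v
      \<Longrightarrow> \<exists>w\<in>Hom C V W. h \<odot> w = u \<and> k \<odot> w = v"
    and "\<And>V w w'. w \<in> Hom C V W \<Longrightarrow> w' \<in> Hom C V W \<Longrightarrow> h \<odot> w = h \<odot> w' \<Longrightarrow> k \<odot> w = k \<odot> w'
      \<Longrightarrow> w = w'"
proof
  let ?A = "src C f" and ?B = "src C g" and ?D = "tgt C f" and ?W = "src C h"
  show f: "f \<in> Hom C ?A ?D" and g: "g \<in> Hom C ?B ?D" and h: "h \<in> Hom C ?W ?A"
    and k: "k \<in> Hom C ?W ?B" and e: "f \<odot> h = g \<odot> k"
    using assms by (auto simp: is_pullback_def Hom_def)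
  have uni: "\<exists>!w. w \<in> Hom C V ?W \<and> h \<odot> w = u \<and> k \<odot> w = v"
    if "u \<in> Hom C V ?A" "v \<in> Hom C V ?B" "f \<odot> u = g \<odot> v" for V u v
    using assms that unfolding is_pullback_def by blast
  then show "\<exists>w\<in>Hom C V ?W. h \<odot> w = u \<and> k \<odot> w = v"
    if "u \<in> Hom C V ?A" "v \<in> Hom C V ?B" "f \<odot> u = g \<odot> v" for V u v
    using that by blast
  show "w = w'"
    if w: "w \<in> Hom C V ?W" "w' \<in> Hom C V ?W" "h \<odot> w = h \<odot> w'" "k \<odot> w = k \<odot> w'" for V w w'
  proof -
    \<comment> \<open>The pair \<open>h \<odot> w\<close>, \<open>k \<odot> w\<close> is itself a
      cone, and both \<open>w\<close> and \<open>w'\<close> mediate it, so the universal property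
      makes them equal.\<close>
    have "f \<odot> (h \<odot> w) = g \<odot> (k \<odot> w)"
      using w f g h k e by (simp add: Hom_def assocl)
    then have "\<exists>!x. x \<in> Hom C V ?W \<and> h \<odot> x = h \<odot> w \<and> k \<odot> x = k \<odot> w"
      using uni[OF cmp_Hom[OF w(1) h] cmp_Hom[OF w(1) k]] by blast
    then show ?thesis
      using w by (metis (no_types, lifting))
  qed
qed

lemma coequalizerI:
  assumes "f \<in> Hom C A B" "g \<in> Hom C A B" "e \<in> Hom C B Q" "e \<odot> f = e \<odot> g"
    and "\<And>Z u. u \<in> Hom C B Z \<Longrightarrow> u \<odot> f = u \<odot> g \<Longrightarrow> \<exists>w\<in>Hom C Q Z. w \<odot> e = u"
    and "\<And>Z w w'. w \<in> Hom C Q Z \<Longrightarrow> w' \<in> Hom C Q Z \<Longrightarrow> w \<odot> e = w' \<odot> e \<Longrightarrow> w = w'"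
  shows "is_coequalizer C f g e"
proof -
  have "src C f = A" "tgt C f = B" "src C e = B" "tgt C e = Q" "f \<in> ar C" "e \<in> ar C"
    using assms(1-4) by (auto simp: Hom_def)
  then show ?thesis
    unfolding is_coequalizer_def using assms by (simp, metis)
qed

lemma coequalizerE:
  assumes "is_coequalizer C f g e"
  obtains A B Q where "f \<in> Hom C A B" "g \<in> Hom C A B" "e \<in> Hom C B Q" "e \<odot> f = e \<odot> g"
    and "\<And>Z u. u \<in> Hom C B Z \<Longrightarrow> u \<odot> f = u \<odot> g \<Longrightarrow> \<exists>w\<in>Hom C Q Z. w \<odot> e = u"
    and "\<And>Z w w'. w \<in> Hom C Q Z \<Longrightarrow> w' \<in> Hom C Q Z \<Longrightarrow> w \<odot> e = w' \<odot> e \<Longrightarrow> w = w'"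
proof
  let ?A = "src C f" and ?B = "tgt C f" and ?Q = "tgt C e"
  show f: "f \<in> Hom C ?A ?B" and g: "g \<in> Hom C ?A ?B" and e: "e \<in> Hom C ?B ?Q"
    and eq: "e \<odot> f = e \<odot> g"
    using assms by (auto simp: is_coequalizer_def Hom_def)
  have uni: "\<exists>!w. w \<in> Hom C ?Q Z \<and> w \<odot> e = u"
    if "u \<in> Hom C ?B Z" "u \<odot> f = u \<odot> g" for Z u
    using assms that unfolding is_coequalizer_def by blast
  then show "\<exists>w\<in>Hom C ?Q Z. w \<odot> e = u" if "u \<in> Hom C ?B Z" "u \<odot> f = u \<odot> g" for Z u
    using that by blast
  show "w = w'" if w: "w \<in> Hom C ?Q Z" "w' \<in> Hom C ?Q Z" "w \<odot> e = w' \<odot> e" for Z w w'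
  proof -
    \<comment> \<open>Dually, \<open>w \<odot> e\<close> coequalizes the pair, and \<open>w\<close>
      and \<open>w'\<close> are both factorizations of it.\<close>
    have "(w \<odot> e) \<odot> f = (w \<odot> e) \<odot> g"
      using w f g e eq by (simp add: Hom_def assocr)
    then have "\<exists>!x. x \<in> Hom C ?Q Z \<and> x \<odot> e = w \<odot> e"
      using uni[OF cmp_Hom[OF e w(1)]] by blast
    then show ?thesis
      using w by (metis (no_types, lifting))
  qed
qed

lemma pseudo_equivalence_relationI:
  assumes "r1 \<in> Hom C R X" "r2 \<in> Hom C R X"
    and "\<exists>d\<in>Hom C X R. r1 \<odot> d = ide C X \<and> r2 \<odot> d = ide C X"
    and "\<exists>s\<in>Hom C R R. r1 \<odot> s = r2 \<and> r2 \<odot> s = r1"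
    and "\<And>Z u v. u \<in> Hom C Z R \<Longrightarrow> v \<in> Hom C Z R \<Longrightarrow> r2 \<odot> u = r1 \<odot> v \<Longrightarrow>
      \<exists>t\<in>Hom C Z R. r1 \<odot> t = r1 \<odot> u \<and> r2 \<odot> t = r2 \<odot> v"
  shows "pseudo_equivalence_relation C r1 r2"
proof -
  have "src C r1 = R" "tgt C r1 = X"
    using assms(1) by (auto simp: Hom_def)
  then show ?thesis
    unfolding pseudo_equivalence_relation_def Let_def using assms by simp
qed

lemma pseudo_equivalence_relationE:
  assumes "pseudo_equivalence_relation C r1 r2"
  obtains R X where "r1 \<in> Hom C R X" "r2 \<in> Hom C R X"
    and "\<exists>d\<in>Hom C X R. r1 \<odot> d = ide C X \<and> r2 \<odot> d = ide C X"
    and "\<exists>s\<in>Hom C R R. r1 \<odot> s = r2 \<and> r2 \<odot> s = r1"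
    and "\<And>Z u v. u \<in> Hom C Z R \<Longrightarrow> v \<in> Hom C Z R \<Longrightarrow> r2 \<odot> u = r1 \<odot> v \<Longrightarrow>
      \<exists>t\<in>Hom C Z R. r1 \<odot> t = r1 \<odot> u \<and> r2 \<odot> t = r2 \<odot> v"
  using assms that unfolding pseudo_equivalence_relation_def Let_def by blast

lemma isoI:
  assumes "f \<in> Hom C A B" "g \<in> Hom C B A" "g \<odot> f = ide C A" "f \<odot> g = ide C B"
  shows "is_iso C f"
proof -
  have "f \<in> ar C" "src C f = A" "tgt C f = B"
    using assms(1) by (auto simp: Hom_def)
  then show ?thesis
    unfolding is_iso_def using assms by auto
qed

text \<open>A split epimorphism cancels: compose with its section \<open>e'\<close> on the
  right.\<close>

lemma iso_cancel:
  assumes "e \<in> Hom C A B" "e' \<in> Hom C B A" "e \<odot> e' = ide C B"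
    and "u \<in> Hom C B Z" "v \<in> Hom C B Z" "u \<odot> e = v \<odot> e"
  shows "u = v"
proof -
  have "u \<odot> e \<odot> e' = v \<odot> e \<odot> e'"
    using assms(6) by simp
  then show ?thesis
    using assms(1-5) by (simp add: Hom_def assocr)
qed

lemma iso_cancel_left:
  assumes "e \<in> Hom C A B" "e' \<in> Hom C B A" "e' \<odot> e = ide C A"
    and "u \<in> Hom C Z A" "v \<in> Hom C Z A" "e \<odot> u = e \<odot> v"
  shows "u = v"
proof -
  have "e' \<odot> (e \<odot> u) = e' \<odot> (e \<odot> v)"
    using assms(6) by simp
  then show ?thesis
    using assms(1-5) by (simp add: Hom_def assocl)
qed

text \<open>The vertex of a pullback of arrows in the image of an equivalence is only isomorphic to
  a value of the functor; this lemma replaces the vertex.\<close>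

lemma pullback_iso:
  assumes pb: "is_pullback C f g h k" and "src C h = W"
    and e: "e \<in> Hom C V W" "e' \<in> Hom C W V" "e' \<odot> e = ide C V" "e \<odot> e' = ide C W"
  shows "is_pullback C f g (h \<odot> e) (k \<odot> e)"
  using pb
proof (rule pullbackE)
  fix A B D U
  assume f: "f \<in> Hom C A D" and g: "g \<in> Hom C B D" and h: "h \<in> Hom C U A" and k: "k \<in> Hom C U B"
    and eq: "f \<odot> h = g \<odot> k"
    and ex: "\<And>V u v. u \<in> Hom C V A \<Longrightarrow> v \<in> Hom C V B \<Longrightarrow> f \<odot> u = g \<odot> v
      \<Longrightarrow> \<exists>w\<in>Hom C V U. h \<odot> w = u \<and> k \<odot> w = v"
    and un: "\<And>V w w'. w \<in> Hom C V U \<Longrightarrow> w' \<in> Hom C V U \<Longrightarrow> h \<odot> w = h \<odot> w' \<Longrightarrow> k \<odot> w = k \<odot> w'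
      \<Longrightarrow> w = w'"
  have U: "U = W" using h assms(2) by (simp add: Hom_def)
  show ?thesis
  proof (rule pullbackI[OF f g])
    show "h \<odot> e \<in> Hom C V A" "k \<odot> e \<in> Hom C V B"
      using h k e U cmp_Hom by auto
    show "f \<odot> (h \<odot> e) = g \<odot> (k \<odot> e)"
      using f g h k e(1) eq unfolding U by (simp add: Hom_def assocl)
    show "\<exists>w\<in>Hom C Z V. h \<odot> e \<odot> w = u \<and> k \<odot> e \<odot> w = v"
      if uv: "u \<in> Hom C Z A" "v \<in> Hom C Z B" "f \<odot> u = g \<odot> v" for Z u v
    proof -
      obtain w where w: "w \<in> Hom C Z W" "h \<odot> w = u" "k \<odot> w = v"
        using ex[OF uv] U by auto
      have "e \<odot> (e' \<odot> w) = w"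
        using w e by (simp add: Hom_def assocl)
      then have "h \<odot> e \<odot> (e' \<odot> w) = u" "k \<odot> e \<odot> (e' \<odot> w) = v"
        using w e h k unfolding U by (simp_all add: Hom_def assocr)
      then show ?thesis
        using cmp_Hom[OF w(1) e(2)] by blast
    qed
    show "w = w'"
      if w: "w \<in> Hom C Z V" "w' \<in> Hom C Z V" "h \<odot> e \<odot> w = h \<odot> e \<odot> w'" "k \<odot> e \<odot> w = k \<odot> e \<odot> w'"
      for Z w w'
    proof -
      have "e \<odot> w = e \<odot> w'"
        by (rule un[unfolded U, of _ Z]) (use w h[unfolded U] k[unfolded U] e(1) in \<open>simp_all add: Hom_def assocl\<close>)
      then have "(e' \<odot> e) \<odot> w = (e' \<odot> e) \<odot> w'"
        using w(1,2) e(1,2) by (simp add: Hom_def assocr)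
      then show ?thesis
        using w(1,2) e(3) cmp_ide_left by simp
    qed
  qed
qed

end

text \<open>The same replacement, for the codomain of a coequalizer.\<close>

lemma (in category) coequalizer_iso:
  assumes ce: "is_coequalizer C f g e" and "tgt C e = Q"
    and i: "i \<in> Hom C Q V" "i' \<in> Hom C V Q" "i' \<odot> i = ide C Q" "i \<odot> i' = ide C V"
  shows "is_coequalizer C f g (i \<odot> e)"
  using ce
proof (rule coequalizerE)
  fix A B Q'
  assume f: "f \<in> Hom C A B" and g: "g \<in> Hom C A B" and e: "e \<in> Hom C B Q'"
    and eq: "e \<odot> f = e \<odot> g"
    and ex: "\<And>Z u. u \<in> Hom C B Z \<Longrightarrow> u \<odot> f = u \<odot> g \<Longrightarrow> \<exists>w\<in>Hom C Q' Z. w \<odot> e = u"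
    and un: "\<And>Z w w'. w \<in> Hom C Q' Z \<Longrightarrow> w' \<in> Hom C Q' Z \<Longrightarrow> w \<odot> e = w' \<odot> e \<Longrightarrow> w = w'"
  have Q: "Q' = Q" using e assms(2) by (simp add: Hom_def)
  note e = e[unfolded Q] and ex = ex[unfolded Q] and un = un[unfolded Q]
  show ?thesis
  proof (rule coequalizerI[OF f g])
    show "i \<odot> e \<in> Hom C B V"
      using e i cmp_Hom by auto
    show "i \<odot> e \<odot> f = i \<odot> e \<odot> g"
      using f g e i(1) eq by (simp add: Hom_def assocr)
    show "\<exists>w\<in>Hom C V Z. w \<odot> (i \<odot> e) = u" if u: "u \<in> Hom C B Z" "u \<odot> f = u \<odot> g" for Z u
    proof -
      obtain w where w: "w \<in> Hom C Q Z" "w \<odot> e = u"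
        using ex[OF u] by auto
      have "i' \<odot> (i \<odot> e) = e"
        using e i by (simp add: Hom_def assocl)
      then have "(w \<odot> i') \<odot> (i \<odot> e) = u"
        using w e i by (simp add: Hom_def assocr)
      then show ?thesis
        using cmp_Hom[OF i(2) w(1)] by blast
    qed
    show "w = w'"
      if w: "w \<in> Hom C V Z" "w' \<in> Hom C V Z" "w \<odot> (i \<odot> e) = w' \<odot> (i \<odot> e)" for Z w w'
    proof -
      have "w \<odot> i = w' \<odot> i"
        by (rule un[of _ Z]) (use w e i in \<open>simp_all add: Hom_def assocr\<close>)
      then show ?thesis
        using iso_cancel[OF i(1,2,4) w(1,2)] by simp
    qed
  qed
qed

section \<open>Full and faithful functors and what they reflect\<close>

locale ff_functor = S: category C + T: category D
  for C :: "('o, 'm, 'z) cat_scheme" and D :: "('q, 'n, 'y) cat_scheme"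
    and Fo :: "'o \<Rightarrow> 'q" and Fa :: "'m \<Rightarrow> 'n" +
  assumes is_functor: "is_functor C D Fo Fa"
    and full: "A \<in> ob C \<Longrightarrow> B \<in> ob C \<Longrightarrow> h \<in> Hom D (Fo A) (Fo B) \<Longrightarrow> \<exists>f\<in>Hom C A B. Fa f = h"
    and faithful: "f \<in> Hom C A B \<Longrightarrow> g \<in> Hom C A B \<Longrightarrow> Fa f = Fa g \<Longrightarrow> f = g"
begin

abbreviation source_cmp (infixl "\<cdot>" 70) where "g \<cdot> f \<equiv> g \<odot>\<^bsub>C\<^esub> f"
abbreviation target_cmp (infixl "\<star>" 70) where "g \<star> f \<equiv> g \<odot>\<^bsub>D\<^esub> f"

lemma F_ob: "A \<in> ob C \<Longrightarrow> Fo A \<in> ob D"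
  using is_functor by (simp add: is_functor_def)

lemma F_Hom: "f \<in> Hom C A B \<Longrightarrow> Fa f \<in> Hom D (Fo A) (Fo B)"
  using is_functor by (auto simp: is_functor_def Hom_def)

lemma F_ide: "A \<in> ob C \<Longrightarrow> Fa (ide C A) = ide D (Fo A)"
  using is_functor by (simp add: is_functor_def)

lemma F_cmp: "f \<in> Hom C A B \<Longrightarrow> g \<in> Hom C B E \<Longrightarrow> Fa (g \<cdot> f) = Fa g \<star> Fa f"
  using is_functor by (auto simp: is_functor_def Hom_def)

text \<open>An equation between composites can be moved along the functor in both directions. The
  middle objects \<open>B\<close> and \<open>B'\<close> may differ, as in a commuting
  square.\<close>

lemma reflect_eq:
  assumes "f \<in> Hom C A B" "g \<in> Hom C B E" "f' \<in> Hom C A B'" "g' \<in> Hom C B' E"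
  shows "Fa g \<star> Fa f = Fa g' \<star> Fa f' \<longleftrightarrow> g \<cdot> f = g' \<cdot> f'"
  unfolding F_cmp[OF assms(1,2), symmetric] F_cmp[OF assms(3,4), symmetric]
  using faithful[OF S.cmp_Hom[OF assms(1,2)] S.cmp_Hom[OF assms(3,4)]] by auto

lemma reflect_eq1:
  assumes "f \<in> Hom C A B" "g \<in> Hom C B E" "h \<in> Hom C A E"
  shows "Fa g \<star> Fa f = Fa h \<longleftrightarrow> g \<cdot> f = h"
  unfolding F_cmp[OF assms(1,2), symmetric]
  using faithful[OF S.cmp_Hom[OF assms(1,2)] assms(3)] by auto

text \<open>A cone in the source is mapped to one in the target; fullness lifts the mediating arrow
  found there, and faithfulness gives back commutativity and uniqueness.\<close>

lemma reflect_pullback: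
  assumes f: "f \<in> Hom C A E" and g: "g \<in> Hom C B E" and h: "h \<in> Hom C W A" and k: "k \<in> Hom C W B"
    and pb: "is_pullback D (Fa f) (Fa g) (Fa h) (Fa k)"
  shows "is_pullback C f g h k"
  using pb
proof (rule T.pullbackE)
  fix A' B' E' W'
  assume F: "Fa f \<in> Hom D A' E'" "Fa g \<in> Hom D B' E'" "Fa h \<in> Hom D W' A'" "Fa k \<in> Hom D W' B'"
    and eq: "Fa f \<star> Fa h = Fa g \<star> Fa k"
    and ex: "\<And>V u v. u \<in> Hom D V A' \<Longrightarrow> v \<in> Hom D V B' \<Longrightarrow> Fa f \<star> u = Fa g \<star> v
      \<Longrightarrow> \<exists>w\<in>Hom D V W'. Fa h \<star> w = u \<and> Fa k \<star> w = v"
    and un: "\<And>V w w'. w \<in> Hom D V W' \<Longrightarrow> w' \<in> Hom D V W' \<Longrightarrow> Fa h \<star> w = Fa h \<star> w'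
      \<Longrightarrow> Fa k \<star> w = Fa k \<star> w' \<Longrightarrow> w = w'"
  have ob: "A' = Fo A" "B' = Fo B" "E' = Fo E" "W' = Fo W"
    using F F_Hom[OF f] F_Hom[OF g] F_Hom[OF h] by (auto simp: Hom_def)
  show ?thesis
  proof (rule S.pullbackI[OF f g h k])
    show "f \<cdot> h = g \<cdot> k"
      using eq reflect_eq[OF h f k g] by simp
    show "\<exists>w\<in>Hom C V W. h \<cdot> w = u \<and> k \<cdot> w = v"
      if u: "u \<in> Hom C V A" and v: "v \<in> Hom C V B" and uv: "f \<cdot> u = g \<cdot> v" for V u v
    proof -
      obtain w where w: "w \<in> Hom D (Fo V) (Fo W)"
        "Fa h \<star> w = Fa u" "Fa k \<star> w = Fa v"
        using ex[of "Fa u" "Fo V" "Fa v"] u v uv F_Hom reflect_eq[OF u f v g] ob by auto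
      obtain w' where "w' \<in> Hom C V W" "Fa w' = w"
        using full[OF _ _ w(1)] u h S.HomD(4) by blast
      then show ?thesis
        using w reflect_eq1[OF _ h u] reflect_eq1[OF _ k v] by blast
    qed
    show "w = w'"
      if w: "w \<in> Hom C V W" "w' \<in> Hom C V W"
        and e: "h \<cdot> w = h \<cdot> w'" "k \<cdot> w = k \<cdot> w'" for V w w'
    proof -
      have "Fa w = Fa w'"
        by (rule un) (use w e F_Hom ob reflect_eq[OF w(1) h w(2) h] reflect_eq[OF w(1) k w(2) k] in auto)
      then show ?thesis
        using faithful[OF w] by simp
    qed
  qed
qed

lemma reflect_coequalizer:
  assumes f: "f \<in> Hom C A B" and g: "g \<in> Hom C A B" and e: "e \<in> Hom C B Q"
    and ce: "is_coequalizer D (Fa f) (Fa g) (Fa e)"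
  shows "is_coequalizer C f g e"
  using ce
proof (rule T.coequalizerE)
  fix A' B' Q'
  assume F: "Fa f \<in> Hom D A' B'" "Fa g \<in> Hom D A' B'" "Fa e \<in> Hom D B' Q'"
    and eq: "Fa e \<star> Fa f = Fa e \<star> Fa g"
    and ex: "\<And>Z u. u \<in> Hom D B' Z \<Longrightarrow> u \<star> Fa f = u \<star> Fa g
      \<Longrightarrow> \<exists>w\<in>Hom D Q' Z. w \<star> Fa e = u"
    and un: "\<And>Z w w'. w \<in> Hom D Q' Z \<Longrightarrow> w' \<in> Hom D Q' Z \<Longrightarrow> w \<star> Fa e = w' \<star> Fa e
      \<Longrightarrow> w = w'"
  have ob: "A' = Fo A" "B' = Fo B" "Q' = Fo Q"
    using F F_Hom[OF f] F_Hom[OF e] by (auto simp: Hom_def)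
  show ?thesis
  proof (rule S.coequalizerI[OF f g e])
    show "e \<cdot> f = e \<cdot> g"
      using eq reflect_eq[OF f e g e] by simp
    show "\<exists>w\<in>Hom C Q Z. w \<cdot> e = u" if u: "u \<in> Hom C B Z" "u \<cdot> f = u \<cdot> g" for Z u
    proof -
      obtain w where w: "w \<in> Hom D (Fo Q) (Fo Z)" "w \<star> Fa e = Fa u"
        using ex[of "Fa u" "Fo Z"] u F_Hom reflect_eq[OF f u(1) g u(1)] ob by auto
      obtain w' where "w' \<in> Hom C Q Z" "Fa w' = w"
        using full[OF _ _ w(1)] u e S.HomD(5) by blast
      then show ?thesis
        using w reflect_eq1[OF e _ u(1)] by blast
    qed
    show "w = w'"
      if w: "w \<in> Hom C Q Z" "w' \<in> Hom C Q Z" "w \<cdot> e = w' \<cdot> e" for Z w w'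
    proof -
      have "Fa w = Fa w'"
        by (rule un) (use w F_Hom ob reflect_eq[OF e w(1) e w(2)] in auto)
      then show ?thesis
        using faithful[OF w(1,2)] by simp
    qed
  qed
qed

end

section \<open>Exact structure along an equivalence\<close>

locale equivalence = ff_functor +
  assumes eso: "Z \<in> ob D \<Longrightarrow> \<exists>A\<in>ob C. \<exists>e\<in>Hom D (Fo A) Z. \<exists>e'\<in>Hom D Z (Fo A).
      e' \<star> e = ide D (Fo A) \<and> e \<star> e' = ide D Z"
begin

lemma preserve_terminal:
  assumes "is_terminal C X"
  shows "is_terminal D (Fo X)"
  unfolding is_terminal_def
proof (intro conjI ballI)
  have X: "X \<in> ob C" and un: "\<And>A. A \<in> ob C \<Longrightarrow> \<exists>!f. f \<in> Hom C A X"
    using assms by (auto simp: is_terminal_def)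
  show "Fo X \<in> ob D"
    using X by (rule F_ob)
  fix Z assume "Z \<in> ob D"
  then obtain A e e' where e: "A \<in> ob C" "e \<in> Hom D (Fo A) Z" "e' \<in> Hom D Z (Fo A)"
    "e' \<star> e = ide D (Fo A)" "e \<star> e' = ide D Z"
    using eso by blast
  obtain f where f: "f \<in> Hom C A X"
    using un e(1) by blast
  show "\<exists>!f. f \<in> Hom D Z (Fo X)"
  proof (rule ex1I)
    show "Fa f \<star> e' \<in> Hom D Z (Fo X)"
      using e f F_Hom T.cmp_Hom by blast
    fix g assume g: "g \<in> Hom D Z (Fo X)"
    obtain g' where g': "g' \<in> Hom C A X" "Fa g' = g \<star> e"
      using full[OF e(1) X] T.cmp_Hom[OF e(2) g] by blast
    have "g' = f" using un e(1) f g' by blast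
    then show "g = Fa f \<star> e'"
      using g' e g by (simp add: Hom_def T.assocr)
  qed
qed

lemma reflect_terminal:
  assumes "X \<in> ob C" "is_terminal D (Fo X)"
  shows "is_terminal C X"
  using assms unfolding is_terminal_def
  by (metis F_Hom F_ob faithful full)

text \<open>A test object \<open>V\<close> of \<open>D\<close> need not be a value of
  \<open>Fo\<close>, but some \<open>e : Fo X \<rightarrow> V\<close> is invertible. Composing with
  \<open>e\<close> moves the cone into the image, where \<open>C\<close> supplies the mediating
  arrow; composing with \<open>e'\<close> moves that arrow back.\<close>

lemma preserve_pullback:
  assumes "is_pullback C f g h k"
  shows "is_pullback D (Fa f) (Fa g) (Fa h) (Fa k)"
  using assms
proof (rule S.pullbackE)
  fix A B E W
  assume f: "f \<in> Hom C A E" and g: "g \<in> Hom C B E" and h: "h \<in> Hom C W A" and k: "k \<in> Hom C W B"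
    and eq: "f \<cdot> h = g \<cdot> k"
    and ex: "\<And>V u v. u \<in> Hom C V A \<Longrightarrow> v \<in> Hom C V B \<Longrightarrow> f \<cdot> u = g \<cdot> v
      \<Longrightarrow> \<exists>w\<in>Hom C V W. h \<cdot> w = u \<and> k \<cdot> w = v"
    and un: "\<And>V w w'. w \<in> Hom C V W \<Longrightarrow> w' \<in> Hom C V W \<Longrightarrow> h \<cdot> w = h \<cdot> w'
      \<Longrightarrow> k \<cdot> w = k \<cdot> w' \<Longrightarrow> w = w'"
  note ob = S.HomD(4)[OF h] S.HomD(5)[OF h] S.HomD(5)[OF k]
  note F = F_Hom[OF f] F_Hom[OF g] F_Hom[OF h] F_Hom[OF k]
  show ?thesis
  proof (rule T.pullbackI[OF F])
    show "Fa f \<star> Fa h = Fa g \<star> Fa k"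
      using eq reflect_eq[OF h f k g] by simp
    show "\<exists>w\<in>Hom D V (Fo W). Fa h \<star> w = u \<and> Fa k \<star> w = v"
      if u: "u \<in> Hom D V (Fo A)" and v: "v \<in> Hom D V (Fo B)"
        and uv: "Fa f \<star> u = Fa g \<star> v" for V u v
    proof -
      obtain X e e' where e: "X \<in> ob C" "e \<in> Hom D (Fo X) V" "e' \<in> Hom D V (Fo X)"
        "e' \<star> e = ide D (Fo X)" "e \<star> e' = ide D V"
        using eso[OF T.HomD(4)[OF u]] by blast
      obtain u' where u': "u' \<in> Hom C X A" "Fa u' = u \<star> e"
        using full[OF e(1) ob(2)] T.cmp_Hom[OF e(2) u] by blast
      obtain v' where v': "v' \<in> Hom C X B" "Fa v' = v \<star> e"
        using full[OF e(1) ob(3)] T.cmp_Hom[OF e(2) v] by blast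
      have "Fa f \<star> Fa u' = Fa g \<star> Fa v'"
        using uv u v e(2) F u' v' by (simp add: Hom_def T.assocl)
      then obtain w where w: "w \<in> Hom C X W" "h \<cdot> w = u'" "k \<cdot> w = v'"
        using ex[OF u'(1) v'(1)] reflect_eq[OF u'(1) f v'(1) g] by blast
      have "Fa h \<star> Fa w = u \<star> e" "Fa k \<star> Fa w = v \<star> e"
        using F_cmp[OF w(1) h] F_cmp[OF w(1) k] w(2,3) u'(2) v'(2) by auto
      then have "Fa h \<star> (Fa w \<star> e') = u" "Fa k \<star> (Fa w \<star> e') = v"
        using F F_Hom[OF w(1)] e(2-5) u v by (simp_all add: Hom_def T.assocl) (simp_all add: T.assocr)
      then show ?thesis
        using T.cmp_Hom[OF e(3) F_Hom[OF w(1)]] by blast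
    qed
    show "w = w'"
      if w: "w \<in> Hom D V (Fo W)" "w' \<in> Hom D V (Fo W)"
        and hk: "Fa h \<star> w = Fa h \<star> w'" "Fa k \<star> w = Fa k \<star> w'" for V w w'
    proof -
      obtain X e e' where e: "X \<in> ob C" "e \<in> Hom D (Fo X) V" "e' \<in> Hom D V (Fo X)"
        "e' \<star> e = ide D (Fo X)" "e \<star> e' = ide D V"
        using eso[OF T.HomD(4)[OF w(1)]] by blast
      obtain v where v: "v \<in> Hom C X W" "Fa v = w \<star> e"
        using full[OF e(1) ob(1)] T.cmp_Hom[OF e(2) w(1)] by blast
      obtain v' where v': "v' \<in> Hom C X W" "Fa v' = w' \<star> e"
        using full[OF e(1) ob(1)] T.cmp_Hom[OF e(2) w(2)] by blast
      have "Fa h \<star> Fa v = Fa h \<star> Fa v'" "Fa k \<star> Fa v = Fa k \<star> Fa v'"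
        using hk v v' F e(2) w by (simp_all add: Hom_def T.assocl)
      then have "v = v'"
        using un[OF v(1) v'(1)] reflect_eq[OF v(1) h v'(1) h] reflect_eq[OF v(1) k v'(1) k] by simp
      then show ?thesis
        using T.iso_cancel[OF e(2,3,5) w] v v' by simp
    qed
  qed
qed

text \<open>Here the codomain of the cocone is replaced: \<open>u\<close> is composed with
  \<open>e'\<close> on the left, and the factorization found in \<open>C\<close> is composed with
  \<open>e\<close> to return.\<close>

lemma preserve_coequalizer:
  assumes "is_coequalizer C f g q"
  shows "is_coequalizer D (Fa f) (Fa g) (Fa q)"
  using assms
proof (rule S.coequalizerE)
  fix A B Q
  assume f: "f \<in> Hom C A B" and g: "g \<in> Hom C A B" and q: "q \<in> Hom C B Q"
    and eq: "q \<cdot> f = q \<cdot> g"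
    and ex: "\<And>Z u. u \<in> Hom C B Z \<Longrightarrow> u \<cdot> f = u \<cdot> g \<Longrightarrow> \<exists>w\<in>Hom C Q Z. w \<cdot> q = u"
    and un: "\<And>Z w w'. w \<in> Hom C Q Z \<Longrightarrow> w' \<in> Hom C Q Z \<Longrightarrow> w \<cdot> q = w' \<cdot> q \<Longrightarrow> w = w'"
  note ob = S.HomD(4)[OF q] S.HomD(5)[OF q]
  note F = F_Hom[OF f] F_Hom[OF g] F_Hom[OF q]
  show ?thesis
  proof (rule T.coequalizerI[OF F])
    show "Fa q \<star> Fa f = Fa q \<star> Fa g"
      using eq reflect_eq[OF f q g q] by simp
    show "\<exists>w\<in>Hom D (Fo Q) Z. w \<star> Fa q = u"
      if u: "u \<in> Hom D (Fo B) Z" and uu: "u \<star> Fa f = u \<star> Fa g" for Z u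
    proof -
      obtain X e e' where e: "X \<in> ob C" "e \<in> Hom D (Fo X) Z" "e' \<in> Hom D Z (Fo X)"
        "e' \<star> e = ide D (Fo X)" "e \<star> e' = ide D Z"
        using eso[OF T.HomD(5)[OF u]] by blast
      obtain u' where u': "u' \<in> Hom C B X" "Fa u' = e' \<star> u"
        using full[OF ob(1) e(1)] T.cmp_Hom[OF u e(3)] by blast
      have "Fa u' \<star> Fa f = Fa u' \<star> Fa g"
        using uu u e(3) F u' by (simp add: Hom_def T.assocr)
      then obtain w where w: "w \<in> Hom C Q X" "w \<cdot> q = u'"
        using ex[OF u'(1)] reflect_eq[OF f u'(1) g u'(1)] by blast
      have "Fa w \<star> Fa q = e' \<star> u"
        using F_cmp[OF q w(1)] w(2) u'(2) by auto
      then have "(e \<star> Fa w) \<star> Fa q = u"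
        using F F_Hom[OF w(1)] e(2-5) u by (simp add: Hom_def T.assocr) (simp add: T.assocl)
      then show ?thesis
        using T.cmp_Hom[OF F_Hom[OF w(1)] e(2)] by blast
    qed
    show "w = w'"
      if w: "w \<in> Hom D (Fo Q) Z" "w' \<in> Hom D (Fo Q) Z" and ww: "w \<star> Fa q = w' \<star> Fa q" for Z w w'
    proof -
      obtain X e e' where e: "X \<in> ob C" "e \<in> Hom D (Fo X) Z" "e' \<in> Hom D Z (Fo X)"
        "e' \<star> e = ide D (Fo X)" "e \<star> e' = ide D Z"
        using eso[OF T.HomD(5)[OF w(1)]] by blast
      obtain v where v: "v \<in> Hom C Q X" "Fa v = e' \<star> w"
        using full[OF ob(2) e(1)] T.cmp_Hom[OF w(1) e(3)] by blast
      obtain v' where v': "v' \<in> Hom C Q X" "Fa v' = e' \<star> w'"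
        using full[OF ob(2) e(1)] T.cmp_Hom[OF w(2) e(3)] by blast
      have "Fa v \<star> Fa q = Fa v' \<star> Fa q"
        using ww v v' F e(3) w by (simp add: Hom_def T.assocr)
      then have "v = v'"
        using un[OF v(1) v'(1)] reflect_eq[OF q v(1) q v'(1)] by simp
      then show ?thesis
        using T.iso_cancel_left[OF e(3,2,5) w] v v' by simp
    qed
  qed
qed

lemma preserve_regular_epi: "regular_epi C e \<Longrightarrow> regular_epi D (Fa e)"
  unfolding regular_epi_def using preserve_coequalizer by blast

lemma exact_functor: "exact_functor C D Fo Fa"
  unfolding exact_functor_def
  using is_functor preserve_terminal preserve_pullback preserve_regular_epi by blast

lemma lift_arrow_into:
  assumes "h \<in> Hom D W (Fo A)" "A \<in> ob C"
  obtains V e e' h' where "V \<in> ob C" "e \<in> Hom D (Fo V) W" "e' \<in> Hom D W (Fo V)"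
    "e' \<star> e = ide D (Fo V)" "e \<star> e' = ide D W" "h' \<in> Hom C V A" "Fa h' = h \<star> e"
  using eso[OF T.HomD(4)[OF assms(1)]] full[OF _ assms(2)] T.cmp_Hom[OF _ assms(1)] by metis

text \<open>The pair coequalized by \<open>Fa q\<close> lives in \<open>D\<close> and may start
  outside the image. Its domain is replaced by an isomorphic \<open>Fo V\<close>; precomposing both
  arrows with an isomorphism does not change their coequalizers, and the new pair lifts to
  \<open>C\<close>.\<close>

lemma reflect_regular_epi:
  assumes q: "q \<in> Hom C B Q" and re: "regular_epi D (Fa q)"
  shows "regular_epi C q"
proof -
  obtain f g where ce: "is_coequalizer D f g (Fa q)"
    using re unfolding regular_epi_def by blast
  show ?thesis
    using ce
  proof (rule T.coequalizerE)
    fix A B' Q'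
    assume f: "f \<in> Hom D A B'" and g: "g \<in> Hom D A B'" and Fq: "Fa q \<in> Hom D B' Q'"
      and eq: "Fa q \<star> f = Fa q \<star> g"
      and ex: "\<And>Z u. u \<in> Hom D B' Z \<Longrightarrow> u \<star> f = u \<star> g
        \<Longrightarrow> \<exists>w\<in>Hom D Q' Z. w \<star> Fa q = u"
      and un: "\<And>Z w w'. w \<in> Hom D Q' Z \<Longrightarrow> w' \<in> Hom D Q' Z \<Longrightarrow> w \<star> Fa q = w' \<star> Fa q
        \<Longrightarrow> w = w'"
    have B: "B' = Fo B"
      using F_Hom[OF q] Fq by (auto simp: Hom_def)
    obtain V e e' f' where e: "V \<in> ob C" "e \<in> Hom D (Fo V) A" "e' \<in> Hom D A (Fo V)"
      "e' \<star> e = ide D (Fo V)" "e \<star> e' = ide D A" "f' \<in> Hom C V B" "Fa f' = f \<star> e"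
      using lift_arrow_into[OF f[unfolded B] S.HomD(4)[OF q]] by metis
    obtain g' where g': "g' \<in> Hom C V B" "Fa g' = g \<star> e"
      using full[OF e(1) S.HomD(4)[OF q]] T.cmp_Hom[OF e(2) g[unfolded B]] by blast
    have "is_coequalizer D (f \<star> e) (g \<star> e) (Fa q)"
    proof (rule T.coequalizerI)
      show "f \<star> e \<in> Hom D (Fo V) B'" "g \<star> e \<in> Hom D (Fo V) B'"
        using e f g T.cmp_Hom by auto
      show "Fa q \<star> (f \<star> e) = Fa q \<star> (g \<star> e)"
        using eq f g e Fq by (simp add: Hom_def T.assocl)
      show "\<exists>w\<in>Hom D Q' Z. w \<star> Fa q = u"
        if u: "u \<in> Hom D B' Z" "u \<star> (f \<star> e) = u \<star> (g \<star> e)" for Z u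
      proof (rule ex[OF u(1)])
        have "(u \<star> f) \<star> e = (u \<star> g) \<star> e"
          using u f g e(2) by (simp add: Hom_def T.assocl)
        then show "u \<star> f = u \<star> g"
          using T.iso_cancel[OF e(2,3,5) T.cmp_Hom[OF f u(1)] T.cmp_Hom[OF g u(1)]] by blast
      qed
    qed (use Fq un in auto)
    then have "is_coequalizer C f' g' q"
      using reflect_coequalizer[OF e(6) g'(1) q] e g' by simp
    then show ?thesis
      unfolding regular_epi_def by blast
  qed
qed

text \<open>Each clause follows one pattern: map the data to \<open>D\<close>, use exactness there,
  replace the object obtained by an isomorphic value of \<open>Fo\<close>, and reflect. A category
  thus inherits exactness from one to which it is equivalent.\<close>

lemma reflect_exact:
  assumes "exact_category D"
  shows "exact_category C"
proof -
  have reg: "has_finite_limits D" "\<And>f p q. is_pullback D f f p q \<Longrightarrow> \<exists>e. is_coequalizer D p q e"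
    "\<And>e f h k. regular_epi D e \<Longrightarrow> is_pullback D e f h k \<Longrightarrow> regular_epi D k"
    and eff: "\<And>r1 r2. equivalence_relation D r1 r2 \<Longrightarrow> \<exists>f. is_pullback D f f r1 r2"
    using assms unfolding exact_category_def regular_category_def by blast+
  have "\<exists>X. is_terminal C X"
  proof -
    obtain Z where Z: "is_terminal D Z"
      using reg(1) unfolding has_finite_limits_def by blast
    then have "Z \<in> ob D" by (simp add: is_terminal_def)
    then obtain A e e' where e: "A \<in> ob C" "e \<in> Hom D (Fo A) Z" "e' \<in> Hom D Z (Fo A)"
      "e' \<star> e = ide D (Fo A)" "e \<star> e' = ide D Z"
      using eso by blast
    have "is_terminal D (Fo A)"
      unfolding is_terminal_def
    proof (intro conjI ballI)
      show "Fo A \<in> ob D" using e(1) F_ob by blast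
      fix B assume B: "B \<in> ob D"
      obtain f where f: "f \<in> Hom D B Z" and un: "\<And>g. g \<in> Hom D B Z \<Longrightarrow> g = f"
        using Z B unfolding is_terminal_def by blast
      show "\<exists>!f. f \<in> Hom D B (Fo A)"
      proof (rule ex1I)
        show "e' \<star> f \<in> Hom D B (Fo A)"
          using f e T.cmp_Hom by blast
        fix g assume g: "g \<in> Hom D B (Fo A)"
        then have "e \<star> g = f"
          using un T.cmp_Hom e by blast
        then show "g = e' \<star> f"
          using g e by (auto simp: Hom_def T.assocl)
      qed
    qed
    then show ?thesis
      using reflect_terminal[OF e(1)] by blast
  qed
  moreover have "\<exists>h k. is_pullback C f g h k"
    if f: "f \<in> ar C" and g: "g \<in> ar C" and fg: "tgt C f = tgt C g" for f g
  proof -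
    let ?A = "src C f" and ?B = "src C g" and ?E = "tgt C f"
    have f: "f \<in> Hom C ?A ?E" and g: "g \<in> Hom C ?B ?E"
      using f g fg by (auto simp: Hom_def)
    note ob = S.HomD(4)[OF f] S.HomD(4)[OF g]
    obtain h k where hk: "is_pullback D (Fa f) (Fa g) h k"
      using reg(1) T.HomD(1,3)[OF F_Hom[OF f]] T.HomD(1,3)[OF F_Hom[OF g]]
      unfolding has_finite_limits_def by metis
    define W where "W = src D h"
    have h: "h \<in> Hom D W (Fo ?A)" and k: "k \<in> Hom D W (Fo ?B)"
      using hk F_Hom[OF f] F_Hom[OF g] unfolding is_pullback_def W_def Hom_def by auto
    obtain V e e' h' where e: "V \<in> ob C" "e \<in> Hom D (Fo V) W" "e' \<in> Hom D W (Fo V)"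
      "e' \<star> e = ide D (Fo V)" "e \<star> e' = ide D W"
      and h': "h' \<in> Hom C V ?A" "Fa h' = h \<star> e"
      using lift_arrow_into[OF h ob(1)] by metis
    obtain k' where k': "k' \<in> Hom C V ?B" "Fa k' = k \<star> e"
      using full[OF e(1) ob(2)] T.cmp_Hom[OF e(2) k] by blast
    have "is_pullback D (Fa f) (Fa g) (Fa h') (Fa k')"
      using T.pullback_iso[OF hk W_def[symmetric] e(2-5)] h' k' by simp
    then show ?thesis
      using reflect_pullback[OF f g h'(1) k'(1)] by blast
  qed
  ultimately have "has_finite_limits C"
    unfolding has_finite_limits_def by blast
  moreover have "\<exists>e. is_coequalizer C p q e" if pb: "is_pullback C f f p q" for f p q
  proof -
    obtain c where c: "is_coequalizer D (Fa p) (Fa q) c"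
      using reg(2) preserve_pullback[OF pb] by blast
    obtain W A where pq: "p \<in> Hom C W A" "q \<in> Hom C W A"
      using pb unfolding is_pullback_def by blast
    define Q where "Q = tgt D c"
    have cQ: "c \<in> Hom D (Fo A) Q"
      using c F_Hom[OF pq(1)] unfolding is_coequalizer_def Q_def Hom_def by auto
    obtain V e e' where e: "V \<in> ob C" "e \<in> Hom D (Fo V) Q" "e' \<in> Hom D Q (Fo V)"
      "e' \<star> e = ide D (Fo V)" "e \<star> e' = ide D Q"
      using eso[OF T.HomD(5)[OF cQ]] by blast
    obtain c' where c': "c' \<in> Hom C A V" "Fa c' = e' \<star> c"
      using full[OF S.HomD(5)[OF pq(1)] e(1)] T.cmp_Hom[OF cQ e(3)] by blast
    have "is_coequalizer D (Fa p) (Fa q) (Fa c')"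
      using T.coequalizer_iso[OF c Q_def[symmetric] e(3,2,5,4)] c' by simp
    then show ?thesis
      using reflect_coequalizer[OF pq c'(1)] by blast
  qed
  moreover have "regular_epi C k" if re: "regular_epi C e" and pb: "is_pullback C e f h k" for e f h k
  proof -
    have "regular_epi D (Fa k)"
      using reg(3)[OF preserve_regular_epi[OF re] preserve_pullback[OF pb]] .
    moreover have "k \<in> Hom C (src C h) (src C f)"
      using pb unfolding is_pullback_def by blast
    ultimately show ?thesis
      using reflect_regular_epi by blast
  qed
  moreover have "\<exists>f. is_pullback C f f r1 r2" if er: "equivalence_relation C r1 r2" for r1 r2
  proof -
    have per: "pseudo_equivalence_relation C r1 r2" and jm: "jointly_monic C r1 r2"
      using er unfolding equivalence_relation_def by blast+
    obtain R X where r: "r1 \<in> Hom C R X" "r2 \<in> Hom C R X"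
      and refl: "\<exists>d\<in>Hom C X R. r1 \<cdot> d = ide C X \<and> r2 \<cdot> d = ide C X"
      and sym: "\<exists>s\<in>Hom C R R. r1 \<cdot> s = r2 \<and> r2 \<cdot> s = r1"
      and trans: "\<And>Z u v. u \<in> Hom C Z R \<Longrightarrow> v \<in> Hom C Z R \<Longrightarrow> r2 \<cdot> u = r1 \<cdot> v \<Longrightarrow>
        \<exists>t\<in>Hom C Z R. r1 \<cdot> t = r1 \<cdot> u \<and> r2 \<cdot> t = r2 \<cdot> v"
      by (rule S.pseudo_equivalence_relationE[OF per]) (rule that)
    note Fr = F_Hom[OF r(1)] F_Hom[OF r(2)]
    \<comment> \<open>Reflexivity and symmetry are preserved by functoriality alone. Transitivity
      quantifies over all test objects of \<open>D\<close>, so these are first replaced by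
      isomorphic values of \<open>Fo\<close>.\<close>
    have "pseudo_equivalence_relation D (Fa r1) (Fa r2)"
    proof (rule T.pseudo_equivalence_relationI[OF Fr])
      obtain d where d: "d \<in> Hom C X R" "r1 \<cdot> d = ide C X" "r2 \<cdot> d = ide C X"
        using refl by blast
      show "\<exists>d\<in>Hom D (Fo X) (Fo R). Fa r1 \<star> d = ide D (Fo X) \<and> Fa r2 \<star> d = ide D (Fo X)"
        using F_cmp[OF d(1) r(1)] F_cmp[OF d(1) r(2)] F_ide[OF S.HomD(5)[OF r(1)]] F_Hom[OF d(1)] d(2,3)
        by auto
      obtain s where s: "s \<in> Hom C R R" "r1 \<cdot> s = r2" "r2 \<cdot> s = r1"
        using sym by blast
      show "\<exists>s\<in>Hom D (Fo R) (Fo R). Fa r1 \<star> s = Fa r2 \<and> Fa r2 \<star> s = Fa r1"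
        using F_cmp[OF s(1) r(1)] F_cmp[OF s(1) r(2)] F_Hom[OF s(1)] s(2,3) by auto
      fix Z u v
      assume u: "u \<in> Hom D Z (Fo R)" and v: "v \<in> Hom D Z (Fo R)"
        and uv: "Fa r2 \<star> u = Fa r1 \<star> v"
      obtain V e e' u' where e: "V \<in> ob C" "e \<in> Hom D (Fo V) Z" "e' \<in> Hom D Z (Fo V)"
        "e' \<star> e = ide D (Fo V)" "e \<star> e' = ide D Z"
        and u': "u' \<in> Hom C V R" "Fa u' = u \<star> e"
        using lift_arrow_into[OF u S.HomD(4)[OF r(1)]] by metis
      obtain v' where v': "v' \<in> Hom C V R" "Fa v' = v \<star> e"
        using full[OF e(1) S.HomD(4)[OF r(1)]] T.cmp_Hom[OF e(2) v] by blast
      have "Fa r2 \<star> Fa u' = Fa r1 \<star> Fa v'"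
        using uv u v e(2) Fr u' v' by (simp add: Hom_def T.assocl)
      then obtain t where t: "t \<in> Hom C V R"
        "r1 \<cdot> t = r1 \<cdot> u'" "r2 \<cdot> t = r2 \<cdot> v'"
        using trans[OF u'(1) v'(1)] reflect_eq[OF u'(1) r(2) v'(1) r(1)] by blast
      have "Fa r1 \<star> Fa t = Fa r1 \<star> (u \<star> e)" "Fa r2 \<star> Fa t = Fa r2 \<star> (v \<star> e)"
        using F_cmp[OF t(1) r(1)] F_cmp[OF u'(1) r(1)] F_cmp[OF t(1) r(2)] F_cmp[OF v'(1) r(2)]
          t(2,3) u'(2) v'(2) by auto
      moreover have "u \<star> e \<star> e' = u" "v \<star> e \<star> e' = v"
        using u v e by (simp_all add: Hom_def T.assocr)
      ultimately have "Fa r1 \<star> (Fa t \<star> e') = Fa r1 \<star> u"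
        "Fa r2 \<star> (Fa t \<star> e') = Fa r2 \<star> v"
        using F_Hom[OF t(1)] Fr e(2,3) u v by (simp_all add: Hom_def T.assocl) (simp_all add: T.assocr)
      then show "\<exists>t\<in>Hom D Z (Fo R). Fa r1 \<star> t = Fa r1 \<star> u \<and> Fa r2 \<star> t = Fa r2 \<star> v"
        using T.cmp_Hom[OF e(3) F_Hom[OF t(1)]] by blast
    qed
    moreover have "jointly_monic D (Fa r1) (Fa r2)"
      unfolding jointly_monic_def T.HomD(2)[OF Fr(1)]
    proof (intro allI ballI impI)
      fix Z u v
      assume u: "u \<in> Hom D Z (Fo R)" and v: "v \<in> Hom D Z (Fo R)"
        and uv: "Fa r1 \<star> u = Fa r1 \<star> v \<and> Fa r2 \<star> u = Fa r2 \<star> v"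
      obtain V e e' u' where e: "V \<in> ob C" "e \<in> Hom D (Fo V) Z" "e' \<in> Hom D Z (Fo V)"
        "e' \<star> e = ide D (Fo V)" "e \<star> e' = ide D Z"
        and u': "u' \<in> Hom C V R" "Fa u' = u \<star> e"
        using lift_arrow_into[OF u S.HomD(4)[OF r(1)]] by metis
      obtain v' where v': "v' \<in> Hom C V R" "Fa v' = v \<star> e"
        using full[OF e(1) S.HomD(4)[OF r(1)]] T.cmp_Hom[OF e(2) v] by blast
      have "Fa r1 \<star> Fa u' = Fa r1 \<star> Fa v'" "Fa r2 \<star> Fa u' = Fa r2 \<star> Fa v'"
        using uv u v e(2) Fr u' v' by (simp_all add: Hom_def T.assocl)
      then have "u' = v'"
        using jm[unfolded jointly_monic_def S.HomD(2)[OF r(1)], rule_format, OF u'(1) v'(1)]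
          reflect_eq[OF u'(1) r(1) v'(1) r(1)] reflect_eq[OF u'(1) r(2) v'(1) r(2)] by blast
      then show "u = v"
        using T.iso_cancel[OF e(2,3,5) u v] u' v' by simp
    qed
    ultimately obtain f where f: "is_pullback D f f (Fa r1) (Fa r2)"
      using eff unfolding equivalence_relation_def by blast
    define Z where "Z = tgt D f"
    have fZ: "f \<in> Hom D (Fo X) Z"
      using f Fr unfolding is_pullback_def Z_def Hom_def by auto
    obtain V e e' where e: "V \<in> ob C" "e \<in> Hom D (Fo V) Z" "e' \<in> Hom D Z (Fo V)"
      "e' \<star> e = ide D (Fo V)" "e \<star> e' = ide D Z"
      using eso[OF T.HomD(5)[OF fZ]] by blast
    obtain f' where f': "f' \<in> Hom C X V" "Fa f' = e' \<star> f"
      using full[OF S.HomD(5)[OF r(1)] e(1)] T.cmp_Hom[OF fZ e(3)] by blast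
    \<comment> \<open>Postcomposition with the isomorphism \<open>e'\<close> keeps the kernel pair
      and moves the codomain of \<open>f\<close> into the image.\<close>
    have "is_pullback D (e' \<star> f) (e' \<star> f) (Fa r1) (Fa r2)"
      using f
    proof (rule T.pullbackE)
      fix A B E W
      assume h: "f \<in> Hom D A E" "f \<in> Hom D B E" "Fa r1 \<in> Hom D W A" "Fa r2 \<in> Hom D W B"
        "f \<star> Fa r1 = f \<star> Fa r2"
        and ex: "\<And>V u v. u \<in> Hom D V A \<Longrightarrow> v \<in> Hom D V B \<Longrightarrow> f \<star> u = f \<star> v
          \<Longrightarrow> \<exists>w\<in>Hom D V W. Fa r1 \<star> w = u \<and> Fa r2 \<star> w = v"
        and un: "\<And>V w w'. w \<in> Hom D V W \<Longrightarrow> w' \<in> Hom D V W \<Longrightarrow> Fa r1 \<star> w = Fa r1 \<star> w'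
          \<Longrightarrow> Fa r2 \<star> w = Fa r2 \<star> w' \<Longrightarrow> w = w'"
      have E: "E = Z" using h(1) fZ by (simp add: Hom_def)
      have *: "f \<star> u = f \<star> v" if "u \<in> Hom D U A" "v \<in> Hom D U B"
        "(e' \<star> f) \<star> u = (e' \<star> f) \<star> v" for U u v
      proof -
        have "e' \<star> (f \<star> u) = e' \<star> (f \<star> v)"
          using that h(1,2) e(3) unfolding E by (simp add: Hom_def T.assocl)
        then show ?thesis
          using T.iso_cancel_left[OF e(3,2,5)] that(1,2) h(1,2) T.cmp_Hom unfolding E by blast
      qed
      show ?thesis
      proof (rule T.pullbackI)
        show "e' \<star> f \<in> Hom D A (Fo V)" "e' \<star> f \<in> Hom D B (Fo V)"
          "Fa r1 \<in> Hom D W A" "Fa r2 \<in> Hom D W B"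
          using h e(3) E T.cmp_Hom by auto
        show "e' \<star> f \<star> Fa r1 = e' \<star> f \<star> Fa r2"
          using h e(3) unfolding E by (simp add: Hom_def T.assocr)
      qed (use ex * un in blast)+
    qed
    then show ?thesis
      using reflect_pullback[OF f'(1) f'(1) r] f'(2) by auto
  qed
  ultimately show ?thesis
    unfolding exact_category_def regular_category_def using S.category_axioms by blast
qed

end

text \<open>The quasi-inverse is an equivalence in the same sense, so the locale is interpreted once
  more with \<open>C\<close> and \<open>D\<close> exchanged, and exactness of both functors is one
  and the same lemma.\<close>

lemma (in equivalence) equivalent_exact_categories:
  assumes "exact_category D"
  shows "equivalent_exact_categories D C"
proof -
  obtain Go e e' where e: "\<And>Z. Z \<in> ob D \<Longrightarrow> Go Z \<in> ob C"
    "\<And>Z. Z \<in> ob D \<Longrightarrow> e Z \<in> Hom D (Fo (Go Z)) Z" "\<And>Z. Z \<in> ob D \<Longrightarrow> e' Z \<in> Hom D Z (Fo (Go Z))"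
    "\<And>Z. Z \<in> ob D \<Longrightarrow> e' Z \<star> e Z = ide D (Fo (Go Z))"
    "\<And>Z. Z \<in> ob D \<Longrightarrow> e Z \<star> e' Z = ide D Z"
    using eso by metis
  \<comment> \<open>Arrows are conjugated by the chosen isomorphisms; fullness provides a preimage
    under \<open>Fa\<close>, and faithfulness makes it the only one.\<close>
  define Ga where "Ga f = (SOME h. h \<in> Hom C (Go (src D f)) (Go (tgt D f)) \<and>
    Fa h = e' (tgt D f) \<star> f \<star> e (src D f))" for f
  have Ga: "Ga f \<in> Hom C (Go A) (Go B)" "Fa (Ga f) = e' B \<star> f \<star> e A"
    if f: "f \<in> Hom D A B" for f A B
  proof -
    note AB = T.HomD[OF f]
    have "e' B \<star> f \<star> e A \<in> Hom D (Fo (Go A)) (Fo (Go B))"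
      using T.cmp_Hom[OF e(2)[OF AB(4)] T.cmp_Hom[OF f e(3)[OF AB(5)]]] .
    then have "\<exists>h. h \<in> Hom C (Go A) (Go B) \<and> Fa h = e' B \<star> f \<star> e A"
      using full[OF e(1)[OF AB(4)] e(1)[OF AB(5)]] by blast
    from someI_ex[OF this] show "Ga f \<in> Hom C (Go A) (Go B)" "Fa (Ga f) = e' B \<star> f \<star> e A"
      unfolding Ga_def AB(2,3) by auto
  qed
  \<comment> \<open>The isomorphism \<open>e (Fo X)\<close> runs between values of \<open>Fo\<close>
    and therefore lifts to an isomorphism of \<open>C\<close>. The lifts give both essential
    surjectivity of \<open>Go\<close> and the counit.\<close>
  have lift_iso: "\<exists>d\<in>Hom C (Go (Fo X)) X. \<exists>d'\<in>Hom C X (Go (Fo X)). Fa d = e (Fo X) \<and>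
      d' \<cdot> d = ide C (Go (Fo X)) \<and> d \<cdot> d' = ide C X" if X: "X \<in> ob C" for X
  proof -
    note FX = F_ob[OF X]
    obtain d where d: "d \<in> Hom C (Go (Fo X)) X" "Fa d = e (Fo X)"
      using full[OF e(1)[OF FX] X e(2)[OF FX]] by blast
    obtain d' where d': "d' \<in> Hom C X (Go (Fo X))" "Fa d' = e' (Fo X)"
      using full[OF X e(1)[OF FX] e(3)[OF FX]] by blast
    have "d' \<cdot> d = ide C (Go (Fo X))"
      using reflect_eq1[OF d(1) d'(1) S.ide_Hom[OF e(1)[OF FX]]] d d' e(4)[OF FX] F_ide[OF e(1)[OF FX]]
      by simp
    moreover have "d \<cdot> d' = ide C X"
      using reflect_eq1[OF d'(1) d(1) S.ide_Hom[OF X]] d d' e(5)[OF FX] F_ide[OF X] by simp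
    ultimately show ?thesis using d d' by blast
  qed
  then obtain \<epsilon> \<epsilon>' where \<epsilon>: "\<And>X. X \<in> ob C \<Longrightarrow> \<epsilon> X \<in> Hom C (Go (Fo X)) X"
    "\<And>X. X \<in> ob C \<Longrightarrow> \<epsilon>' X \<in> Hom C X (Go (Fo X))" "\<And>X. X \<in> ob C \<Longrightarrow> Fa (\<epsilon> X) = e (Fo X)"
    "\<And>X. X \<in> ob C \<Longrightarrow> \<epsilon>' X \<cdot> \<epsilon> X = ide C (Go (Fo X))" "\<And>X. X \<in> ob C \<Longrightarrow> \<epsilon> X \<cdot> \<epsilon>' X = ide C X"
    by metis
  interpret G: equivalence D C Go Ga
  proof
    show "is_functor D C Go Ga"
      unfolding is_functor_def
    proof (intro conjI ballI impI)
      show "Go A \<in> ob C" if "A \<in> ob D" for A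
        using e that by blast
      show "Ga f \<in> Hom C (Go (src D f)) (Go (tgt D f))" if "f \<in> ar D" for f
        using Ga(1)[OF T.ar_Hom[OF that]] .
      show "Ga (ide D A) = ide C (Go A)" if A: "A \<in> ob D" for A
      proof (rule faithful[OF Ga(1)[OF T.ide_Hom[OF A]] S.ide_Hom[OF e(1)[OF A]]])
        show "Fa (Ga (ide D A)) = Fa (ide C (Go A))"
          using e(2,3,4)[OF A] F_ide[OF e(1)[OF A]] Ga(2)[OF T.ide_Hom[OF A]] A
          by (simp add: Hom_def)
      qed
      show "Ga (g \<star> f) = Ga g \<cdot> Ga f" if "f \<in> ar D" "g \<in> ar D" "tgt D f = src D g" for f g
      proof -
        define A B E where "A = src D f" and "B = src D g" and "E = tgt D g"
        have f: "f \<in> Hom D A B" and g: "g \<in> Hom D B E"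
          using that by (auto simp: A_def B_def E_def Hom_def)
        note ob = T.HomD(4,5)[OF f] T.HomD(4,5)[OF g]
        have "Fa (Ga g \<cdot> Ga f) = Fa (Ga (g \<star> f))"
        proof -
          have "Fa (Ga g \<cdot> Ga f) = (e' E \<star> g \<star> e B) \<star> (e' B \<star> f \<star> e A)"
            using F_cmp[OF Ga(1)[OF f] Ga(1)[OF g]] Ga(2)[OF f] Ga(2)[OF g] by simp
          also have "\<dots> = e' E \<star> g \<star> ((e B \<star> e' B) \<star> (f \<star> e A))"
            using f g e(2)[OF ob(1)] e(2)[OF ob(2)] e(3)[OF ob(2)] e(3)[OF ob(4)]
            by (simp add: Hom_def T.assocl)
          also have "\<dots> = e' E \<star> g \<star> (f \<star> e A)"
            unfolding e(5)[OF ob(2)] using f e(2)[OF ob(1)] by (simp add: Hom_def)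
          also have "\<dots> = Fa (Ga (g \<star> f))"
            unfolding Ga(2)[OF T.cmp_Hom[OF f g]]
            using f g e(2)[OF ob(1)] e(3)[OF ob(4)] by (simp add: Hom_def T.assocl)
          finally show ?thesis .
        qed
        then show ?thesis
          using faithful[OF S.cmp_Hom[OF Ga(1)[OF f] Ga(1)[OF g]] Ga(1)[OF T.cmp_Hom[OF f g]]] by simp
      qed
    qed
    show "\<exists>f\<in>Hom D A B. Ga f = h" if A: "A \<in> ob D" and B: "B \<in> ob D" and h: "h \<in> Hom C (Go A) (Go B)"
      for A B h
    proof
      note Fh = F_Hom[OF h]
      \<comment> \<open>This conjugates \<open>Fa h\<close> in the opposite direction, so that the
        isomorphisms cancel when \<open>Ga\<close> is applied.\<close>
      show f: "e B \<star> Fa h \<star> e' A \<in> Hom D A B"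
        using T.cmp_Hom[OF e(3)[OF A] T.cmp_Hom[OF Fh e(2)[OF B]]] .
      have "Fa (Ga (e B \<star> Fa h \<star> e' A))
          = (e' B \<star> e B) \<star> Fa h \<star> (e' A \<star> e A)"
        unfolding Ga(2)[OF f] using Fh e(2,3)[OF A] e(2,3)[OF B]
        by (simp add: Hom_def T.assocl)
      also have "\<dots> = Fa h"
        unfolding e(4)[OF A] e(4)[OF B] using Fh F_ob e(1) A B by (simp add: Hom_def)
      finally show "Ga (e B \<star> Fa h \<star> e' A) = h"
        using faithful[OF Ga(1)[OF f] h] by simp
    qed
    show "f = g" if f: "f \<in> Hom D A B" and g: "g \<in> Hom D A B" and fg: "Ga f = Ga g" for f g A B
    proof -
      note A = T.HomD(4)[OF f] and B = T.HomD(5)[OF f]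
      have "e' B \<star> f \<star> e A = e' B \<star> g \<star> e A"
        using Ga(2)[OF f] Ga(2)[OF g] fg by simp
      then have "e' B \<star> f = e' B \<star> g"
        using T.iso_cancel[OF e(2,3,5)[OF A] T.cmp_Hom[OF f e(3)[OF B]] T.cmp_Hom[OF g e(3)[OF B]]]
        by blast
      then show ?thesis
        using T.iso_cancel_left[OF e(3,2,5)[OF B] f g] by blast
    qed
    show "\<exists>A\<in>ob D. \<exists>d\<in>Hom C (Go A) X. \<exists>d'\<in>Hom C X (Go A).
        d' \<cdot> d = ide C (Go A) \<and> d \<cdot> d' = ide C X" if "X \<in> ob C" for X
      using lift_iso[OF that] F_ob[OF that] by blast
  qed
  have "natural_iso D D id id (Fo \<circ> Go) (Fa \<circ> Ga) e'"
    unfolding natural_iso_def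
  proof (intro conjI ballI)
    fix A assume A: "A \<in> ob D"
    show "e' A \<in> Hom D (id A) ((Fo \<circ> Go) A)"
      using e(3)[OF A] by simp
    show "is_iso D (e' A)"
      using T.isoI[OF e(3,2,5,4)[OF A]] .
  next
    fix f assume "f \<in> ar D"
    define A B where "A = src D f" and "B = tgt D f"
    have f: "f \<in> Hom D A B"
      using T.ar_Hom[OF \<open>f \<in> ar D\<close>] unfolding A_def B_def .
    note A = T.HomD(4)[OF f] and B = T.HomD(5)[OF f]
    have "Fa (Ga f) \<star> e' A = e' B \<star> f \<star> (e A \<star> e' A)"
      unfolding Ga(2)[OF f] using f e(2,3)[OF A] e(2,3)[OF B] by (simp add: Hom_def T.assocl)
    also have "\<dots> = e' B \<star> f"
      unfolding e(5)[OF A] using f e(3)[OF B] by (simp add: Hom_def)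
    finally show "e' (tgt D f) \<star> id f = (Fa \<circ> Ga) f \<star> e' (src D f)"
      by (simp add: A_def B_def)
  qed
  moreover have "natural_iso C C (Go \<circ> Fo) (Ga \<circ> Fa) id id \<epsilon>"
    unfolding natural_iso_def
  proof (intro conjI ballI)
    fix X assume X: "X \<in> ob C"
    show "\<epsilon> X \<in> Hom C ((Go \<circ> Fo) X) (id X)"
      using \<epsilon>(1)[OF X] by simp
    show "is_iso C (\<epsilon> X)"
      using S.isoI[OF \<epsilon>(1,2,4,5)[OF X]] .
  next
    fix f assume "f \<in> ar C"
    define A B where "A = src C f" and "B = tgt C f"
    have f: "f \<in> Hom C A B"
      using S.ar_Hom[OF \<open>f \<in> ar C\<close>] unfolding A_def B_def .
    note A = S.HomD(4)[OF f] and B = S.HomD(5)[OF f]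
    note Ff = F_Hom[OF f] note FA = F_ob[OF A] and FB = F_ob[OF B]
    have "Fa (\<epsilon> B) \<star> Fa (Ga (Fa f)) = (e (Fo B) \<star> e' (Fo B)) \<star> (Fa f \<star> e (Fo A))"
      unfolding Ga(2)[OF Ff] \<epsilon>(3)[OF B] using Ff e(2,3)[OF FA] e(2,3)[OF FB]
      by (simp add: Hom_def T.assocl)
    also have "\<dots> = Fa f \<star> Fa (\<epsilon> A)"
      unfolding e(5)[OF FB] \<epsilon>(3)[OF A] using Ff e(2)[OF FA] by (simp add: Hom_def)
    finally show "\<epsilon> (tgt C f) \<cdot> (Ga \<circ> Fa) f = id f \<cdot> \<epsilon> (src C f)"
      using reflect_eq[OF Ga(1)[OF Ff] \<epsilon>(1)[OF B] \<epsilon>(1)[OF A] f] by (simp add: A_def B_def)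
  qed
  ultimately show ?thesis
    unfolding equivalent_exact_categories_def
    using assms reflect_exact[OF assms] exact_functor G.exact_functor by blast
qed


section \<open>Categories presented by congruences\<close>

text \<open>Both \<open>Pred_existential_free\<close> and \<open>ex_lex\<close> have this form
  (\<open>Pred_eq\<close>, \<open>ex_lex_eq\<close>). The union in the composition runs over all
  representatives; it is a single class as soon as composition respects the congruence.\<close>

definition quot_cat :: "'o set \<Rightarrow> ('o \<Rightarrow> 'o \<Rightarrow> 'm set) \<Rightarrow> ('o \<Rightarrow> 'o \<Rightarrow> ('m \<times> 'm) set) \<Rightarrow> ('o \<Rightarrow> 'm)
    \<Rightarrow> ('m \<Rightarrow> 'm \<Rightarrow> 'm) \<Rightarrow> ('o, 'o \<times> 'm set \<times> 'o) cat" where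
  "quot_cat Ob hs eqv i c =
    \<lparr> ob = Ob,
      ar = {(U, F, V). U \<in> Ob \<and> V \<in> Ob \<and> F \<in> hs U V // eqv U V},
      src = (\<lambda>(U, F, V). U),
      tgt = (\<lambda>(U, F, V). V),
      ide = (\<lambda>U. (U, eqv U U `` {i U}, U)),
      cmp = (\<lambda>(V', G, W) (U, F, V). (U, \<Union>f\<in>F. \<Union>g\<in>G. eqv U W `` {c g f}, W)) \<rparr>"

text \<open>The congruence is the kernel of \<open>K\<close> on each hom-set. Associativity and unit
  laws are not postulated for \<open>c\<close> and \<open>i\<close>: they hold in \<open>T\<close>,
  hence on classes.\<close>

locale quotient_presentation = T: category T
  for T :: "('q, 'n, 'y) cat_scheme"
    and Ob :: "'o set" and hs :: "'o \<Rightarrow> 'o \<Rightarrow> 'm set" and eqv :: "'o \<Rightarrow> 'o \<Rightarrow> ('m \<times> 'm) set"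
    and i :: "'o \<Rightarrow> 'm" and c :: "'m \<Rightarrow> 'm \<Rightarrow> 'm" and Go :: "'o \<Rightarrow> 'q" and K :: "'o \<Rightarrow> 'o \<Rightarrow> 'm \<Rightarrow> 'n" +
  assumes Go_ob: "U \<in> Ob \<Longrightarrow> Go U \<in> ob T"
    and K_Hom: "U \<in> Ob \<Longrightarrow> V \<in> Ob \<Longrightarrow> f \<in> hs U V \<Longrightarrow> K U V f \<in> Hom T (Go U) (Go V)"
    and K_full: "U \<in> Ob \<Longrightarrow> V \<in> Ob \<Longrightarrow> h \<in> Hom T (Go U) (Go V) \<Longrightarrow> \<exists>f\<in>hs U V. K U V f = h"
    and eqv_kernel: "U \<in> Ob \<Longrightarrow> V \<in> Ob \<Longrightarrow>
      eqv U V = {(f, g). f \<in> hs U V \<and> g \<in> hs U V \<and> K U V f = K U V g}"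
    and i_maps: "U \<in> Ob \<Longrightarrow> i U \<in> hs U U"
    and K_i: "U \<in> Ob \<Longrightarrow> K U U (i U) = ide T (Go U)"
    and c_maps: "U \<in> Ob \<Longrightarrow> V \<in> Ob \<Longrightarrow> W \<in> Ob \<Longrightarrow> f \<in> hs U V \<Longrightarrow> g \<in> hs V W \<Longrightarrow> c g f \<in> hs U W"
    and K_c: "U \<in> Ob \<Longrightarrow> V \<in> Ob \<Longrightarrow> W \<in> Ob \<Longrightarrow> f \<in> hs U V \<Longrightarrow> g \<in> hs V W
      \<Longrightarrow> K U W (c g f) = K V W g \<odot>\<^bsub>T\<^esub> K U V f"
begin

abbreviation "Q \<equiv> quot_cat Ob hs eqv i c"

text \<open>Any representative may be taken, because \<open>K\<close> is constant on each
  class.\<close>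

definition Ga :: "'o \<times> 'm set \<times> 'o \<Rightarrow> 'n" where
  "Ga = (\<lambda>(U, F, V). K U V (SOME f. f \<in> F))"

lemma class_eq:
  "U \<in> Ob \<Longrightarrow> V \<in> Ob \<Longrightarrow> f \<in> hs U V \<Longrightarrow> eqv U V `` {f} = {g \<in> hs U V. K U V g = K U V f}"
  by (auto simp: eqv_kernel)

lemma Ga_class:
  assumes "U \<in> Ob" "V \<in> Ob" "f \<in> hs U V"
  shows "Ga (U, eqv U V `` {f}, V) = K U V f"
proof -
  have "f \<in> eqv U V `` {f}"
    using assms by (simp add: class_eq)
  then have "(SOME f'. f' \<in> eqv U V `` {f}) \<in> eqv U V `` {f}"
    by (metis someI)
  then show ?thesis
    using assms by (simp add: Ga_def class_eq)
qed

lemma Hom_Q: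
  "Hom Q U V = {(U, eqv U V `` {f}, V) | f. f \<in> hs U V \<and> U \<in> Ob \<and> V \<in> Ob}"
  by (auto simp: Hom_def quot_cat_def quotient_def)

lemma HomQ_E:
  assumes "F \<in> Hom Q U V"
  obtains f where "F = (U, eqv U V `` {f}, V)" "f \<in> hs U V" "U \<in> Ob" "V \<in> Ob"
  using assms unfolding Hom_Q by blast

text \<open>By \<open>K_c\<close> all composites of representatives have the same image under
  \<open>K\<close>, so the union consists of copies of one class.\<close>

lemma cmp_class:
  assumes "U \<in> Ob" "V \<in> Ob" "W \<in> Ob" "f \<in> hs U V" "g \<in> hs V W"
  shows "(V, eqv V W `` {g}, W) \<odot>\<^bsub>Q\<^esub> (U, eqv U V `` {f}, V) = (U, eqv U W `` {c g f}, W)"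
proof -
  have "eqv U W `` {c g' f'} = eqv U W `` {c g f}"
    if "f' \<in> eqv U V `` {f}" "g' \<in> eqv V W `` {g}" for f' g'
    using that assms by (simp add: class_eq c_maps K_c)
  moreover have "f \<in> eqv U V `` {f}" "g \<in> eqv V W `` {g}"
    using assms by (simp_all add: class_eq)
  ultimately have "(\<Union>f'\<in>eqv U V `` {f}. \<Union>g'\<in>eqv V W `` {g}. eqv U W `` {c g' f'}) = eqv U W `` {c g f}"
    by blast
  then show ?thesis
    by (simp add: quot_cat_def)
qed

lemma Ga_Hom: "F \<in> Hom Q U V \<Longrightarrow> Ga F \<in> Hom T (Go U) (Go V)"
  by (elim HomQ_E) (simp add: Ga_class K_Hom)

lemma Ga_faithful:
  assumes "F \<in> Hom Q U V" "G \<in> Hom Q U V" "Ga F = Ga G"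
  shows "F = G"
proof -
  obtain f where f: "F = (U, eqv U V `` {f}, V)" "f \<in> hs U V" "U \<in> Ob" "V \<in> Ob"
    using assms(1) by (rule HomQ_E)
  obtain g where g: "G = (U, eqv U V `` {g}, V)" "g \<in> hs U V"
    using assms(2) by (rule HomQ_E)
  have "K U V f = K U V g"
    using assms(3) f g Ga_class[of U V f] Ga_class[of U V g] by simp
  then show ?thesis
    using f g by (simp add: class_eq)
qed

lemma Ga_ide: "U \<in> Ob \<Longrightarrow> Ga (ide Q U) = ide T (Go U)"
  using Ga_class[OF _ _ i_maps] K_i by (simp add: quot_cat_def)

lemma Q_ide_Hom: "U \<in> Ob \<Longrightarrow> ide Q U \<in> Hom Q U U"
  unfolding Hom_Q using i_maps by (auto simp: quot_cat_def)

lemma Q_cmp: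
  assumes "F \<in> Hom Q U V" "G \<in> Hom Q V W"
  shows "G \<odot>\<^bsub>Q\<^esub> F \<in> Hom Q U W" "Ga (G \<odot>\<^bsub>Q\<^esub> F) = Ga G \<odot>\<^bsub>T\<^esub> Ga F"
proof -
  obtain f where f: "F = (U, eqv U V `` {f}, V)" "f \<in> hs U V" "U \<in> Ob" "V \<in> Ob"
    using assms(1) by (rule HomQ_E)
  obtain g where g: "G = (V, eqv V W `` {g}, W)" "g \<in> hs V W" "W \<in> Ob"
    using assms(2) by (rule HomQ_E)
  have GF: "G \<odot>\<^bsub>Q\<^esub> F = (U, eqv U W `` {c g f}, W)" "c g f \<in> hs U W"
    using cmp_class[of U V W f g] c_maps[of U V W f g] f g by auto
  show "G \<odot>\<^bsub>Q\<^esub> F \<in> Hom Q U W"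
    unfolding Hom_Q using GF f g by blast
  show "Ga (G \<odot>\<^bsub>Q\<^esub> F) = Ga G \<odot>\<^bsub>T\<^esub> Ga F"
    using GF f g Ga_class[of U W "c g f"] Ga_class[of U V f] Ga_class[of V W g] K_c[of U V W f g] by simp
qed

text \<open>Each law equates parallel arrows whose images under \<open>Ga\<close> agree in
  \<open>T\<close>. The facts used, \<open>Ga_faithful\<close> and \<open>Q_cmp\<close>, speak only
  of \<open>Hom Q\<close> and are available before \<open>Q\<close> is known to be a
  category.\<close>

lemma category_Q: "category Q"
proof
  have arQ: "\<exists>U V. F \<in> Hom Q U V \<and> U \<in> Ob \<and> V \<in> Ob" if "F \<in> ar Q" for F
    using that by (auto simp: Hom_def quot_cat_def)
  have ob: "ob Q = Ob"
    by (simp add: quot_cat_def)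
  show "src Q F \<in> ob Q" "tgt Q F \<in> ob Q" if "F \<in> ar Q" for F
    using arQ[OF that] ob by (auto simp: Hom_def)
  show "ide Q U \<in> Hom Q U U" if "U \<in> ob Q" for U
    using Q_ide_Hom that ob by simp
  show "G \<odot>\<^bsub>Q\<^esub> F \<in> Hom Q U W" if "F \<in> Hom Q U V" "G \<in> Hom Q V W" for F G U V W
    using Q_cmp(1)[OF that] .
  show "ide Q V \<odot>\<^bsub>Q\<^esub> F = F" if F: "F \<in> Hom Q U V" for F U V
  proof -
    have V: "V \<in> Ob" using F by (rule HomQ_E)
    show ?thesis
      by (rule Ga_faithful[OF Q_cmp(1)[OF F Q_ide_Hom[OF V]] F])
        (simp add: Q_cmp(2)[OF F Q_ide_Hom[OF V]] Ga_ide[OF V] T.cmp_ide_left[OF Ga_Hom[OF F]])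
  qed
  show "F \<odot>\<^bsub>Q\<^esub> ide Q U = F" if F: "F \<in> Hom Q U V" for F U V
  proof -
    have U: "U \<in> Ob" using F by (rule HomQ_E)
    show ?thesis
      by (rule Ga_faithful[OF Q_cmp(1)[OF Q_ide_Hom[OF U] F] F])
        (simp add: Q_cmp(2)[OF Q_ide_Hom[OF U] F] Ga_ide[OF U] T.cmp_ide_right[OF Ga_Hom[OF F]])
  qed
  show "H \<odot>\<^bsub>Q\<^esub> (G \<odot>\<^bsub>Q\<^esub> F) = H \<odot>\<^bsub>Q\<^esub> G \<odot>\<^bsub>Q\<^esub> F"
    if F: "F \<in> Hom Q U V" and G: "G \<in> Hom Q V W" and H: "H \<in> Hom Q W Z" for F G H U V W Z
    by (rule Ga_faithful[OF Q_cmp(1)[OF Q_cmp(1)[OF F G] H] Q_cmp(1)[OF F Q_cmp(1)[OF G H]]])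
      (simp add: Q_cmp(2)[OF Q_cmp(1)[OF F G] H] Q_cmp(2)[OF F Q_cmp(1)[OF G H]] Q_cmp(2)[OF F G]
        Q_cmp(2)[OF G H] T.cmp_assoc[OF Ga_Hom[OF F] Ga_Hom[OF G] Ga_Hom[OF H]])
qed

lemma ff_functor_Q: "ff_functor Q T Go Ga"
proof -
  interpret Q: category Q by (rule category_Q)
  show ?thesis
  proof
    show "is_functor Q T Go Ga"
      unfolding is_functor_def
    proof (intro conjI ballI impI)
      show "Go U \<in> ob T" if "U \<in> ob Q" for U
        using that Go_ob by (simp add: quot_cat_def)
      show "Ga F \<in> Hom T (Go (src Q F)) (Go (tgt Q F))" if "F \<in> ar Q" for F
        using Ga_Hom[OF Q.ar_Hom[OF that]] .
      show "Ga (ide Q U) = ide T (Go U)" if "U \<in> ob Q" for U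
        using that Ga_ide by (simp add: quot_cat_def)
      show "Ga (G \<odot>\<^bsub>Q\<^esub> F) = Ga G \<odot>\<^bsub>T\<^esub> Ga F" if "F \<in> ar Q" "G \<in> ar Q" "tgt Q F = src Q G" for F G
        using Q_cmp(2)[of F "src Q F" "tgt Q F" G "tgt Q G"] that by (simp add: Hom_def)
    qed
    show "\<exists>F\<in>Hom Q U V. Ga F = h"
      if UV: "U \<in> ob Q" "V \<in> ob Q" and h: "h \<in> Hom T (Go U) (Go V)" for U V h
    proof -
      have ob: "U \<in> Ob" "V \<in> Ob"
        using UV by (auto simp: quot_cat_def)
      obtain f where f: "f \<in> hs U V" "K U V f = h"
        using K_full[OF ob h] by blast
      then show ?thesis
        using Ga_class[OF ob f(1)] Hom_Q[of U V] ob by blast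
    qed
  qed (rule Ga_faithful)
qed

end


section \<open>Projective covers and the exact completion\<close>

context category
begin

section \<open>Regular epimorphisms and kernel pairs\<close>

lemma regular_epi_cancel:
  assumes "regular_epi C e" "e \<in> Hom C A B" "u \<in> Hom C B Z" "v \<in> Hom C B Z" "u \<odot> e = v \<odot> e"
  shows "u = v"
proof -
  obtain f g where "is_coequalizer C f g e"
    using assms(1) unfolding regular_epi_def by blast
  then show ?thesis
  proof (rule coequalizerE)
    fix A' B' Q
    assume e: "e \<in> Hom C B' Q"
      and un: "\<And>Z w w'. w \<in> Hom C Q Z \<Longrightarrow> w' \<in> Hom C Q Z \<Longrightarrow> w \<odot> e = w' \<odot> e \<Longrightarrow> w = w'"
    have "Q = B" using HomD(3)[OF e] HomD(3)[OF assms(2)] by simp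
    then show ?thesis using un assms(3-5) by blast
  qed
qed

text \<open>A regular epimorphism is the coequalizer of its kernel pair, whatever pair
  \<open>f\<close>, \<open>g\<close> exhibits it as regular: that pair factors through the kernel
  pair, so \<open>u\<close> coequalizes it as well.\<close>

lemma regular_epi_kernel_pair_factor:
  assumes "regular_epi C e" and e: "e \<in> Hom C A B" and pb: "is_pullback C e e p q"
    and u: "u \<in> Hom C A Z" "u \<odot> p = u \<odot> q"
  shows "\<exists>w\<in>Hom C B Z. w \<odot> e = u"
proof -
  obtain f g where "is_coequalizer C f g e"
    using assms(1) unfolding regular_epi_def by blast
  then show ?thesis
  proof (rule coequalizerE)
    fix A' B' Q
    assume e': "e \<in> Hom C B' Q" and fg: "f \<in> Hom C A' B'" "g \<in> Hom C A' B'" "e \<odot> f = e \<odot> g"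
      and ex: "\<And>Z u. u \<in> Hom C B' Z \<Longrightarrow> u \<odot> f = u \<odot> g \<Longrightarrow> \<exists>w\<in>Hom C Q Z. w \<odot> e = u"
    have eqs: "Q = B" "B' = A"
      using HomD(2,3)[OF e] HomD(2,3)[OF e'] by auto
    obtain w where w: "w \<in> Hom C A' (src C p)" "p \<odot> w = f" "q \<odot> w = g"
      using pb fg unfolding is_pullback_def eqs HomD(2)[OF e] by blast
    have pq: "p \<in> Hom C (src C p) A" "q \<in> Hom C (src C p) A"
      using pb unfolding is_pullback_def HomD(2)[OF e] by auto
    have "u \<odot> f = u \<odot> g"
      using cmp_assoc[OF w(1) pq(1) u(1)] cmp_assoc[OF w(1) pq(2) u(1)] u(2) w(2,3) by simp
    then show ?thesis
      using ex[of u] u(1) unfolding eqs by blast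
  qed
qed

lemma coequalizer_unique:
  assumes "is_coequalizer C f g p" "is_coequalizer C f g q" and p: "p \<in> Hom C A B" and q: "q \<in> Hom C A Q"
  shows "\<exists>e\<in>Hom C B Q. \<exists>e'\<in>Hom C Q B. e' \<odot> e = ide C B \<and> e \<odot> e' = ide C Q"
proof -
  note B = HomD(5)[OF p] and Q = HomD(5)[OF q]
  have eqp: "p \<odot> f = p \<odot> g" and eqq: "q \<odot> f = q \<odot> g"
    using assms(1,2) unfolding is_coequalizer_def by blast+
  have A: "tgt C f = A"
    using assms(1) HomD(2)[OF p] unfolding is_coequalizer_def by simp
  obtain e where e: "e \<in> Hom C B Q" "e \<odot> p = q"
    using assms(1) q eqq unfolding is_coequalizer_def A HomD(3)[OF p] by blast
  obtain e' where e': "e' \<in> Hom C Q B" "e' \<odot> q = p"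
    using assms(2) p eqp unfolding is_coequalizer_def A HomD(3)[OF q] by blast
  have "e' \<odot> e \<odot> p = ide C B \<odot> p"
    using cmp_assoc[OF p e(1) e'(1)] e(2) e'(2) cmp_ide_left[OF p] by simp
  then have "e' \<odot> e = ide C B"
    using regular_epi_cancel[OF _ p cmp_Hom[OF e(1) e'(1)] ide_Hom[OF B]] assms(1)
    unfolding regular_epi_def by blast
  moreover have "e \<odot> e' \<odot> q = ide C Q \<odot> q"
    using cmp_assoc[OF q e'(1) e(1)] e(2) e'(2) cmp_ide_left[OF q] by simp
  then have "e \<odot> e' = ide C Q"
    using regular_epi_cancel[OF _ q cmp_Hom[OF e'(1) e(1)] ide_Hom[OF Q]] assms(2)
    unfolding regular_epi_def by blast
  ultimately show ?thesis
    using e(1) e'(1) by blast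
qed

end

text \<open>The clause \<open>quotient\<close> makes \<open>Ja r1\<close>, \<open>Ja r2\<close> a
  weak kernel pair of \<open>q\<close>: pairs of elements with projective domain that
  \<open>q\<close> identifies come from the relation, with no uniqueness of \<open>h\<close>. It is
  phrased with arrows out of values of \<open>Jo\<close>, so that no limit in \<open>D\<close> has
  to be mentioned.\<close>

locale projective_cover = J: ff_functor D T Jo Ja
  for D :: "('o, 'm, 'z) cat_scheme" and T :: "('q, 'n, 'y) cat_scheme"
    and Jo :: "'o \<Rightarrow> 'q" and Ja :: "'m \<Rightarrow> 'n" +
  assumes exact: "exact_category T"
    and projective: "X \<in> ob D \<Longrightarrow> p \<in> Hom T Y Z \<Longrightarrow> regular_epi T p \<Longrightarrow> u \<in> Hom T (Jo X) Z
      \<Longrightarrow> \<exists>h\<in>Hom T (Jo X) Y. p \<odot>\<^bsub>T\<^esub> h = u"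
    and cover: "Z \<in> ob T \<Longrightarrow> \<exists>X\<in>ob D. \<exists>p\<in>Hom T (Jo X) Z. regular_epi T p"
    and quotient: "pseudo_equivalence_relation D r1 r2 \<Longrightarrow> r1 \<in> Hom D A B \<Longrightarrow> r2 \<in> Hom D A B \<Longrightarrow>
      \<exists>Q. \<exists>q\<in>Hom T (Jo B) Q. regular_epi T q \<and> q \<odot>\<^bsub>T\<^esub> Ja r1 = q \<odot>\<^bsub>T\<^esub> Ja r2 \<and>
        (\<forall>Z u v. Z \<in> ob D \<longrightarrow> u \<in> Hom T (Jo Z) (Jo B) \<longrightarrow> v \<in> Hom T (Jo Z) (Jo B) \<longrightarrow>
          q \<odot>\<^bsub>T\<^esub> u = q \<odot>\<^bsub>T\<^esub> v \<longrightarrow> (\<exists>h\<in>Hom T (Jo Z) (Jo A). Ja r1 \<odot>\<^bsub>T\<^esub> h = u \<and> Ja r2 \<odot>\<^bsub>T\<^esub> h = v))"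
begin

abbreviation base_cmp (infixl "\<cdot>" 70) where "g \<cdot> f \<equiv> g \<odot>\<^bsub>D\<^esub> f"
abbreviation exact_cmp (infixl "\<star>" 70) where "g \<star> f \<equiv> g \<odot>\<^bsub>T\<^esub> f"

lemma kernel_pair_exists:
  assumes p: "p \<in> Hom T A B"
  obtains k1 k2 K where "is_pullback T p p k1 k2" "k1 \<in> Hom T K A" "k2 \<in> Hom T K A" "p \<star> k1 = p \<star> k2"
proof -
  have "has_finite_limits T"
    using exact unfolding exact_category_def regular_category_def by blast
  then obtain k1 k2 where pb: "is_pullback T p p k1 k2"
    using J.T.HomD(1)[OF p] unfolding has_finite_limits_def by blast
  then have "k1 \<in> Hom T (src T k1) A" "k2 \<in> Hom T (src T k1) A" "p \<star> k1 = p \<star> k2"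
    unfolding is_pullback_def J.T.HomD(2)[OF p] by auto
  then show thesis using that pb by blast
qed

text \<open>If every pair of generalized projective elements identified by \<open>q\<close> comes from \<open>(r1, r2)\<close>, then
  \<open>(r1, r2)\<close> covers the kernel pair of \<open>q\<close>.\<close>

lemma coequalizer_of_lifting:
  assumes r: "r1 \<in> Hom D A B" "r2 \<in> Hom D A B"
    and q: "q \<in> Hom T (Jo B) Q" "regular_epi T q" "q \<star> Ja r1 = q \<star> Ja r2"
    and lift: "\<And>Z u v. Z \<in> ob D \<Longrightarrow> u \<in> Hom T (Jo Z) (Jo B) \<Longrightarrow> v \<in> Hom T (Jo Z) (Jo B) \<Longrightarrow>
      q \<star> u = q \<star> v \<Longrightarrow> \<exists>h\<in>Hom T (Jo Z) (Jo A). Ja r1 \<star> h = u \<and> Ja r2 \<star> h = v"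
  shows "is_coequalizer T (Ja r1) (Ja r2) q"
proof (rule J.T.coequalizerI[OF J.F_Hom[OF r(1)] J.F_Hom[OF r(2)] q(1,3)])
  show "w = w'" if "w \<in> Hom T Q Z" "w' \<in> Hom T Q Z" "w \<star> q = w' \<star> q" for Z w w'
    using J.T.regular_epi_cancel[OF q(2,1) that] .
  show "\<exists>w\<in>Hom T Q Z. w \<star> q = u"
    if u: "u \<in> Hom T (Jo B) Z" and eq: "u \<star> Ja r1 = u \<star> Ja r2" for Z u
  proof -
    obtain k1 k2 K where pb: "is_pullback T q q k1 k2" and k: "k1 \<in> Hom T K (Jo B)" "k2 \<in> Hom T K (Jo B)"
      and qk: "q \<star> k1 = q \<star> k2"
      using kernel_pair_exists[OF q(1)] .
    \<comment> \<open>The kernel pair object \<open>K\<close> need not be projective. It is covered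
      by \<open>c\<close>, lifting is applied to \<open>k1 \<star> c\<close> and
      \<open>k2 \<star> c\<close>, and \<open>c\<close> is cancelled at the end.\<close>
    obtain V c where V: "V \<in> ob D" and c: "c \<in> Hom T (Jo V) K" "regular_epi T c"
      using cover[OF J.T.HomD(4)[OF k(1)]] by blast
    have "q \<star> (k1 \<star> c) = q \<star> (k2 \<star> c)"
      using J.T.cmp_assoc[OF c(1) k(1) q(1)] J.T.cmp_assoc[OF c(1) k(2) q(1)] qk by simp
    then obtain h where h: "h \<in> Hom T (Jo V) (Jo A)" "Ja r1 \<star> h = k1 \<star> c" "Ja r2 \<star> h = k2 \<star> c"
      using lift[OF V J.T.cmp_Hom[OF c(1) k(1)] J.T.cmp_Hom[OF c(1) k(2)]] by blast
    have "u \<star> k1 \<star> c = u \<star> Ja r1 \<star> h"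
      using J.T.cmp_assoc[OF c(1) k(1) u] J.T.cmp_assoc[OF h(1) J.F_Hom[OF r(1)] u] h(2) by simp
    also have "\<dots> = u \<star> k2 \<star> c"
      unfolding eq using J.T.cmp_assoc[OF c(1) k(2) u] J.T.cmp_assoc[OF h(1) J.F_Hom[OF r(2)] u] h(3) by simp
    finally have "u \<star> k1 = u \<star> k2"
      using J.T.regular_epi_cancel[OF c(2,1) J.T.cmp_Hom[OF k(1) u] J.T.cmp_Hom[OF k(2) u]] by blast
    then show ?thesis
      using J.T.regular_epi_kernel_pair_factor[OF q(2,1) pb u] by blast
  qed
qed

definition Ob :: "'m ex_ob set" where
  "Ob = {(r1, r2). pseudo_equivalence_relation D r1 r2}"

definition rel :: "'m ex_ob \<Rightarrow> 'o" where "rel U = src D (fst U)"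

definition car :: "'m ex_ob \<Rightarrow> 'o" where "car U = tgt D (fst U)"

lemma Ob_Hom:
  assumes "U \<in> Ob"
  shows "fst U \<in> Hom D (rel U) (car U)" "snd U \<in> Hom D (rel U) (car U)"
  using assms unfolding Ob_def rel_def car_def pseudo_equivalence_relation_def Let_def by auto

lemma car_ob: "U \<in> Ob \<Longrightarrow> car U \<in> ob D" and rel_ob: "U \<in> Ob \<Longrightarrow> rel U \<in> ob D"
  using Ob_Hom(1) J.S.HomD by blast+

text \<open>One quotient is fixed for every pseudo-equivalence relation of \<open>D\<close>;
  \<open>Go\<close> becomes the object part of the functor from the exact completion to
  \<open>T\<close>.\<close>

lemma quotient_choice:
  "\<exists>Go qu. \<forall>U\<in>Ob. qu U \<in> Hom T (Jo (car U)) (Go U) \<and> regular_epi T (qu U) \<and>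
    qu U \<star> Ja (fst U) = qu U \<star> Ja (snd U) \<and>
    (\<forall>Z u v. Z \<in> ob D \<longrightarrow> u \<in> Hom T (Jo Z) (Jo (car U)) \<longrightarrow> v \<in> Hom T (Jo Z) (Jo (car U)) \<longrightarrow>
      qu U \<star> u = qu U \<star> v \<longrightarrow>
      (\<exists>h\<in>Hom T (Jo Z) (Jo (rel U)). Ja (fst U) \<star> h = u \<and> Ja (snd U) \<star> h = v))"
proof -
  have "\<forall>U\<in>Ob. \<exists>Q q. q \<in> Hom T (Jo (car U)) Q \<and> regular_epi T q \<and>
    q \<star> Ja (fst U) = q \<star> Ja (snd U) \<and>
    (\<forall>Z u v. Z \<in> ob D \<longrightarrow> u \<in> Hom T (Jo Z) (Jo (car U)) \<longrightarrow> v \<in> Hom T (Jo Z) (Jo (car U)) \<longrightarrow>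
      q \<star> u = q \<star> v \<longrightarrow>
      (\<exists>h\<in>Hom T (Jo Z) (Jo (rel U)). Ja (fst U) \<star> h = u \<and> Ja (snd U) \<star> h = v))"
  proof
    fix U assume U: "U \<in> Ob"
    then have "pseudo_equivalence_relation D (fst U) (snd U)"
      by (auto simp: Ob_def)
    from quotient[OF this Ob_Hom[OF U]] show "\<exists>Q q. q \<in> Hom T (Jo (car U)) Q \<and> regular_epi T q \<and>
      q \<star> Ja (fst U) = q \<star> Ja (snd U) \<and>
      (\<forall>Z u v. Z \<in> ob D \<longrightarrow> u \<in> Hom T (Jo Z) (Jo (car U)) \<longrightarrow> v \<in> Hom T (Jo Z) (Jo (car U)) \<longrightarrow>
        q \<star> u = q \<star> v \<longrightarrow>
        (\<exists>h\<in>Hom T (Jo Z) (Jo (rel U)). Ja (fst U) \<star> h = u \<and> Ja (snd U) \<star> h = v))"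
      unfolding Bex_def .
  qed
  from bchoice[OF this] obtain Go where "\<forall>U\<in>Ob. \<exists>q. q \<in> Hom T (Jo (car U)) (Go U) \<and> regular_epi T q \<and>
    q \<star> Ja (fst U) = q \<star> Ja (snd U) \<and>
    (\<forall>Z u v. Z \<in> ob D \<longrightarrow> u \<in> Hom T (Jo Z) (Jo (car U)) \<longrightarrow> v \<in> Hom T (Jo Z) (Jo (car U)) \<longrightarrow>
      q \<star> u = q \<star> v \<longrightarrow>
      (\<exists>h\<in>Hom T (Jo Z) (Jo (rel U)). Ja (fst U) \<star> h = u \<and> Ja (snd U) \<star> h = v))" ..
  from bchoice[OF this] show ?thesis by blast
qed

lemma ex_maps_iff:
  "f \<in> ex_maps D U V \<longleftrightarrow> f \<in> Hom D (car U) (car V) \<and>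
    (\<exists>k\<in>Hom D (rel U) (rel V). fst V \<cdot> k = f \<cdot> fst U \<and> snd V \<cdot> k = f \<cdot> snd U)"
  by (cases U; cases V) (simp add: car_def rel_def)

lemma ex_eq_iff:
  "(f, g) \<in> ex_eq D U V \<longleftrightarrow> f \<in> ex_maps D U V \<and> g \<in> ex_maps D U V \<and>
    (\<exists>h\<in>Hom D (car U) (rel V). fst V \<cdot> h = f \<and> snd V \<cdot> h = g)"
  by (cases U; cases V) (simp add: car_def rel_def)

lemma ex_lex_eq: "ex_lex D = quot_cat Ob (ex_maps D) (ex_eq D) (\<lambda>U. ide D (car U)) (\<lambda>g f. g \<cdot> f)"
  by (simp add: ex_lex_def quot_cat_def Ob_def car_def Let_def)

text \<open>Projectivity gives fullness, the lifting property identifies \<open>ex_eq\<close> with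
  equality of the induced arrows, and essential surjectivity comes from covering an object and then
  covering the kernel pair of that cover.\<close>

lemma equivalent_ex_lex: "equivalent_exact_categories T (ex_lex D)"
proof -
  obtain Go qu where *: "\<forall>U\<in>Ob. qu U \<in> Hom T (Jo (car U)) (Go U) \<and> regular_epi T (qu U) \<and>
    qu U \<star> Ja (fst U) = qu U \<star> Ja (snd U) \<and>
    (\<forall>Z u v. Z \<in> ob D \<longrightarrow> u \<in> Hom T (Jo Z) (Jo (car U)) \<longrightarrow> v \<in> Hom T (Jo Z) (Jo (car U)) \<longrightarrow>
      qu U \<star> u = qu U \<star> v \<longrightarrow>
      (\<exists>h\<in>Hom T (Jo Z) (Jo (rel U)). Ja (fst U) \<star> h = u \<and> Ja (snd U) \<star> h = v))"
    using quotient_choice by blast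
  have qu: "qu U \<in> Hom T (Jo (car U)) (Go U)" and qu_epi: "regular_epi T (qu U)"
    and qu_eq: "qu U \<star> Ja (fst U) = qu U \<star> Ja (snd U)" if "U \<in> Ob" for U
    using * that by blast+
  have lift_T: "\<exists>h\<in>Hom T (Jo Z) (Jo (rel U)). Ja (fst U) \<star> h = u \<and> Ja (snd U) \<star> h = v"
    if "U \<in> Ob" "Z \<in> ob D" "u \<in> Hom T (Jo Z) (Jo (car U))" "v \<in> Hom T (Jo Z) (Jo (car U))"
      "qu U \<star> u = qu U \<star> v" for U Z u v
    using * that by blast
  \<comment> \<open>Fullness and faithfulness of \<open>J\<close> turn the lift in \<open>T\<close>
    into one in \<open>D\<close>. Together with \<open>unlift\<close> this says that factoring
    through the relation is the same as being identified by \<open>qu U\<close>.\<close>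
  have lift: "\<exists>h\<in>Hom D Z (rel U). fst U \<cdot> h = u \<and> snd U \<cdot> h = v"
    if U: "U \<in> Ob" and u: "u \<in> Hom D Z (car U)" and v: "v \<in> Hom D Z (car U)"
      and e: "qu U \<star> Ja u = qu U \<star> Ja v" for U Z u v
  proof -
    note Z = J.S.HomD(4)[OF u]
    obtain h where h: "h \<in> Hom T (Jo Z) (Jo (rel U))" "Ja (fst U) \<star> h = Ja u" "Ja (snd U) \<star> h = Ja v"
      using lift_T[OF U Z J.F_Hom[OF u] J.F_Hom[OF v] e] by blast
    obtain h' where h': "h' \<in> Hom D Z (rel U)" "Ja h' = h"
      using J.full[OF Z rel_ob[OF U] h(1)] by blast
    then show ?thesis
      using h J.reflect_eq1[OF h'(1) Ob_Hom(1)[OF U] u] J.reflect_eq1[OF h'(1) Ob_Hom(2)[OF U] v] by blast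
  qed
  have unlift: "qu U \<star> Ja (fst U \<cdot> h) = qu U \<star> Ja (snd U \<cdot> h)"
    if U: "U \<in> Ob" and h: "h \<in> Hom D Z (rel U)" for U Z h
    using J.F_cmp[OF h Ob_Hom(1)[OF U]] J.F_cmp[OF h Ob_Hom(2)[OF U]] qu_eq[OF U]
      J.T.cmp_assoc[OF J.F_Hom[OF h] J.F_Hom[OF Ob_Hom(1)[OF U]] qu[OF U]]
      J.T.cmp_assoc[OF J.F_Hom[OF h] J.F_Hom[OF Ob_Hom(2)[OF U]] qu[OF U]] by simp
  have coeq: "is_coequalizer T (Ja (fst U)) (Ja (snd U)) (qu U)" if U: "U \<in> Ob" for U
    using coequalizer_of_lifting[OF Ob_Hom[OF U] qu[OF U] qu_epi[OF U] qu_eq[OF U]] lift_T[OF U] by blast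
  \<comment> \<open>\<open>K U V f\<close> is the arrow induced on quotients. It exists because an
    arrow of relations over \<open>f\<close> makes \<open>qu V \<star> Ja f\<close> coequalize the
    pair of \<open>U\<close>, and it is unique because \<open>qu U\<close> is epi.\<close>
  define K where "K U V f = (SOME w. w \<in> Hom T (Go U) (Go V) \<and> w \<star> qu U = qu V \<star> Ja f)" for U V f
  have K: "K U V f \<in> Hom T (Go U) (Go V)" "K U V f \<star> qu U = qu V \<star> Ja f"
    if U: "U \<in> Ob" and V: "V \<in> Ob" and f: "f \<in> ex_maps D U V" for U V f
  proof -
    obtain k where f': "f \<in> Hom D (car U) (car V)" and k: "k \<in> Hom D (rel U) (rel V)"
      "fst V \<cdot> k = f \<cdot> fst U" "snd V \<cdot> k = f \<cdot> snd U"
      using f unfolding ex_maps_iff by blast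
    note u = J.T.cmp_Hom[OF J.F_Hom[OF f'] qu[OF V]]
    have "qu V \<star> Ja f \<star> Ja (fst U) = qu V \<star> Ja f \<star> Ja (snd U)"
      using unlift[OF V k(1)] unfolding k(2,3)
      using J.F_cmp[OF Ob_Hom(1)[OF U] f'] J.F_cmp[OF Ob_Hom(2)[OF U] f']
        J.T.cmp_assoc[OF J.F_Hom[OF Ob_Hom(1)[OF U]] J.F_Hom[OF f'] qu[OF V]]
        J.T.cmp_assoc[OF J.F_Hom[OF Ob_Hom(2)[OF U]] J.F_Hom[OF f'] qu[OF V]] by simp
    then have "\<exists>w. w \<in> Hom T (Go U) (Go V) \<and> w \<star> qu U = qu V \<star> Ja f"
      using coeq[OF U] u unfolding is_coequalizer_def J.T.HomD(3)[OF J.F_Hom[OF Ob_Hom(1)[OF U]]]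
        J.T.HomD(3)[OF qu[OF U]] by blast
    from someI_ex[OF this] show "K U V f \<in> Hom T (Go U) (Go V)" "K U V f \<star> qu U = qu V \<star> Ja f"
      unfolding K_def by auto
  qed
  have K_unique: "K U V f = w"
    if U: "U \<in> Ob" and V: "V \<in> Ob" and f: "f \<in> ex_maps D U V"
      and w: "w \<in> Hom T (Go U) (Go V)" "w \<star> qu U = qu V \<star> Ja f" for U V f w
    using J.T.regular_epi_cancel[OF qu_epi[OF U] qu[OF U] K(1)[OF U V f] w(1)] K(2)[OF U V f] w(2) by simp
  have maps_Hom: "f \<in> Hom D (car U) (car V)" if "f \<in> ex_maps D U V" for f U V
    using that unfolding ex_maps_iff by blast
  interpret Q: quotient_presentation T Ob "ex_maps D" "ex_eq D" "\<lambda>U. ide D (car U)" "\<lambda>g f. g \<cdot> f" Go K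
  proof
    show "Go U \<in> ob T" if "U \<in> Ob" for U
      using J.T.HomD(5)[OF qu[OF that]] .
    show "K U V f \<in> Hom T (Go U) (Go V)" if "U \<in> Ob" "V \<in> Ob" "f \<in> ex_maps D U V" for U V f
      using K(1)[OF that] .
    show "\<exists>f\<in>ex_maps D U V. K U V f = h" if U: "U \<in> Ob" and V: "V \<in> Ob" and h: "h \<in> Hom T (Go U) (Go V)" for U V h
    proof -
      \<comment> \<open>Projectivity of \<open>Jo (car U)\<close> lifts \<open>h\<close> to the
        carriers. The lift respects the relations, since its values on related elements are
        identified by \<open>qu V\<close> and hence are related, by \<open>lift\<close>.\<close>
      obtain g where g: "g \<in> Hom T (Jo (car U)) (Jo (car V))" "qu V \<star> g = h \<star> qu U"
        using projective[OF car_ob[OF U] qu[OF V] qu_epi[OF V] J.T.cmp_Hom[OF qu[OF U] h]] by blast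
      obtain f where f: "f \<in> Hom D (car U) (car V)" "Ja f = g"
        using J.full[OF car_ob[OF U] car_ob[OF V] g(1)] by blast
      note r = Ob_Hom[OF U] note Jr = J.F_Hom[OF r(1)] J.F_Hom[OF r(2)]
      have *: "qu V \<star> Ja (f \<cdot> r') = h \<star> (qu U \<star> Ja r')" if r': "r' \<in> Hom D (rel U) (car U)" for r'
        using J.F_cmp[OF r' f(1)] f(2) g(2) J.T.cmp_assoc[OF J.F_Hom[OF r'] g(1) qu[OF V]]
          J.T.cmp_assoc[OF J.F_Hom[OF r'] qu[OF U] h] by simp
      have "f \<in> ex_maps D U V"
        unfolding ex_maps_iff
        using f(1) lift[OF V J.S.cmp_Hom[OF r(1) f(1)] J.S.cmp_Hom[OF r(2) f(1)]] *[OF r(1)] *[OF r(2)] qu_eq[OF U]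
        by simp
      then show ?thesis
        using K_unique[OF U V _ h] f(2) g(2) by metis
    qed
    show "ex_eq D U V = {(f, g). f \<in> ex_maps D U V \<and> g \<in> ex_maps D U V \<and> K U V f = K U V g}"
      if U: "U \<in> Ob" and V: "V \<in> Ob" for U V
    proof -
      \<comment> \<open>The arrow in \<open>ex_eq\<close> factors the pair \<open>f\<close>,
        \<open>g\<close> through the relation, which by \<open>lift\<close> and
        \<open>unlift\<close> means that \<open>qu V\<close> identifies their images.\<close>
      have "(\<exists>h\<in>Hom D (car U) (rel V). fst V \<cdot> h = f \<and> snd V \<cdot> h = g) \<longleftrightarrow> K U V f = K U V g"
        if f: "f \<in> ex_maps D U V" and g: "g \<in> ex_maps D U V" for f g
      proof
        assume "\<exists>h\<in>Hom D (car U) (rel V). fst V \<cdot> h = f \<and> snd V \<cdot> h = g"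
        then have "qu V \<star> Ja f = qu V \<star> Ja g"
          using unlift[OF V] by blast
        then show "K U V f = K U V g"
          using K_unique[OF U V f K(1)[OF U V g]] K(2)[OF U V g] by simp
      next
        assume "K U V f = K U V g"
        then have "qu V \<star> Ja f = qu V \<star> Ja g"
          using K(2)[OF U V f] K(2)[OF U V g] by simp
        then show "\<exists>h\<in>Hom D (car U) (rel V). fst V \<cdot> h = f \<and> snd V \<cdot> h = g"
          using lift[OF V maps_Hom[OF f] maps_Hom[OF g]] by blast
      qed
      then show ?thesis
        using ex_eq_iff by blast
    qed
    show i: "ide D (car U) \<in> ex_maps D U U" if U: "U \<in> Ob" for U
    proof -
      note r = Ob_Hom[OF U]
      show ?thesis
        unfolding ex_maps_iff
        using J.S.ide_Hom[OF car_ob[OF U]] J.S.ide_Hom[OF rel_ob[OF U]] J.S.cmp_ide_left[OF r(1)]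
          J.S.cmp_ide_left[OF r(2)] J.S.cmp_ide_right[OF r(1)] J.S.cmp_ide_right[OF r(2)] by auto
    qed
    show "K U U (ide D (car U)) = ide T (Go U)" if U: "U \<in> Ob" for U
      using K_unique[OF U U i[OF U] J.T.ide_Hom[OF J.T.HomD(5)[OF qu[OF U]]]]
        J.T.cmp_ide_left[OF qu[OF U]] J.T.cmp_ide_right[OF qu[OF U]] J.F_ide[OF car_ob[OF U]] by simp
    fix U V W f g
    assume U: "U \<in> Ob" and V: "V \<in> Ob" and W: "W \<in> Ob" and f: "f \<in> ex_maps D U V" and g: "g \<in> ex_maps D V W"
    note f' = maps_Hom[OF f] and g' = maps_Hom[OF g]
    show c: "g \<cdot> f \<in> ex_maps D U W"
    proof -
      obtain k where k: "k \<in> Hom D (rel U) (rel V)" "fst V \<cdot> k = f \<cdot> fst U" "snd V \<cdot> k = f \<cdot> snd U"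
        using f unfolding ex_maps_iff by blast
      obtain l where l: "l \<in> Hom D (rel V) (rel W)" "fst W \<cdot> l = g \<cdot> fst V" "snd W \<cdot> l = g \<cdot> snd V"
        using g unfolding ex_maps_iff by blast
      have "fst W \<cdot> (l \<cdot> k) = g \<cdot> f \<cdot> fst U"
        using J.S.cmp_assoc[OF k(1) l(1) Ob_Hom(1)[OF W]] J.S.cmp_assoc[OF k(1) Ob_Hom(1)[OF V] g']
          J.S.cmp_assoc[OF Ob_Hom(1)[OF U] f' g'] k(2) l(2) by simp
      moreover have "snd W \<cdot> (l \<cdot> k) = g \<cdot> f \<cdot> snd U"
        using J.S.cmp_assoc[OF k(1) l(1) Ob_Hom(2)[OF W]] J.S.cmp_assoc[OF k(1) Ob_Hom(2)[OF V] g']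
          J.S.cmp_assoc[OF Ob_Hom(2)[OF U] f' g'] k(3) l(3) by simp
      ultimately show ?thesis
        unfolding ex_maps_iff using J.S.cmp_Hom[OF f' g'] J.S.cmp_Hom[OF k(1) l(1)] by blast
    qed
    show "K U W (g \<cdot> f) = K V W g \<star> K U V f"
    proof (rule K_unique[OF U W c J.T.cmp_Hom[OF K(1)[OF U V f] K(1)[OF V W g]]])
      have "K V W g \<star> K U V f \<star> qu U = K V W g \<star> (qu V \<star> Ja f)"
        using J.T.cmp_assoc[OF qu[OF U] K(1)[OF U V f] K(1)[OF V W g]] K(2)[OF U V f] by simp
      also have "\<dots> = qu W \<star> Ja g \<star> Ja f"
        using J.T.cmp_assoc[OF J.F_Hom[OF f'] qu[OF V] K(1)[OF V W g]] K(2)[OF V W g] by simp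
      also have "\<dots> = qu W \<star> Ja (g \<cdot> f)"
        using J.T.cmp_assoc[OF J.F_Hom[OF f'] J.F_Hom[OF g'] qu[OF W]] J.F_cmp[OF f' g'] by simp
      finally show "K V W g \<star> K U V f \<star> qu U = qu W \<star> Ja (g \<cdot> f)" .
    qed
  qed
  have eso: "\<exists>U\<in>Ob. \<exists>e\<in>Hom T (Go U) Z. \<exists>e'\<in>Hom T Z (Go U). e' \<star> e = ide T (Go U) \<and> e \<star> e' = ide T Z"
    if Z: "Z \<in> ob T" for Z
  proof -
    \<comment> \<open>The object \<open>Z\<close> is presented by a cover \<open>X\<close> and a
      cover \<open>A\<close> of the kernel pair of \<open>X \<rightarrow> Z\<close>. As the second
      cover is rarely invertible, \<open>r1\<close> and \<open>r2\<close> need not be jointly monic;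
      this is where pseudo-equivalence relations are forced.\<close>
    obtain X p where X: "X \<in> ob D" and p: "p \<in> Hom T (Jo X) Z" "regular_epi T p"
      using cover[OF Z] by blast
    obtain k1 k2 M where pb: "is_pullback T p p k1 k2" and k: "k1 \<in> Hom T M (Jo X)" "k2 \<in> Hom T M (Jo X)"
      and pk: "p \<star> k1 = p \<star> k2"
      using kernel_pair_exists[OF p(1)] .
    obtain A c where A: "A \<in> ob D" and c: "c \<in> Hom T (Jo A) M" "regular_epi T c"
      using cover[OF J.T.HomD(4)[OF k(1)]] by blast
    obtain r1 where r1: "r1 \<in> Hom D A X" "Ja r1 = k1 \<star> c"
      using J.full[OF A X J.T.cmp_Hom[OF c(1) k(1)]] by blast
    obtain r2 where r2: "r2 \<in> Hom D A X" "Ja r2 = k2 \<star> c"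
      using J.full[OF A X J.T.cmp_Hom[OF c(1) k(2)]] by blast
    have pr: "p \<star> Ja r1 = p \<star> Ja r2"
      using J.T.cmp_assoc[OF c(1) k(1) p(1)] J.T.cmp_assoc[OF c(1) k(2) p(1)] r1(2) r2(2) pk by simp
    have plift_T: "\<exists>h\<in>Hom T (Jo V) (Jo A). Ja r1 \<star> h = u \<and> Ja r2 \<star> h = v"
      if V: "V \<in> ob D" and u: "u \<in> Hom T (Jo V) (Jo X)" and v: "v \<in> Hom T (Jo V) (Jo X)"
        and uv: "p \<star> u = p \<star> v" for V u v
    proof -
      obtain w where w: "w \<in> Hom T (Jo V) M" "k1 \<star> w = u" "k2 \<star> w = v"
        using pb u v uv unfolding is_pullback_def J.T.HomD(2)[OF p(1)] J.T.HomD(2)[OF k(1)] by blast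
      obtain h where h: "h \<in> Hom T (Jo V) (Jo A)" "c \<star> h = w"
        using projective[OF V c w(1)] by blast
      then show ?thesis
        using J.T.cmp_assoc[OF h(1) c(1) k(1)] J.T.cmp_assoc[OF h(1) c(1) k(2)] r1(2) r2(2) w(2,3) by auto
    qed
    have plift: "\<exists>h\<in>Hom D V A. r1 \<cdot> h = u \<and> r2 \<cdot> h = v"
      if u: "u \<in> Hom D V X" and v: "v \<in> Hom D V X" and uv: "p \<star> Ja u = p \<star> Ja v" for V u v
    proof -
      note V = J.S.HomD(4)[OF u]
      obtain h where h: "h \<in> Hom T (Jo V) (Jo A)" "Ja r1 \<star> h = Ja u" "Ja r2 \<star> h = Ja v"
        using plift_T[OF V J.F_Hom[OF u] J.F_Hom[OF v] uv] by blast
      obtain h' where h': "h' \<in> Hom D V A" "Ja h' = h"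
        using J.full[OF V A h(1)] by blast
      then show ?thesis
        using h J.reflect_eq1[OF h'(1) r1(1) u] J.reflect_eq1[OF h'(1) r2(1) v] by blast
    qed
    have pr': "p \<star> Ja (r1 \<cdot> h) = p \<star> Ja (r2 \<cdot> h)" if h: "h \<in> Hom D V A" for V h
      using J.F_cmp[OF h r1(1)] J.F_cmp[OF h r2(1)] pr
        J.T.cmp_assoc[OF J.F_Hom[OF h] J.F_Hom[OF r1(1)] p(1)]
        J.T.cmp_assoc[OF J.F_Hom[OF h] J.F_Hom[OF r2(1)] p(1)] by simp
    \<comment> \<open>Every clause asks to factor a pair that \<open>p\<close> identifies, so
      \<open>plift\<close> supplies all three arrows.\<close>
    have "pseudo_equivalence_relation D r1 r2"
    proof (rule J.S.pseudo_equivalence_relationI[OF r1(1) r2(1)])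
      show "\<exists>d\<in>Hom D X A. r1 \<cdot> d = ide D X \<and> r2 \<cdot> d = ide D X"
        using plift[OF J.S.ide_Hom[OF X] J.S.ide_Hom[OF X]] by blast
      show "\<exists>s\<in>Hom D A A. r1 \<cdot> s = r2 \<and> r2 \<cdot> s = r1"
        using plift[OF r2(1) r1(1)] pr by simp
      fix V u v assume u: "u \<in> Hom D V A" and v: "v \<in> Hom D V A" and uv: "r2 \<cdot> u = r1 \<cdot> v"
      show "\<exists>t\<in>Hom D V A. r1 \<cdot> t = r1 \<cdot> u \<and> r2 \<cdot> t = r2 \<cdot> v"
        using plift[OF J.S.cmp_Hom[OF u r1(1)] J.S.cmp_Hom[OF v r2(1)]] pr'[OF u] pr'[OF v] uv by simp
    qed
    then have U: "(r1, r2) \<in> Ob"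
      by (simp add: Ob_def)
    have b: "car (r1, r2) = X"
      using J.S.HomD(3)[OF r1(1)] by (simp add: car_def)
    \<comment> \<open>The cover \<open>p\<close> and the chosen quotient map coequalize the same
      pair, whence \<open>Z\<close> is isomorphic to \<open>Go (r1, r2)\<close>.\<close>
    have "is_coequalizer T (Ja r1) (Ja r2) p"
      using coequalizer_of_lifting[OF r1(1) r2(1) p pr] plift_T by blast
    then show ?thesis
      using J.T.coequalizer_unique[OF coeq[OF U, unfolded fst_conv snd_conv] _ qu[OF U, unfolded b] p(1)] U by blast
  qed
  interpret F: ff_functor Q.Q T Go Q.Ga
    by (rule Q.ff_functor_Q)
  interpret equivalence Q.Q T Go Q.Ga
    by unfold_locales (use eso in \<open>simp add: quot_cat_def\<close>)
  show ?thesis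
    unfolding ex_lex_eq using equivalent_exact_categories[OF exact] .
qed

end


section \<open>Semantics at existential-free stages\<close>

context fp_category
begin

section \<open>Products in the base category\<close>

lemma prd_ob: "A \<in> ob C \<Longrightarrow> B \<in> ob C \<Longrightarrow> prd C A B \<in> ob C"
  and pr1_Hom: "A \<in> ob C \<Longrightarrow> B \<in> ob C \<Longrightarrow> pr1 C A B \<in> Hom C (prd C A B) A"
  and pr2_Hom: "A \<in> ob C \<Longrightarrow> B \<in> ob C \<Longrightarrow> pr2 C A B \<in> Hom C (prd C A B) B"
  using prd_product[of A B] HomD(4) unfolding is_product_def by blast+

lemma pr_simps [simp]:
  assumes "A \<in> ob C" "B \<in> ob C"
  shows "pr1 C A B \<in> ar C" "src C (pr1 C A B) = prd C A B" "tgt C (pr1 C A B) = A"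
    "pr2 C A B \<in> ar C" "src C (pr2 C A B) = prd C A B" "tgt C (pr2 C A B) = B"
  using pr1_Hom[OF assms] pr2_Hom[OF assms] by (auto simp: Hom_def)

lemma pair:
  assumes "f \<in> Hom C Z A" "g \<in> Hom C Z B"
  shows pair_Hom: "pair C f g \<in> Hom C Z (prd C A B)"
    and pr1_pair: "pr1 C A B \<odot> pair C f g = f"
    and pr2_pair: "pr2 C A B \<odot> pair C f g = g"
    and pair_unique: "h \<in> Hom C Z (prd C A B) \<Longrightarrow> pr1 C A B \<odot> h = f \<Longrightarrow> pr2 C A B \<odot> h = g \<Longrightarrow> pair C f g = h"
proof -
  have *: "\<exists>!h. h \<in> Hom C Z (prd C A B) \<and> pr1 C A B \<odot> h = f \<and> pr2 C A B \<odot> h = g"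
    using prd_product[OF HomD(5)[OF assms(1)] HomD(5)[OF assms(2)]] assms
    unfolding is_product_def by blast
  have eq: "src C f = Z" "tgt C f = A" "tgt C g = B"
    using assms by (auto simp: Hom_def)
  note th = theI'[OF *]
  show "pair C f g \<in> Hom C Z (prd C A B)" "pr1 C A B \<odot> pair C f g = f" "pr2 C A B \<odot> pair C f g = g"
    unfolding pair_def eq using th by auto
  show "pair C f g = h"
    if "h \<in> Hom C Z (prd C A B)" "pr1 C A B \<odot> h = f" "pr2 C A B \<odot> h = g"
    unfolding pair_def eq using the1_equality[OF *, of h] that by blast
qed

lemma pair_simps [simp]:
  assumes "f \<in> ar C" "g \<in> ar C" "src C f = src C g"
  shows "pair C f g \<in> ar C" "src C (pair C f g) = src C g"
    "tgt C (pair C f g) = prd C (tgt C f) (tgt C g)"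
    "tgt C f = A \<Longrightarrow> tgt C g = B \<Longrightarrow> pr1 C A B \<odot> pair C f g = f"
    "tgt C f = A \<Longrightarrow> tgt C g = B \<Longrightarrow> pr2 C A B \<odot> pair C f g = g"
  using pair(1-3)[of f "src C f" "tgt C f" g "tgt C g"] assms by (auto simp: Hom_def)

lemma pair_eta:
  assumes "h \<in> Hom C Z (prd C A B)" "A \<in> ob C" "B \<in> ob C"
  shows "pair C (pr1 C A B \<odot> h) (pr2 C A B \<odot> h) = h"
  using assms pair_unique[of "pr1 C A B \<odot> h" Z A "pr2 C A B \<odot> h" B h] pr1_Hom pr2_Hom cmp_Hom by simp

lemma pair_cmp:
  assumes "h \<in> ar C" "f \<in> ar C" "g \<in> ar C" "src C f = tgt C h" "src C g = tgt C h"
  shows "pair C f g \<odot> h = pair C (f \<odot> h) (g \<odot> h)"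
proof (rule pair_unique[symmetric])
  show "f \<odot> h \<in> Hom C (src C h) (tgt C f)" "g \<odot> h \<in> Hom C (src C h) (tgt C g)"
    "pair C f g \<odot> h \<in> Hom C (src C h) (prd C (tgt C f) (tgt C g))"
    using assms by (auto simp: Hom_def)
  show "pr1 C (tgt C f) (tgt C g) \<odot> (pair C f g \<odot> h) = f \<odot> h"
    "pr2 C (tgt C f) (tgt C g) \<odot> (pair C f g \<odot> h) = g \<odot> h"
    using assms tgt_ob by (simp_all add: assocl)
qed

text \<open>Pulling back a projection along \<open>f\<close> gives the projection from
  \<open>Z x B\<close>, with \<open>f x B\<close> on top. Beck-Chevalley is applied to this square
  and to its transpose only.\<close>

lemma pullback_pr1:
  assumes f: "f \<in> Hom C Z A" and B: "B \<in> ob C"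
  shows "is_pullback C (pr1 C A B) f (pair C (f \<odot> pr1 C Z B) (pr2 C Z B)) (pr1 C Z B)"
proof (rule pullbackI)
  note Z = HomD(4)[OF f] and A = HomD(5)[OF f]
  show "pr1 C A B \<in> Hom C (prd C A B) A" "pr1 C Z B \<in> Hom C (prd C Z B) Z"
    using A B Z pr1_Hom by auto
  show "f \<in> Hom C Z A" by fact
  show "pair C (f \<odot> pr1 C Z B) (pr2 C Z B) \<in> Hom C (prd C Z B) (prd C A B)"
    "pr1 C A B \<odot> pair C (f \<odot> pr1 C Z B) (pr2 C Z B) = f \<odot> pr1 C Z B"
    using f Z A B by (simp_all add: Hom_def)
  show "\<exists>w\<in>Hom C V (prd C Z B). pair C (f \<odot> pr1 C Z B) (pr2 C Z B) \<odot> w = u \<and> pr1 C Z B \<odot> w = v"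
    if u: "u \<in> Hom C V (prd C A B)" and v: "v \<in> Hom C V Z" and uv: "pr1 C A B \<odot> u = f \<odot> v" for V u v
  proof (intro bexI conjI)
    show "pair C v (pr2 C A B \<odot> u) \<in> Hom C V (prd C Z B)"
      using u v A B by (simp add: Hom_def)
    show "pr1 C Z B \<odot> pair C v (pr2 C A B \<odot> u) = v"
      using u v A B by (simp add: Hom_def)
    have "pair C (f \<odot> pr1 C Z B) (pr2 C Z B) \<odot> pair C v (pr2 C A B \<odot> u)
        = pair C (pr1 C A B \<odot> u) (pr2 C A B \<odot> u)"
      using u v A B Z f uv by (simp add: Hom_def pair_cmp assocr)
    then show "pair C (f \<odot> pr1 C Z B) (pr2 C Z B) \<odot> pair C v (pr2 C A B \<odot> u) = u"
      using pair_eta[OF u A B] by simp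
  qed
  show "w = w'"
    if w: "w \<in> Hom C V (prd C Z B)" "w' \<in> Hom C V (prd C Z B)"
      and e1: "pair C (f \<odot> pr1 C Z B) (pr2 C Z B) \<odot> w = pair C (f \<odot> pr1 C Z B) (pr2 C Z B) \<odot> w'"
      and e2: "pr1 C Z B \<odot> w = pr1 C Z B \<odot> w'" for V w w'
  proof -
    have "pr2 C A B \<odot> (pair C (f \<odot> pr1 C Z B) (pr2 C Z B) \<odot> w)
        = pr2 C A B \<odot> (pair C (f \<odot> pr1 C Z B) (pr2 C Z B) \<odot> w')"
      using e1 by simp
    then have "pr2 C Z B \<odot> w = pr2 C Z B \<odot> w'"
      using w A B Z f by (simp add: Hom_def assocl)
    then show ?thesis
      using e2 pair_eta[OF w(1) Z B] pair_eta[OF w(2) Z B] by metis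
  qed
qed

end

context doctrine
begin

section \<open>Predicates, stages and truth at an element\<close>

sublocale B: fp_category "base P"
  by (rule base_fp)

abbreviation "C \<equiv> base P"

abbreviation base_cmp (infixl "\<cdot>" 70) where "g \<cdot> f \<equiv> g \<odot>\<^bsub>C\<^esub> f"

abbreviation le ("_ \<le>[_] _" [51, 0, 51] 50) where "\<alpha> \<le>[A] \<beta> \<equiv> \<alpha> \<sqsubseteq>\<^bsub>fib P A\<^esub> \<beta>"

lemma rei_preds: "f \<in> Hom C A B \<Longrightarrow> \<alpha> \<in> preds P B \<Longrightarrow> rei P f \<alpha> \<in> preds P A"
  using rei_closed by blast

lemma le_refl: "A \<in> ob C \<Longrightarrow> \<alpha> \<in> preds P A \<Longrightarrow> \<alpha> \<le>[A] \<alpha>"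
  using weak_partial_order.le_refl[OF partial_order.axioms(1)[OF fib_poset]] by blast

lemma le_trans:
  "A \<in> ob C \<Longrightarrow> \<alpha> \<le>[A] \<beta> \<Longrightarrow> \<beta> \<le>[A] \<gamma> \<Longrightarrow> \<alpha> \<in> preds P A \<Longrightarrow> \<beta> \<in> preds P A \<Longrightarrow> \<gamma> \<in> preds P A
    \<Longrightarrow> \<alpha> \<le>[A] \<gamma>"
  using weak_partial_order.le_trans[OF partial_order.axioms(1)[OF fib_poset]] by blast

lemma le_antisym:
  "A \<in> ob C \<Longrightarrow> \<alpha> \<le>[A] \<beta> \<Longrightarrow> \<beta> \<le>[A] \<alpha> \<Longrightarrow> \<alpha> \<in> preds P A \<Longrightarrow> \<beta> \<in> preds P A \<Longrightarrow> \<alpha> = \<beta>"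
  using partial_order.le_antisym[OF fib_poset] by blast

lemma rei_le:
  "f \<in> Hom C A B \<Longrightarrow> \<alpha> \<le>[B] \<beta> \<Longrightarrow> \<alpha> \<in> preds P B \<Longrightarrow> \<beta> \<in> preds P B \<Longrightarrow> rei P f \<alpha> \<le>[A] rei P f \<beta>"
  using rei_mono[of f A B] unfolding isotone_def by blast

text \<open>Antisymmetry of the fibre pins down the definite description in \<open>exq\<close>,
  which therefore takes the values of any left adjoint \<open>L\<close>.\<close>

lemma exq:
  assumes f: "f \<in> Hom C A B" and "has_left_adjoint P f" and \<alpha>: "\<alpha> \<in> preds P A"
  shows exq_preds: "exq P f \<alpha> \<in> preds P B"
    and exq_le_iff: "\<beta> \<in> preds P B \<Longrightarrow> exq P f \<alpha> \<le>[B] \<beta> \<longleftrightarrow> \<alpha> \<le>[A] rei P f \<beta>"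
proof -
  have AB: "src C f = A" "tgt C f = B" and B: "B \<in> ob C"
    using B.HomD[OF f] by auto
  obtain L where L: "L \<in> preds P A \<rightarrow> preds P B"
    "\<And>\<alpha> \<beta>. \<alpha> \<in> preds P A \<Longrightarrow> \<beta> \<in> preds P B \<Longrightarrow> L \<alpha> \<le>[B] \<beta> \<longleftrightarrow> \<alpha> \<le>[A] rei P f \<beta>"
    using assms(2) unfolding has_left_adjoint_def Let_def AB by blast
  have "exq P f \<alpha> = L \<alpha>"
    unfolding exq_def Let_def AB
  proof (rule the_equality)
    show "L \<alpha> \<in> preds P B \<and> (\<forall>\<beta>\<in>preds P B. L \<alpha> \<le>[B] \<beta> \<longleftrightarrow> \<alpha> \<le>[A] rei P f \<beta>)"
      using L \<alpha> by blast
    show "\<gamma> = L \<alpha>"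
      if \<gamma>: "\<gamma> \<in> preds P B \<and> (\<forall>\<beta>\<in>preds P B. \<gamma> \<le>[B] \<beta> \<longleftrightarrow> \<alpha> \<le>[A] rei P f \<beta>)" for \<gamma>
    proof (rule le_antisym[OF B])
      have L\<alpha>: "L \<alpha> \<in> preds P B"
        using L(1) \<alpha> by blast
      then show "\<gamma> \<le>[B] L \<alpha>" "L \<alpha> \<le>[B] \<gamma>" "\<gamma> \<in> preds P B" "L \<alpha> \<in> preds P B"
        using \<gamma> L(2)[OF \<alpha>] le_refl[OF B] by blast+
    qed
  qed
  then show "exq P f \<alpha> \<in> preds P B" "\<beta> \<in> preds P B \<Longrightarrow> exq P f \<alpha> \<le>[B] \<beta> \<longleftrightarrow> \<alpha> \<le>[A] rei P f \<beta>"
    using L \<alpha> by auto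
qed

text \<open>Stages are exactly the objects of \<open>Pred_existential_free\<close>
  (\<open>Pred_ob\<close>), so such an object can later serve as a stage for arrows out of
  itself.\<close>

definition stage :: "'o \<times> 'p \<Rightarrow> bool" where
  "stage s \<longleftrightarrow> fst s \<in> ob C \<and> existential_free P (fst s) (snd s)"

definition el :: "'o \<times> 'p \<Rightarrow> 'o \<Rightarrow> 'm set" where
  "el s A = Hom C (fst s) A"

definition Tr :: "'o \<times> 'p \<Rightarrow> 'p \<Rightarrow> 'm \<Rightarrow> bool" where
  "Tr s \<phi> a \<longleftrightarrow> snd s \<le>[fst s] rei P a \<phi>"

lemma stageD:
  assumes "stage s"
  shows "fst s \<in> ob C" "snd s \<in> preds P (fst s)"
  using assms by (auto simp: stage_def existential_free_def)

lemma el_simps: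
  assumes "a \<in> el s A"
  shows "a \<in> ar C" "src C a = fst s" "tgt C a = A" "A \<in> ob C"
  using B.HomD[of a "fst s" A] assms by (auto simp: el_def)

lemma el_cmp [simp]: "a \<in> el s A \<Longrightarrow> f \<in> Hom C A B \<Longrightarrow> f \<cdot> a \<in> el s B"
  unfolding el_def by (rule B.cmp_Hom)

lemma el_pr [simp]:
  assumes "w \<in> el s (prd C A B)" "A \<in> ob C" "B \<in> ob C"
  shows "pr1 C A B \<cdot> w \<in> el s A" "pr2 C A B \<cdot> w \<in> el s B"
  using assms B.pr1_Hom B.pr2_Hom by auto

lemma el_pair [simp]: "a \<in> el s A \<Longrightarrow> b \<in> el s B \<Longrightarrow> pair C a b \<in> el s (prd C A B)"
  unfolding el_def by (rule B.pair_Hom)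

lemma pr_pair_el [simp]:
  assumes "a \<in> el s A" "b \<in> el s B"
  shows "pr1 C A B \<cdot> pair C a b = a" "pr2 C A B \<cdot> pair C a b = b"
  using B.pair(2,3)[of a "fst s" A b B] assms unfolding el_def by auto

lemma pair_eta_el [simp]:
  "w \<in> el s (prd C A B) \<Longrightarrow> A \<in> ob C \<Longrightarrow> B \<in> ob C
    \<Longrightarrow> pair C (pr1 C A B \<cdot> w) (pr2 C A B \<cdot> w) = w"
  unfolding el_def by (rule B.pair_eta)

lemma cmp_assoc_el:
  "a \<in> el s A \<Longrightarrow> f \<in> Hom C A B \<Longrightarrow> g \<in> Hom C B D \<Longrightarrow> (g \<cdot> f) \<cdot> a = g \<cdot> (f \<cdot> a)"
  unfolding el_def using B.cmp_assoc[of a "fst s" A f B g D] by simp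

lemma pair_cmp_el:
  "a \<in> el s A \<Longrightarrow> f \<in> Hom C A B \<Longrightarrow> g \<in> Hom C A D
    \<Longrightarrow> pair C f g \<cdot> a = pair C (f \<cdot> a) (g \<cdot> a)"
  unfolding el_def by (rule B.pair_cmp) (auto simp: Hom_def)

text \<open>By pairing, elements of a product are pairs of elements. Entailments in contexts of two
  and three variables are split into separate variables in this way.\<close>

lemma all_el_prd:
  assumes "A \<in> ob C" "B \<in> ob C"
  shows "(\<forall>w\<in>el s (prd C A B). Q w) \<longleftrightarrow> (\<forall>a\<in>el s A. \<forall>b\<in>el s B. Q (pair C a b))"
  using assms by (metis el_pair el_pr pair_eta_el)

lemma Tr_rei:
  "a \<in> el s A \<Longrightarrow> f \<in> Hom C A B \<Longrightarrow> \<phi> \<in> preds P B \<Longrightarrow> Tr s (rei P f \<phi>) a \<longleftrightarrow> Tr s \<phi> (f \<cdot> a)"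
  unfolding el_def Tr_def by (simp add: rei_cmp)

lemma Tr_sub2:
  "a \<in> el s A \<Longrightarrow> f \<in> Hom C A B \<Longrightarrow> g \<in> Hom C A D \<Longrightarrow> \<phi> \<in> preds P (prd C B D)
    \<Longrightarrow> Tr s (sub2 P \<phi> f g) a \<longleftrightarrow> Tr s \<phi> (pair C (f \<cdot> a) (g \<cdot> a))"
  unfolding sub2_def by (simp add: Tr_rei[OF _ B.pair_Hom] pair_cmp_el)

lemma sub2_preds:
  "f \<in> Hom C A B \<Longrightarrow> g \<in> Hom C A D \<Longrightarrow> \<phi> \<in> preds P (prd C B D) \<Longrightarrow> sub2 P \<phi> f g \<in> preds P A"
  unfolding sub2_def by (rule rei_preds[OF B.pair_Hom])

lemma Tr_le:
  assumes "stage s" "a \<in> el s A" "\<phi> \<in> preds P A" "\<psi> \<in> preds P A" "\<phi> \<le>[A] \<psi>" "Tr s \<phi> a"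
  shows "Tr s \<psi> a"
  using assms stageD[OF assms(1)] rei_le[of a "fst s" A \<phi> \<psi>] rei_preds[of a "fst s" A]
    le_trans[of "fst s" "snd s" "rei P a \<phi>" "rei P a \<psi>"]
  unfolding Tr_def el_def by blast

text \<open>The conditions on \<open>h\<close> say that it is an arrow of predicates from
  \<open>t\<close> to \<open>s\<close>. Truth persists along such a change of stage, which later
  specializes a generic element to an arbitrary one.\<close>

lemma Tr_mono:
  assumes s: "stage s" and t: "stage t" and a: "a \<in> el s A" and \<phi>: "\<phi> \<in> preds P A"
    and h: "h \<in> el t (fst s)" "Tr t (snd s) h" and "Tr s \<phi> a"
  shows "Tr t \<phi> (a \<cdot> h)"
proof -
  have "rei P h (snd s) \<le>[fst t] rei P h (rei P a \<phi>)"
    using assms stageD[OF s] rei_preds unfolding Tr_def el_def by (intro rei_le) auto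
  moreover have "rei P (a \<cdot> h) \<phi> = rei P h (rei P a \<phi>)"
    using rei_cmp h(1) a \<phi> unfolding el_def by blast
  ultimately show ?thesis
    using le_trans[OF stageD(1)[OF t], of "snd t" "rei P h (snd s)" "rei P h (rei P a \<phi>)"]
      h a \<phi> stageD[OF s] stageD[OF t] rei_preds
    unfolding Tr_def el_def by (metis)
qed

lemma stage_el_ide: "stage s \<Longrightarrow> ide C (fst s) \<in> el s (fst s)"
  unfolding el_def using stageD B.ide_Hom by blast

lemma stage_Tr_ide: "stage s \<Longrightarrow> Tr s (snd s) (ide C (fst s))"
  unfolding Tr_def using stageD[of s] rei_ide le_refl by simp

end

locale goedel_hyperdoctrine = first_order_hyperdoctrine P for P :: "('o, 'm, 'p) doctr" +
  assumes goedel: "goedel_doctrine P"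
begin

section \<open>Truth of the logical operations and completeness of the stages\<close>

lemma enough: "A \<in> ob C \<Longrightarrow> \<alpha> \<in> preds P A \<Longrightarrow>
  \<exists>B\<in>ob C. \<exists>\<beta>. existential_free P (prd C A B) \<beta> \<and> \<alpha> = exq P (pr1 C A B) \<beta>"
  using goedel unfolding goedel_doctrine_def skolem_doctrine_def enough_existential_free_def by blast

lemma pr1_left_adjoint: "A \<in> ob C \<Longrightarrow> B \<in> ob C \<Longrightarrow> has_left_adjoint P (pr1 C A B)"
  by (rule Ex_adjoint) simp

lemma exq_pr1:
  assumes "A \<in> ob C" "B \<in> ob C" "\<phi> \<in> preds P (prd C A B)"
  shows exq_pr1_preds: "exq P (pr1 C A B) \<phi> \<in> preds P A"
    and exq_pr1_le_iff: "\<psi> \<in> preds P A \<Longrightarrow>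
      exq P (pr1 C A B) \<phi> \<le>[A] \<psi> \<longleftrightarrow> \<phi> \<le>[prd C A B] rei P (pr1 C A B) \<psi>"
  using exq[OF B.pr1_Hom[OF assms(1,2)] pr1_left_adjoint[OF assms(1,2)] assms(3)] by auto

lemma exq_pr1_unit:
  assumes "A \<in> ob C" "B \<in> ob C" "\<phi> \<in> preds P (prd C A B)"
  shows "\<phi> \<le>[prd C A B] rei P (pr1 C A B) (exq P (pr1 C A B) \<phi>)"
  using assms exq_pr1_le_iff[of A B \<phi> "exq P (pr1 C A B) \<phi>"] exq_pr1_preds le_refl by blast

lemma lattice_fib: "A \<in> ob C \<Longrightarrow> bounded_lattice (fib P A)"
  using fib_heyting heyting_algebra.axioms(1) by blast

lemma meet_preds:
  assumes "A \<in> ob C" "\<phi> \<in> preds P A" "\<psi> \<in> preds P A"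
  shows "\<phi> \<sqinter>\<^bsub>fib P A\<^esub> \<psi> \<in> preds P A"
proof -
  interpret bounded_lattice "fib P A" by (rule lattice_fib[OF assms(1)])
  show ?thesis using assms by simp
qed

lemma le_meet_iff:
  assumes "A \<in> ob C" "\<phi> \<in> preds P A" "\<psi> \<in> preds P A" "\<chi> \<in> preds P A"
  shows "\<chi> \<le>[A] \<phi> \<sqinter>\<^bsub>fib P A\<^esub> \<psi> \<longleftrightarrow> \<chi> \<le>[A] \<phi> \<and> \<chi> \<le>[A] \<psi>"
proof -
  interpret bounded_lattice "fib P A" by (rule lattice_fib[OF assms(1)])
  show ?thesis
    using assms meet_left meet_right meet_le le_trans by (meson meet_closed)
qed

lemma top_preds: "A \<in> ob C \<Longrightarrow> \<top>\<^bsub>fib P A\<^esub> \<in> preds P A"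
  and le_top: "A \<in> ob C \<Longrightarrow> \<phi> \<in> preds P A \<Longrightarrow> \<phi> \<le>[A] \<top>\<^bsub>fib P A\<^esub>"
proof -
  assume A: "A \<in> ob C"
  interpret bounded_lattice "fib P A" by (rule lattice_fib[OF A])
  show "\<top>\<^bsub>fib P A\<^esub> \<in> preds P A" by simp
  show "\<phi> \<in> preds P A \<Longrightarrow> \<phi> \<le>[A] \<top>\<^bsub>fib P A\<^esub>" by (rule top_higher)
qed

lemma rei_meet: "f \<in> Hom C A B \<Longrightarrow> \<phi> \<in> preds P B \<Longrightarrow> \<psi> \<in> preds P B \<Longrightarrow>
    rei P f (\<phi> \<sqinter>\<^bsub>fib P B\<^esub> \<psi>) = rei P f \<phi> \<sqinter>\<^bsub>fib P A\<^esub> rei P f \<psi>"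
  and rei_implication: "f \<in> Hom C A B \<Longrightarrow> \<phi> \<in> preds P B \<Longrightarrow> \<psi> \<in> preds P B \<Longrightarrow>
    rei P f (implication (fib P B) \<phi> \<psi>) = implication (fib P A) (rei P f \<phi>) (rei P f \<psi>)"
  and rei_top: "f \<in> Hom C A B \<Longrightarrow> rei P f \<top>\<^bsub>fib P B\<^esub> = \<top>\<^bsub>fib P A\<^esub>"
  using rei_heyting unfolding heyting_hom_def by blast+

lemma implication:
  assumes A: "A \<in> ob C" and "\<phi> \<in> preds P A" "\<psi> \<in> preds P A"
  shows implication_preds: "implication (fib P A) \<phi> \<psi> \<in> preds P A"
    and le_implication_iff: "\<chi> \<in> preds P A \<Longrightarrow>
      \<chi> \<le>[A] implication (fib P A) \<phi> \<psi> \<longleftrightarrow> \<chi> \<sqinter>\<^bsub>fib P A\<^esub> \<phi> \<le>[A] \<psi>"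
proof -
  obtain z where z: "is_implication (fib P A) \<phi> \<psi> z"
    using heyting_algebra.implication_exists[OF fib_heyting[OF A] assms(2,3)] by blast
  have "is_implication (fib P A) \<phi> \<psi> (implication (fib P A) \<phi> \<psi>)"
    unfolding implication_def
  proof (rule theI[where a = z])
    show "is_implication (fib P A) \<phi> \<psi> z" by (rule z)
    show "z' = z" if "is_implication (fib P A) \<phi> \<psi> z'" for z'
      using that z le_refl[OF A] le_antisym[OF A] unfolding is_implication_def by meson
  qed
  then show "implication (fib P A) \<phi> \<psi> \<in> preds P A" "\<chi> \<in> preds P A \<Longrightarrow>
      \<chi> \<le>[A] implication (fib P A) \<phi> \<psi> \<longleftrightarrow> \<chi> \<sqinter>\<^bsub>fib P A\<^esub> \<phi> \<le>[A] \<psi>"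
    unfolding is_implication_def by blast+
qed

lemma Tr_meet:
  assumes "stage s" "a \<in> el s A" "\<phi> \<in> preds P A" "\<psi> \<in> preds P A"
  shows "Tr s (\<phi> \<sqinter>\<^bsub>fib P A\<^esub> \<psi>) a \<longleftrightarrow> Tr s \<phi> a \<and> Tr s \<psi> a"
  using assms rei_meet[of a "fst s" A \<phi> \<psi>] le_meet_iff[of "fst s" "rei P a \<phi>" "rei P a \<psi>" "snd s"]
    rei_preds[of a "fst s" A] stageD[of s]
  unfolding Tr_def el_def by simp

lemma Tr_top: "stage s \<Longrightarrow> a \<in> el s A \<Longrightarrow> Tr s \<top>\<^bsub>fib P A\<^esub> a"
  unfolding Tr_def el_def using rei_top le_top stageD by simp

text \<open>By Beck-Chevalley along \<open>a\<close>, truth of the existential at \<open>a\<close>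
  means that \<open>snd s\<close> entails an existential over its own object, and splitting turns
  this into an arrow \<open>b\<close>. The converse is the unit of the adjunction.\<close>

lemma Tr_exq:
  assumes s: "stage s" and a: "a \<in> el s A" and B: "B \<in> ob C" and \<phi>: "\<phi> \<in> preds P (prd C A B)"
  shows "Tr s (exq P (pr1 C A B) \<phi>) a \<longleftrightarrow> (\<exists>b\<in>el s B. Tr s \<phi> (pair C a b))"
proof
  let ?Z = "fst s"
  let ?f = "pair C (a \<cdot> pr1 C ?Z B) (pr2 C ?Z B)"
  have a': "a \<in> Hom C ?Z A" and A: "A \<in> ob C" and Z: "?Z \<in> ob C" and \<zeta>: "snd s \<in> preds P ?Z"
    using a s el_simps stageD unfolding el_def by auto
  have f: "?f \<in> Hom C (prd C ?Z B) (prd C A B)"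
    using a' Z B A by (simp add: Hom_def)
  assume "Tr s (exq P (pr1 C A B) \<phi>) a"
  moreover have "exq P (pr1 C ?Z B) (rei P ?f \<phi>) = rei P a (exq P (pr1 C A B) \<phi>)"
    using Ex_beck_chevalley[OF B.pullback_pr1[OF a' B]] \<phi> A B by simp
  ultimately have "snd s \<le>[?Z] exq P (pr1 C ?Z B) (rei P ?f \<phi>)"
    by (simp add: Tr_def)
  \<comment> \<open>Since \<open>a\<close> has been absorbed by Beck-Chevalley, the instance of
    existential-freeness along the identity is the one required.\<close>
  moreover have "existential_splitting P ?Z (rei P (ide C ?Z) (snd s))"
    using s Z B.ide_Hom unfolding stage_def existential_free_def by blast
  then have "existential_splitting P ?Z (snd s)"
    using rei_ide[OF Z \<zeta>] by simp
  ultimately obtain b where b: "b \<in> Hom C ?Z B"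
    "snd s \<le>[?Z] rei P (pair C (ide C ?Z) b) (rei P ?f \<phi>)"
    unfolding existential_splitting_def using rei_preds[OF f \<phi>] B by blast
  have p: "pair C (ide C ?Z) b \<in> Hom C ?Z (prd C ?Z B)"
    using b(1) Z by (simp add: Hom_def)
  have "?f \<cdot> pair C (ide C ?Z) b = pair C a b"
    using a' b(1) Z A B by (simp add: B.pair_cmp B.assocr Hom_def)
  then have "snd s \<le>[?Z] rei P (pair C a b) \<phi>"
    using b(2) rei_cmp[OF p f \<phi>] by simp
  then show "\<exists>b\<in>el s B. Tr s \<phi> (pair C a b)"
    using b(1) unfolding Tr_def el_def by blast
next
  assume "\<exists>b\<in>el s B. Tr s \<phi> (pair C a b)"
  then obtain b where b: "b \<in> el s B" "Tr s \<phi> (pair C a b)" by blast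
  have A: "A \<in> ob C" using a el_simps by blast
  have "Tr s (rei P (pr1 C A B) (exq P (pr1 C A B) \<phi>)) (pair C a b)"
    using Tr_le[OF s el_pair[OF a b(1)] \<phi> rei_preds[OF B.pr1_Hom[OF A B] exq_pr1_preds[OF A B \<phi>]]
      exq_pr1_unit[OF A B \<phi>] b(2)] .
  then show "Tr s (exq P (pr1 C A B) \<phi>) a"
    using Tr_rei[OF el_pair[OF a b(1)] B.pr1_Hom[OF A B] exq_pr1_preds[OF A B \<phi>]] a b(1) by simp
qed

text \<open>One test decides the entailment. Write \<phi> as the existential of an existential-free
  \<beta> over \<open>A x B\<close>. At the stage \<open>(A x B, \<beta>)\<close> the element
  \<open>pr1\<close> satisfies \<phi>, and truth of \<psi> there is the entailment by
  adjunction.\<close>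

lemma le_iff_Tr:
  assumes A: "A \<in> ob C" and \<phi>: "\<phi> \<in> preds P A" and \<psi>: "\<psi> \<in> preds P A"
  shows "\<phi> \<le>[A] \<psi> \<longleftrightarrow> (\<forall>s a. stage s \<longrightarrow> a \<in> el s A \<longrightarrow> Tr s \<phi> a \<longrightarrow> Tr s \<psi> a)"
proof
  assume "\<phi> \<le>[A] \<psi>"
  then show "\<forall>s a. stage s \<longrightarrow> a \<in> el s A \<longrightarrow> Tr s \<phi> a \<longrightarrow> Tr s \<psi> a"
    using Tr_le[OF _ _ \<phi> \<psi>] by blast
next
  assume *: "\<forall>s a. stage s \<longrightarrow> a \<in> el s A \<longrightarrow> Tr s \<phi> a \<longrightarrow> Tr s \<psi> a"
  obtain B \<beta> where B: "B \<in> ob C" and \<beta>: "existential_free P (prd C A B) \<beta>"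
    and eq: "\<phi> = exq P (pr1 C A B) \<beta>"
    using enough[OF A \<phi>] by blast
  let ?s = "(prd C A B, \<beta>)"
  have s: "stage ?s"
    unfolding stage_def using \<beta> A B B.prd_ob by simp
  have \<beta>': "\<beta> \<in> preds P (prd C A B)"
    using stageD(2)[OF s] by simp
  have p: "pr1 C A B \<in> el ?s A"
    unfolding el_def using B.pr1_Hom[OF A B] by simp
  have "Tr ?s \<phi> (pr1 C A B)"
    unfolding Tr_def eq using exq_pr1_unit[OF A B \<beta>'] by simp
  then have "Tr ?s \<psi> (pr1 C A B)"
    using * s p by blast
  then show "\<phi> \<le>[A] \<psi>"
    unfolding eq using exq_pr1_le_iff[OF A B \<beta>' \<psi>] by (simp add: Tr_def)
qed

section \<open>Contexts with several variables, read at stages\<close>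

lemma var_Hom:
  assumes "A \<in> ob C" "B \<in> ob C" "D \<in> ob C"
  shows "var1 C A B D \<in> Hom C (prd C (prd C A B) D) A" "var2 C A B D \<in> Hom C (prd C (prd C A B) D) B"
    "var3 C A B D \<in> Hom C (prd C (prd C A B) D) D"
  unfolding var1_def var2_def var3_def
  using assms B.prd_ob by (simp_all add: Hom_def)

lemma var_pair:
  assumes "a \<in> el s A" "b \<in> el s B" "d \<in> el s D"
  shows "var1 C A B D \<cdot> pair C (pair C a b) d = a" "var2 C A B D \<cdot> pair C (pair C a b) d = b"
    "var3 C A B D \<cdot> pair C (pair C a b) d = d"
proof -
  have ob: "A \<in> ob C" "B \<in> ob C" "D \<in> ob C" "prd C A B \<in> ob C"
    using assms el_simps B.prd_ob by auto
  note w = el_pair[OF el_pair[OF assms(1,2)] assms(3)]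
  show "var1 C A B D \<cdot> pair C (pair C a b) d = a" "var2 C A B D \<cdot> pair C (pair C a b) d = b"
    "var3 C A B D \<cdot> pair C (pair C a b) d = d"
    unfolding var1_def var2_def var3_def
    using cmp_assoc_el[OF w B.pr1_Hom[OF ob(4,3)] B.pr1_Hom[OF ob(1,2)]]
      cmp_assoc_el[OF w B.pr1_Hom[OF ob(4,3)] B.pr2_Hom[OF ob(1,2)]]
      pr_pair_el[OF assms(1,2)] pr_pair_el[OF el_pair[OF assms(1,2)] assms(3)] by simp_all
qed

lemma le_iff_Tr2:
  assumes "A \<in> ob C" "B \<in> ob C" "\<phi> \<in> preds P (prd C A B)" "\<psi> \<in> preds P (prd C A B)"
  shows "\<phi> \<le>[prd C A B] \<psi> \<longleftrightarrow> (\<forall>s a b. stage s \<longrightarrow> a \<in> el s A \<longrightarrow> b \<in> el s B \<longrightarrow>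
    Tr s \<phi> (pair C a b) \<longrightarrow> Tr s \<psi> (pair C a b))"
proof -
  have "(\<forall>w\<in>el s (prd C A B). Tr s \<phi> w \<longrightarrow> Tr s \<psi> w) \<longleftrightarrow>
      (\<forall>a\<in>el s A. \<forall>b\<in>el s B. Tr s \<phi> (pair C a b) \<longrightarrow> Tr s \<psi> (pair C a b))" for s
    by (rule all_el_prd[OF assms(1,2)])
  then show ?thesis
    unfolding le_iff_Tr[OF B.prd_ob[OF assms(1,2)] assms(3,4)] by blast
qed

lemma le_iff_Tr3:
  assumes "A \<in> ob C" "B \<in> ob C" "D \<in> ob C"
    and "\<phi> \<in> preds P (prd C (prd C A B) D)" "\<psi> \<in> preds P (prd C (prd C A B) D)"
  shows "\<phi> \<le>[prd C (prd C A B) D] \<psi> \<longleftrightarrow> (\<forall>s a b d. stage s \<longrightarrow> a \<in> el s A \<longrightarrow> b \<in> el s B \<longrightarrow>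
    d \<in> el s D \<longrightarrow> Tr s \<phi> (pair C (pair C a b) d) \<longrightarrow> Tr s \<psi> (pair C (pair C a b) d))"
proof -
  have "(\<forall>w\<in>el s (prd C A B). \<forall>d\<in>el s D. Tr s \<phi> (pair C w d) \<longrightarrow> Tr s \<psi> (pair C w d)) \<longleftrightarrow>
      (\<forall>a\<in>el s A. \<forall>b\<in>el s B. \<forall>d\<in>el s D.
        Tr s \<phi> (pair C (pair C a b) d) \<longrightarrow> Tr s \<psi> (pair C (pair C a b) d))" for s
    by (rule all_el_prd[OF assms(1,2)])
  then show ?thesis
    unfolding le_iff_Tr2[OF B.prd_ob[OF assms(1,2)] assms(3-5)] by blast
qed

lemma pred_eqI2:
  assumes "A \<in> ob C" "B \<in> ob C" "\<phi> \<in> preds P (prd C A B)" "\<psi> \<in> preds P (prd C A B)"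
    and "\<And>s a b. stage s \<Longrightarrow> a \<in> el s A \<Longrightarrow> b \<in> el s B \<Longrightarrow> Tr s \<phi> (pair C a b) \<longleftrightarrow> Tr s \<psi> (pair C a b)"
  shows "\<phi> = \<psi>"
  using assms B.prd_ob by (intro le_antisym[of "prd C A B"]) (auto simp: le_iff_Tr2)

lemma partial_equivalence_iff:
  assumes A: "A \<in> ob C"
  shows "partial_equivalence P A \<rho> \<longleftrightarrow> \<rho> \<in> preds P (prd C A A) \<and>
    (\<forall>s a b. stage s \<longrightarrow> a \<in> el s A \<longrightarrow> b \<in> el s A \<longrightarrow> Tr s \<rho> (pair C a b) \<longrightarrow> Tr s \<rho> (pair C b a)) \<and>
    (\<forall>s a b c. stage s \<longrightarrow> a \<in> el s A \<longrightarrow> b \<in> el s A \<longrightarrow> c \<in> el s A \<longrightarrow>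
      Tr s \<rho> (pair C a b) \<longrightarrow> Tr s \<rho> (pair C b c) \<longrightarrow> Tr s \<rho> (pair C a c))"
proof (cases "\<rho> \<in> preds P (prd C A A)")
  case True
  note p = B.pr1_Hom[OF A A] B.pr2_Hom[OF A A] and v = var_Hom[OF A A A]
  note AA = B.prd_ob[OF A A]
  note AAA = B.prd_ob[OF AA A]
  have "\<rho> \<le>[prd C A A] sub2 P \<rho> (pr2 C A A) (pr1 C A A) \<longleftrightarrow>
    (\<forall>s a b. stage s \<longrightarrow> a \<in> el s A \<longrightarrow> b \<in> el s A \<longrightarrow> Tr s \<rho> (pair C a b) \<longrightarrow> Tr s \<rho> (pair C b a))"
    unfolding le_iff_Tr2[OF A A True sub2_preds[OF p(2,1) True]]
    by (simp add: imp_conjL Tr_sub2[OF _ p(2,1) True])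
  moreover have "sub2 P \<rho> (var1 C A A A) (var2 C A A A) \<sqinter>\<^bsub>fib P (prd C (prd C A A) A)\<^esub>
        sub2 P \<rho> (var2 C A A A) (var3 C A A A) \<le>[prd C (prd C A A) A] sub2 P \<rho> (var1 C A A A) (var3 C A A A)
    \<longleftrightarrow> (\<forall>s a b c. stage s \<longrightarrow> a \<in> el s A \<longrightarrow> b \<in> el s A \<longrightarrow> c \<in> el s A \<longrightarrow>
      Tr s \<rho> (pair C a b) \<longrightarrow> Tr s \<rho> (pair C b c) \<longrightarrow> Tr s \<rho> (pair C a c))"
    unfolding le_iff_Tr3[OF A A A meet_preds[OF AAA sub2_preds[OF v(1,2) True] sub2_preds[OF v(2,3) True]]
        sub2_preds[OF v(1,3) True]]
    by (simp add: imp_conjL Tr_meet[OF _ _ sub2_preds[OF v(1,2) True] sub2_preds[OF v(2,3) True]]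
        Tr_sub2[OF _ v(1,2) True] Tr_sub2[OF _ v(2,3) True] Tr_sub2[OF _ v(1,3) True] var_pair)
  ultimately show ?thesis
    using True unfolding partial_equivalence_def Let_def by blast
qed (auto simp: partial_equivalence_def)

text \<open>Totality is translated by \<open>Tr_exq\<close>: a functional relation has an actual
  value \<open>b\<close> at the same stage for every element of its domain.\<close>

lemma functional_relation_iff:
  assumes A: "A \<in> ob C" and B: "B \<in> ob C" and \<rho>: "\<rho> \<in> preds P (prd C A A)" and \<sigma>: "\<sigma> \<in> preds P (prd C B B)"
  shows "functional_relation P (A, \<rho>) (B, \<sigma>) \<phi> \<longleftrightarrow> \<phi> \<in> preds P (prd C A B) \<and>
    (\<forall>s a b. stage s \<longrightarrow> a \<in> el s A \<longrightarrow> b \<in> el s B \<longrightarrow>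
      Tr s \<phi> (pair C a b) \<longrightarrow> Tr s \<rho> (pair C a a) \<and> Tr s \<sigma> (pair C b b)) \<and>
    (\<forall>s a a' b. stage s \<longrightarrow> a \<in> el s A \<longrightarrow> a' \<in> el s A \<longrightarrow> b \<in> el s B \<longrightarrow>
      Tr s \<rho> (pair C a a') \<longrightarrow> Tr s \<phi> (pair C a b) \<longrightarrow> Tr s \<phi> (pair C a' b)) \<and>
    (\<forall>s a b b'. stage s \<longrightarrow> a \<in> el s A \<longrightarrow> b \<in> el s B \<longrightarrow> b' \<in> el s B \<longrightarrow>
      Tr s \<sigma> (pair C b b') \<longrightarrow> Tr s \<phi> (pair C a b) \<longrightarrow> Tr s \<phi> (pair C a b')) \<and>
    (\<forall>s a b b'. stage s \<longrightarrow> a \<in> el s A \<longrightarrow> b \<in> el s B \<longrightarrow> b' \<in> el s B \<longrightarrow>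
      Tr s \<phi> (pair C a b) \<longrightarrow> Tr s \<phi> (pair C a b') \<longrightarrow> Tr s \<sigma> (pair C b b')) \<and>
    (\<forall>s a. stage s \<longrightarrow> a \<in> el s A \<longrightarrow> Tr s \<rho> (pair C a a) \<longrightarrow> (\<exists>b\<in>el s B. Tr s \<phi> (pair C a b)))"
proof (cases "\<phi> \<in> preds P (prd C A B)")
  case True
  note p = B.pr1_Hom[OF A B] B.pr2_Hom[OF A B] and v = var_Hom[OF A A B] and w = var_Hom[OF A B B]
  note AB = B.prd_ob[OF A B]
  note AAB = B.prd_ob[OF B.prd_ob[OF A A] B] and ABB = B.prd_ob[OF AB B]
  note s1 = sub2_preds[OF p(1,1) \<rho>] sub2_preds[OF p(2,2) \<sigma>]
  note s2 = sub2_preds[OF v(1,2) \<rho>] sub2_preds[OF v(1,3) True] sub2_preds[OF v(2,3) True]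
  note s3 = sub2_preds[OF w(2,3) \<sigma>] sub2_preds[OF w(1,2) True] sub2_preds[OF w(1,3) True]
  note i = B.ide_Hom[OF A]
  have "\<phi> \<le>[prd C A B] sub2 P \<rho> (pr1 C A B) (pr1 C A B) \<sqinter>\<^bsub>fib P (prd C A B)\<^esub> sub2 P \<sigma> (pr2 C A B) (pr2 C A B)
    \<longleftrightarrow> (\<forall>s a b. stage s \<longrightarrow> a \<in> el s A \<longrightarrow> b \<in> el s B \<longrightarrow>
      Tr s \<phi> (pair C a b) \<longrightarrow> Tr s \<rho> (pair C a a) \<and> Tr s \<sigma> (pair C b b))"
    unfolding le_iff_Tr2[OF A B True meet_preds[OF AB s1]]
    by (simp add: imp_conjL Tr_meet[OF _ _ s1] Tr_sub2[OF _ p(1,1) \<rho>] Tr_sub2[OF _ p(2,2) \<sigma>])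
  moreover have "sub2 P \<rho> (var1 C A A B) (var2 C A A B) \<sqinter>\<^bsub>fib P (prd C (prd C A A) B)\<^esub>
        sub2 P \<phi> (var1 C A A B) (var3 C A A B) \<le>[prd C (prd C A A) B] sub2 P \<phi> (var2 C A A B) (var3 C A A B)
    \<longleftrightarrow> (\<forall>s a a' b. stage s \<longrightarrow> a \<in> el s A \<longrightarrow> a' \<in> el s A \<longrightarrow> b \<in> el s B \<longrightarrow>
      Tr s \<rho> (pair C a a') \<longrightarrow> Tr s \<phi> (pair C a b) \<longrightarrow> Tr s \<phi> (pair C a' b))"
    unfolding le_iff_Tr3[OF A A B meet_preds[OF AAB s2(1,2)] s2(3)]
    by (simp add: imp_conjL Tr_meet[OF _ _ s2(1,2)] Tr_sub2[OF _ v(1,2) \<rho>] Tr_sub2[OF _ v(1,3) True]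
        Tr_sub2[OF _ v(2,3) True] var_pair)
  moreover have "sub2 P \<sigma> (var2 C A B B) (var3 C A B B) \<sqinter>\<^bsub>fib P (prd C (prd C A B) B)\<^esub>
        sub2 P \<phi> (var1 C A B B) (var2 C A B B) \<le>[prd C (prd C A B) B] sub2 P \<phi> (var1 C A B B) (var3 C A B B)
    \<longleftrightarrow> (\<forall>s a b b'. stage s \<longrightarrow> a \<in> el s A \<longrightarrow> b \<in> el s B \<longrightarrow> b' \<in> el s B \<longrightarrow>
      Tr s \<sigma> (pair C b b') \<longrightarrow> Tr s \<phi> (pair C a b) \<longrightarrow> Tr s \<phi> (pair C a b'))"
    unfolding le_iff_Tr3[OF A B B meet_preds[OF ABB s3(1,2)] s3(3)]
    by (simp add: imp_conjL Tr_meet[OF _ _ s3(1,2)] Tr_sub2[OF _ w(2,3) \<sigma>] Tr_sub2[OF _ w(1,2) True]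
        Tr_sub2[OF _ w(1,3) True] var_pair)
  moreover have "sub2 P \<phi> (var1 C A B B) (var2 C A B B) \<sqinter>\<^bsub>fib P (prd C (prd C A B) B)\<^esub>
        sub2 P \<phi> (var1 C A B B) (var3 C A B B) \<le>[prd C (prd C A B) B] sub2 P \<sigma> (var2 C A B B) (var3 C A B B)
    \<longleftrightarrow> (\<forall>s a b b'. stage s \<longrightarrow> a \<in> el s A \<longrightarrow> b \<in> el s B \<longrightarrow> b' \<in> el s B \<longrightarrow>
      Tr s \<phi> (pair C a b) \<longrightarrow> Tr s \<phi> (pair C a b') \<longrightarrow> Tr s \<sigma> (pair C b b'))"
    unfolding le_iff_Tr3[OF A B B meet_preds[OF ABB s3(2,3)] s3(1)]
    by (simp add: imp_conjL Tr_meet[OF _ _ s3(2,3)] Tr_sub2[OF _ w(2,3) \<sigma>] Tr_sub2[OF _ w(1,2) True]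
        Tr_sub2[OF _ w(1,3) True] var_pair)
  moreover have "sub2 P \<rho> (ide C A) (ide C A) \<le>[A] exq P (pr1 C A B) \<phi>
    \<longleftrightarrow> (\<forall>s a. stage s \<longrightarrow> a \<in> el s A \<longrightarrow> Tr s \<rho> (pair C a a) \<longrightarrow> (\<exists>b\<in>el s B. Tr s \<phi> (pair C a b)))"
    unfolding le_iff_Tr[OF A sub2_preds[OF i i \<rho>] exq_pr1_preds[OF A B True]]
    by (simp add: imp_conjL Tr_exq[OF _ _ B True] Tr_sub2[OF _ i i \<rho>] el_simps)
  ultimately show ?thesis
    using True unfolding functional_relation_def Let_def prod.case by blast
qed (auto simp: functional_relation_def)

text \<open>A family of relations, one for each stage, need not come from a predicate. Definability
  is the side condition of the constructions of objects and arrows in the topos.\<close>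

definition definable :: "'o \<Rightarrow> ('o \<times> 'p \<Rightarrow> 'm \<Rightarrow> bool) \<Rightarrow> bool" where
  "definable A S \<longleftrightarrow> (\<exists>\<phi>\<in>preds P A. \<forall>s a. stage s \<longrightarrow> a \<in> el s A \<longrightarrow> (Tr s \<phi> a \<longleftrightarrow> S s a))"

text \<open>A term in context \<open>D\<close> is uniform in stages: one base arrow computes it
  everywhere. Terms are functions of \<open>s\<close> and \<open>x\<close> so that definability
  rules apply to formulas by unification.\<close>

definition trm :: "'o \<Rightarrow> 'o \<Rightarrow> ('o \<times> 'p \<Rightarrow> 'm \<Rightarrow> 'm) \<Rightarrow> bool" where
  "trm D A t \<longleftrightarrow> (\<exists>f\<in>Hom C D A. \<forall>s x. stage s \<longrightarrow> x \<in> el s D \<longrightarrow> t s x = f \<cdot> x)"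

lemma trm_id: "D \<in> ob C \<Longrightarrow> trm D D (\<lambda>s x. x)"
  unfolding trm_def by (rule bexI[of _ "ide C D"]) (auto simp: B.ide_Hom el_simps)

lemma trm_cmp:
  assumes "f \<in> Hom C A B" "trm D A t"
  shows "trm D B (\<lambda>s x. f \<cdot> t s x)"
proof -
  obtain g where g: "g \<in> Hom C D A" "\<And>s x. stage s \<Longrightarrow> x \<in> el s D \<Longrightarrow> t s x = g \<cdot> x"
    using assms(2) unfolding trm_def by blast
  then have "\<forall>s x. stage s \<longrightarrow> x \<in> el s D \<longrightarrow> f \<cdot> t s x = (f \<cdot> g) \<cdot> x"
    using assms(1) cmp_assoc_el by simp
  then show ?thesis
    unfolding trm_def using B.cmp_Hom[OF g(1) assms(1)] by blast
qed

lemma trm_pr1: "A \<in> ob C \<Longrightarrow> B \<in> ob C \<Longrightarrow> trm D (prd C A B) t \<Longrightarrow> trm D A (\<lambda>s x. pr1 C A B \<cdot> t s x)"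
  and trm_pr2: "A \<in> ob C \<Longrightarrow> B \<in> ob C \<Longrightarrow> trm D (prd C A B) t \<Longrightarrow> trm D B (\<lambda>s x. pr2 C A B \<cdot> t s x)"
  by (rule trm_cmp[OF B.pr1_Hom] trm_cmp[OF B.pr2_Hom]; assumption)+

lemma trm_el: "trm D A t \<Longrightarrow> stage s \<Longrightarrow> x \<in> el s D \<Longrightarrow> t s x \<in> el s A"
  unfolding trm_def by (metis el_cmp)

lemma definable_Tr:
  assumes "\<phi> \<in> preds P A" "trm D A t"
  shows "definable D (\<lambda>s x. Tr s \<phi> (t s x))"
proof -
  obtain f where f: "f \<in> Hom C D A" "\<And>s x. stage s \<Longrightarrow> x \<in> el s D \<Longrightarrow> t s x = f \<cdot> x"
    using assms(2) unfolding trm_def by blast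
  show ?thesis
    unfolding definable_def
    by (rule bexI[OF _ rei_preds[OF f(1) assms(1)]]) (simp add: Tr_rei[OF _ f(1) assms(1)] f(2))
qed

lemma definable_Tr2:
  assumes "\<phi> \<in> preds P (prd C A B)" "trm D A t" "trm D B u"
  shows "definable D (\<lambda>s x. Tr s \<phi> (pair C (t s x) (u s x)))"
proof -
  obtain f where f: "f \<in> Hom C D A" "\<And>s x. stage s \<Longrightarrow> x \<in> el s D \<Longrightarrow> t s x = f \<cdot> x"
    using assms(2) unfolding trm_def by blast
  obtain g where g: "g \<in> Hom C D B" "\<And>s x. stage s \<Longrightarrow> x \<in> el s D \<Longrightarrow> u s x = g \<cdot> x"
    using assms(3) unfolding trm_def by blast
  show ?thesis
    unfolding definable_def
    by (rule bexI[OF _ sub2_preds[OF f(1) g(1) assms(1)]])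
      (simp add: Tr_sub2[OF _ f(1) g(1) assms(1)] f(2) g(2))
qed

lemma definable_conj:
  assumes A: "A \<in> ob C" and "definable A S" "definable A S'"
  shows "definable A (\<lambda>s x. S s x \<and> S' s x)"
proof -
  obtain \<phi> \<psi> where *: "\<phi> \<in> preds P A" "\<psi> \<in> preds P A"
    "\<And>s a. stage s \<Longrightarrow> a \<in> el s A \<Longrightarrow> Tr s \<phi> a \<longleftrightarrow> S s a"
    "\<And>s a. stage s \<Longrightarrow> a \<in> el s A \<Longrightarrow> Tr s \<psi> a \<longleftrightarrow> S' s a"
    using assms(2,3) unfolding definable_def by blast
  show ?thesis
    unfolding definable_def
    by (rule bexI[OF _ meet_preds[OF A *(1,2)]]) (simp add: Tr_meet[OF _ _ *(1,2)] *(3,4))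
qed

text \<open>The bound variable is the second projection from \<open>D x B\<close>. It ranges over
  elements at the same stage, which is what \<open>Tr_exq\<close> provides.\<close>

lemma definable_ex:
  assumes D: "D \<in> ob C" and B: "B \<in> ob C"
    and "definable (prd C D B) (\<lambda>s w. S s (pr1 C D B \<cdot> w) (pr2 C D B \<cdot> w))"
  shows "definable D (\<lambda>s x. \<exists>b\<in>el s B. S s x b)"
proof -
  obtain \<phi> where \<phi>: "\<phi> \<in> preds P (prd C D B)" "\<And>s w. stage s \<Longrightarrow> w \<in> el s (prd C D B) \<Longrightarrow>
      Tr s \<phi> w \<longleftrightarrow> S s (pr1 C D B \<cdot> w) (pr2 C D B \<cdot> w)"
    using assms(3) unfolding definable_def by blast
  show ?thesis
    unfolding definable_def
    by (rule bexI[OF _ exq_pr1_preds[OF D B \<phi>(1)]]) (auto simp: Tr_exq[OF _ _ B \<phi>(1)] \<phi>(2))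
qed

lemmas definable_intros = definable_conj definable_ex trm_pr1 trm_pr2 trm_id B.prd_ob

lemma definable_cong:
  assumes "definable A S" "\<And>s a. stage s \<Longrightarrow> a \<in> el s A \<Longrightarrow> S s a \<longleftrightarrow> S' s a"
  shows "definable A S'"
  using assms unfolding definable_def by blast

end


section \<open>Exactness of the tripos-to-topos construction\<close>

context goedel_hyperdoctrine
begin

abbreviation "\<T> \<equiv> tripos_to_topos P"
abbreviation topos_cmp (infixl "\<star>" 70) where "g \<star> f \<equiv> g \<odot>\<^bsub>\<T>\<^esub> f"

text \<open>Membership in the sets of elements is part of \<open>E\<close> and of \<open>R\<close>,
  so arguments with them carry few side conditions on sorts. \<open>E s X a a\<close> expresses that
  \<open>a\<close> lies in the extent of \<open>X\<close>.\<close>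

definition E :: "'o \<times> 'p \<Rightarrow> 'o \<times> 'p \<Rightarrow> 'm \<Rightarrow> 'm \<Rightarrow> bool" where
  "E s X a a' \<longleftrightarrow> a \<in> el s (fst X) \<and> a' \<in> el s (fst X) \<and> Tr s (snd X) (pair C a a')"

definition R :: "'o \<times> 'p \<Rightarrow> ('o, 'p) per_ar \<Rightarrow> 'm \<Rightarrow> 'm \<Rightarrow> bool" where
  "R s f a b \<longleftrightarrow> a \<in> el s (fst (src \<T> f)) \<and> b \<in> el s (fst (tgt \<T> f)) \<and> Tr s (fst (snd f)) (pair C a b)"

lemma T_ob_iff: "X \<in> ob \<T> \<longleftrightarrow> fst X \<in> ob C \<and> partial_equivalence P (fst X) (snd X)"
  by (cases X) (simp add: tripos_to_topos_def)

lemma T_obD: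
  assumes "X \<in> ob \<T>"
  shows "fst X \<in> ob C" "snd X \<in> preds P (prd C (fst X) (fst X))"
  using assms by (auto simp: T_ob_iff partial_equivalence_def Let_def)

lemma T_Hom_iff: "f \<in> Hom \<T> X Y \<longleftrightarrow> X \<in> ob \<T> \<and> Y \<in> ob \<T> \<and> (\<exists>\<phi>. f = (X, \<phi>, Y) \<and> functional_relation P X Y \<phi>)"
  by (auto simp: Hom_def tripos_to_topos_def)

lemma E_sym: "X \<in> ob \<T> \<Longrightarrow> stage s \<Longrightarrow> E s X a b \<Longrightarrow> E s X b a"
  and E_trans: "X \<in> ob \<T> \<Longrightarrow> stage s \<Longrightarrow> E s X a b \<Longrightarrow> E s X b c \<Longrightarrow> E s X a c"
  using partial_equivalence_iff[of "fst X" "snd X"] unfolding T_ob_iff E_def by blast+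

lemma E_refl: "X \<in> ob \<T> \<Longrightarrow> stage s \<Longrightarrow> E s X a b \<Longrightarrow> E s X a a"
  and E_refl2: "X \<in> ob \<T> \<Longrightarrow> stage s \<Longrightarrow> E s X a b \<Longrightarrow> E s X b b"
  using E_sym E_trans by blast+

lemma E_el: "E s X a b \<Longrightarrow> a \<in> el s (fst X)" "E s X a b \<Longrightarrow> b \<in> el s (fst X)"
  unfolding E_def by auto

lemma R_el: "f \<in> Hom \<T> X Y \<Longrightarrow> R s f a b \<Longrightarrow> a \<in> el s (fst X)"
  "f \<in> Hom \<T> X Y \<Longrightarrow> R s f a b \<Longrightarrow> b \<in> el s (fst Y)"
  unfolding R_def Hom_def by auto

lemma R_iff_Tr:
  "f \<in> Hom \<T> X Y \<Longrightarrow> a \<in> el s (fst X) \<Longrightarrow> b \<in> el s (fst Y)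
    \<Longrightarrow> R s f a b \<longleftrightarrow> Tr s (fst (snd f)) (pair C a b)"
  unfolding R_def Hom_def by auto

lemma
  assumes f: "f \<in> Hom \<T> X Y" and s: "stage s"
  shows R_dom: "R s f a b \<Longrightarrow> E s X a a"
    and R_cod: "R s f a b \<Longrightarrow> E s Y b b"
    and R_cong1: "E s X a a' \<Longrightarrow> R s f a b \<Longrightarrow> R s f a' b"
    and R_cong2: "E s Y b b' \<Longrightarrow> R s f a b \<Longrightarrow> R s f a b'"
    and R_single: "R s f a b \<Longrightarrow> R s f a b' \<Longrightarrow> E s Y b b'"
    and R_total: "E s X a a \<Longrightarrow> \<exists>b. R s f a b"
proof -
  obtain \<phi> where X: "X \<in> ob \<T>" and Y: "Y \<in> ob \<T>" and \<phi>: "f = (X, \<phi>, Y)" "functional_relation P X Y \<phi>"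
    using f unfolding T_Hom_iff by blast
  have R: "R s f a b \<longleftrightarrow> a \<in> el s (fst X) \<and> b \<in> el s (fst Y) \<and> Tr s \<phi> (pair C a b)" for a b
    unfolding R_def \<phi>(1) tripos_to_topos_def by simp
  note fr = functional_relation_iff[OF T_obD(1)[OF X] T_obD(1)[OF Y] T_obD(2)[OF X] T_obD(2)[OF Y],
      unfolded prod.collapse, THEN iffD1, OF \<phi>(2)]
  show "R s f a b \<Longrightarrow> E s X a a" "R s f a b \<Longrightarrow> E s Y b b" "E s X a a' \<Longrightarrow> R s f a b \<Longrightarrow> R s f a' b"
    "E s Y b b' \<Longrightarrow> R s f a b \<Longrightarrow> R s f a b'" "R s f a b \<Longrightarrow> R s f a b' \<Longrightarrow> E s Y b b'"
    "E s X a a \<Longrightarrow> \<exists>b. R s f a b"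
    using fr s unfolding R E_def by blast+
qed

lemma definable_E:
  assumes "X \<in> ob \<T>" "trm D (fst X) t" "trm D (fst X) u"
  shows "definable D (\<lambda>s x. E s X (t s x) (u s x))"
  by (rule definable_cong[OF definable_Tr2[OF T_obD(2)[OF assms(1)] assms(2,3)]])
    (simp add: E_def trm_el[OF assms(2)] trm_el[OF assms(3)])

lemma T_Hom_pred: "f \<in> Hom \<T> X Y \<Longrightarrow> fst (snd f) \<in> preds P (prd C (fst X) (fst Y))"
  unfolding T_Hom_iff by (cases X, cases Y) (auto simp: functional_relation_def Let_def simp del: split_paired_Ex)

lemma definable_R:
  assumes "f \<in> Hom \<T> X Y" "trm D (fst X) t" "trm D (fst Y) u"
  shows "definable D (\<lambda>s x. R s f (t s x) (u s x))"
proof (rule definable_cong[OF definable_Tr2[OF T_Hom_pred[OF assms(1)] assms(2,3)]])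
  show "Tr s (fst (snd f)) (pair C (t s x) (u s x)) \<longleftrightarrow> R s f (t s x) (u s x)"
    if "stage s" "x \<in> el s D" for s x
    using assms(1) trm_el[OF assms(2) that] trm_el[OF assms(3) that] by (auto simp: R_def Hom_def)
qed

text \<open>Comprehension for objects. The representing predicate is hidden: the objects constructed
  from this lemma are used only through \<open>fst\<close> and \<open>E\<close>.\<close>

lemma T_obI:
  assumes A: "A \<in> ob C"
    and S: "definable (prd C A A) (\<lambda>s w. S s (pr1 C A A \<cdot> w) (pr2 C A A \<cdot> w))"
    and sym: "\<And>s a b. stage s \<Longrightarrow> a \<in> el s A \<Longrightarrow> b \<in> el s A \<Longrightarrow> S s a b \<Longrightarrow> S s b a"
    and trans: "\<And>s a b c. stage s \<Longrightarrow> a \<in> el s A \<Longrightarrow> b \<in> el s A \<Longrightarrow> c \<in> el s A \<Longrightarrow>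
      S s a b \<Longrightarrow> S s b c \<Longrightarrow> S s a c"
  shows "\<exists>X\<in>ob \<T>. fst X = A \<and>
    (\<forall>s a b. stage s \<longrightarrow> E s X a b = (a \<in> el s A \<and> b \<in> el s A \<and> S s a b))"
proof -
  obtain \<rho> where \<rho>: "\<rho> \<in> preds P (prd C A A)" "\<And>s w. stage s \<Longrightarrow> w \<in> el s (prd C A A) \<Longrightarrow>
      Tr s \<rho> w \<longleftrightarrow> S s (pr1 C A A \<cdot> w) (pr2 C A A \<cdot> w)"
    using S unfolding definable_def by blast
  have *: "Tr s \<rho> (pair C a b) \<longleftrightarrow> S s a b" if "stage s" "a \<in> el s A" "b \<in> el s A" for s a b
    using that \<rho>(2) by simp
  have "partial_equivalence P A \<rho>"
    unfolding partial_equivalence_iff[OF A] using \<rho>(1) sym trans * by blast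
  then have "(A, \<rho>) \<in> ob \<T>"
    using A by (simp add: T_ob_iff)
  moreover have "E s (A, \<rho>) a b \<longleftrightarrow> a \<in> el s A \<and> b \<in> el s A \<and> S s a b" if "stage s" for s a b
    using *[OF that] unfolding E_def fst_conv snd_conv by blast
  ultimately show ?thesis
    by (metis fst_conv)
qed

text \<open>Comprehension for arrows. Through \<open>dom\<close> and \<open>cod\<close> the relation
  \<open>S\<close> holds only between elements of the right sorts, so no such condition is added to
  the other clauses.\<close>

lemma T_HomI:
  assumes X: "X \<in> ob \<T>" and Y: "Y \<in> ob \<T>"
    and S: "definable (prd C (fst X) (fst Y))
      (\<lambda>s w. S s (pr1 C (fst X) (fst Y) \<cdot> w) (pr2 C (fst X) (fst Y) \<cdot> w))"
    and dom: "\<And>s a b. stage s \<Longrightarrow> S s a b \<Longrightarrow> E s X a a"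
    and cod: "\<And>s a b. stage s \<Longrightarrow> S s a b \<Longrightarrow> E s Y b b"
    and c1: "\<And>s a a' b. stage s \<Longrightarrow> E s X a a' \<Longrightarrow> S s a b \<Longrightarrow> S s a' b"
    and c2: "\<And>s a b b'. stage s \<Longrightarrow> E s Y b b' \<Longrightarrow> S s a b \<Longrightarrow> S s a b'"
    and single: "\<And>s a b b'. stage s \<Longrightarrow> S s a b \<Longrightarrow> S s a b' \<Longrightarrow> E s Y b b'"
    and total: "\<And>s a. stage s \<Longrightarrow> E s X a a \<Longrightarrow> \<exists>b. S s a b"
  shows "\<exists>f\<in>Hom \<T> X Y. \<forall>s a b. stage s \<longrightarrow> R s f a b = S s a b"
proof -
  let ?A = "fst X" and ?B = "fst Y"
  obtain \<phi> where \<phi>: "\<phi> \<in> preds P (prd C ?A ?B)" "\<And>s w. stage s \<Longrightarrow> w \<in> el s (prd C ?A ?B) \<Longrightarrow>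
      Tr s \<phi> w \<longleftrightarrow> S s (pr1 C ?A ?B \<cdot> w) (pr2 C ?A ?B \<cdot> w)"
    using S unfolding definable_def by blast
  have *: "Tr s \<phi> (pair C a b) \<longleftrightarrow> S s a b" if "stage s" "a \<in> el s ?A" "b \<in> el s ?B" for s a b
    using that \<phi>(2) by simp
  have el: "a \<in> el s ?A" "b \<in> el s ?B" if "stage s" "S s a b" for s a b
    using dom[OF that] cod[OF that] by (auto simp: E_def)
  have "functional_relation P (?A, snd X) (?B, snd Y) \<phi>"
    unfolding functional_relation_iff[OF T_obD(1)[OF X] T_obD(1)[OF Y] T_obD(2)[OF X] T_obD(2)[OF Y]]
  proof (intro conjI allI impI)
    show "\<phi> \<in> preds P (prd C ?A ?B)" by (rule \<phi>(1))
    fix s a assume s: "stage s" and a: "a \<in> el s ?A"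
    show "Tr s (snd X) (pair C a a)" if "b \<in> el s ?B" "Tr s \<phi> (pair C a b)" for b
      using dom[OF s] *[OF s a] that by (auto simp: E_def)
    show "Tr s (snd Y) (pair C b b)" if "b \<in> el s ?B" "Tr s \<phi> (pair C a b)" for b
      using cod[OF s] *[OF s a] that by (auto simp: E_def)
    show "Tr s \<phi> (pair C a' b)"
      if "a' \<in> el s ?A" "b \<in> el s ?B" "Tr s (snd X) (pair C a a')" "Tr s \<phi> (pair C a b)" for a' b
      using c1[OF s, of a a' b] *[OF s] a that by (auto simp: E_def)
    show "Tr s \<phi> (pair C a b')"
      if "b \<in> el s ?B" "b' \<in> el s ?B" "Tr s (snd Y) (pair C b b')" "Tr s \<phi> (pair C a b)" for b b'
      using c2[OF s, of b b' a] *[OF s] a that by (auto simp: E_def)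
    show "Tr s (snd Y) (pair C b b')"
      if "b \<in> el s ?B" "b' \<in> el s ?B" "Tr s \<phi> (pair C a b)" "Tr s \<phi> (pair C a b')" for b b'
      using single[OF s, of a b b'] *[OF s] a that by (auto simp: E_def)
    show "\<exists>b\<in>el s ?B. Tr s \<phi> (pair C a b)" if "Tr s (snd X) (pair C a a)"
      using total[OF s, of a] *[OF s a] a that el[OF s] by (auto simp: E_def)
  qed
  then have f: "(X, \<phi>, Y) \<in> Hom \<T> X Y"
    unfolding T_Hom_iff using X Y by simp
  have "R s (X, \<phi>, Y) a b \<longleftrightarrow> S s a b" if "stage s" for s a b
    using *[OF that] el[OF that] by (auto simp: R_def tripos_to_topos_def)
  then show ?thesis
    using f by blast
qed

text \<open>One inclusion is enough. If \<open>g\<close> relates \<open>a\<close> to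
  \<open>b\<close>, then \<open>f\<close> relates \<open>a\<close> to some \<open>b'\<close>, so
  does \<open>g\<close>, and single-valuedness of \<open>g\<close> makes \<open>b'\<close> equal to
  \<open>b\<close> in \<open>Y\<close>.\<close>

lemma T_Hom_eqI:
  assumes f: "f \<in> Hom \<T> X Y" and g: "g \<in> Hom \<T> X Y"
    and le: "\<And>s a b. stage s \<Longrightarrow> R s f a b \<Longrightarrow> R s g a b"
  shows "f = g"
proof -
  obtain \<phi> where X: "X \<in> ob \<T>" and Y: "Y \<in> ob \<T>" and \<phi>: "f = (X, \<phi>, Y)"
    using f unfolding T_Hom_iff by blast
  obtain \<psi> where \<psi>: "g = (X, \<psi>, Y)"
    using g unfolding T_Hom_iff by blast
  have RR: "R s f a b \<longleftrightarrow> R s g a b" if "stage s" for s a b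
    using le[OF that] R_single[OF g that] R_total[OF f that] R_dom[OF g that] R_cong2[OF f that] by blast
  have "\<phi> = \<psi>"
  proof (rule pred_eqI2[OF T_obD(1)[OF X] T_obD(1)[OF Y]])
    show "\<phi> \<in> preds P (prd C (fst X) (fst Y))" "\<psi> \<in> preds P (prd C (fst X) (fst Y))"
      using T_Hom_pred[OF f] T_Hom_pred[OF g] \<phi> \<psi> by auto
    show "Tr s \<phi> (pair C a b) \<longleftrightarrow> Tr s \<psi> (pair C a b)"
      if "stage s" "a \<in> el s (fst X)" "b \<in> el s (fst Y)" for s a b
      using RR[OF that(1), of a b] that unfolding R_def \<phi> \<psi> by (simp add: tripos_to_topos_def)
  qed
  then show ?thesis using \<phi> \<psi> by simp
qed

lemma T_ide_Hom: "X \<in> ob \<T> \<Longrightarrow> ide \<T> X \<in> Hom \<T> X X"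
  and R_ide: "X \<in> ob \<T> \<Longrightarrow> R s (ide \<T> X) a b \<longleftrightarrow> E s X a b"
proof -
  assume X: "X \<in> ob \<T>"
  have ide: "ide \<T> X = (X, snd X, X)"
    by (simp add: tripos_to_topos_def)
  show "R s (ide \<T> X) a b \<longleftrightarrow> E s X a b"
    unfolding ide R_def E_def by (simp add: tripos_to_topos_def)
  have ob: "fst X \<in> ob C" using T_obD X by blast
  have "\<exists>f\<in>Hom \<T> X X. \<forall>s a b. stage s \<longrightarrow> R s f a b = E s X a b"
  proof (rule T_HomI[OF X X, of "\<lambda>s. E s X"])
    show "definable (prd C (fst X) (fst X)) (\<lambda>s w. E s X (pr1 C (fst X) (fst X) \<cdot> w) (pr2 C (fst X) (fst X) \<cdot> w))"
      using X ob by (intro definable_intros definable_E)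
    show "\<exists>b. E s X a b" if "E s X a a" for s a
      using that by blast
  qed (use E_sym[OF X] E_trans[OF X] E_refl[OF X] E_refl2[OF X] in blast)+
  then obtain f where f: "f \<in> Hom \<T> X X" "\<And>s a b. stage s \<Longrightarrow> R s f a b \<longleftrightarrow> E s X a b"
    by blast
  have "fst (snd f) = snd X"
  proof (rule pred_eqI2[OF ob ob T_Hom_pred[OF f(1)] T_obD(2)[OF X]])
    show "Tr s (fst (snd f)) (pair C a b) \<longleftrightarrow> Tr s (snd X) (pair C a b)"
      if "stage s" "a \<in> el s (fst X)" "b \<in> el s (fst X)" for s a b
      using f(2)[OF that(1), of a b] that f(1) by (auto simp: R_def E_def Hom_def)
  qed
  then have "f = (X, snd X, X)"
    using f(1) unfolding T_Hom_iff by auto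
  then show "ide \<T> X \<in> Hom \<T> X X"
    using f(1) ide by simp
qed

text \<open>The existential in \<open>relational_composite\<close> has a witness at each stage where
  it holds, so composition in the topos is ordinary composition of relations.\<close>

lemma
  assumes f: "f \<in> Hom \<T> X Y" and g: "g \<in> Hom \<T> Y Z"
  shows T_cmp_Hom: "g \<star> f \<in> Hom \<T> X Z"
    and R_cmp: "stage s \<Longrightarrow> R s (g \<star> f) a c \<longleftrightarrow> (\<exists>b. R s f a b \<and> R s g b c)"
proof -
  obtain \<phi> where X: "X \<in> ob \<T>" and Y: "Y \<in> ob \<T>" and \<phi>: "f = (X, \<phi>, Y)"
    using f unfolding T_Hom_iff by blast
  obtain \<psi> where Z: "Z \<in> ob \<T>" and \<psi>: "g = (Y, \<psi>, Z)"
    using g unfolding T_Hom_iff by blast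
  let ?A = "fst X" and ?B = "fst Y" and ?D = "fst Z"
  note A = T_obD(1)[OF X] and B = T_obD(1)[OF Y] and D = T_obD(1)[OF Z]
  note AD = B.prd_ob[OF A D]
  let ?\<chi> = "relational_composite P ?A ?B ?D \<phi> \<psi>"
  have pr: "\<phi> \<in> preds P (prd C ?A ?B)" "\<psi> \<in> preds P (prd C ?B ?D)"
    using T_Hom_pred[OF f] T_Hom_pred[OF g] \<phi> \<psi> by auto
  note v = var_Hom[OF A D B]
  note sp = sub2_preds[OF v(1,3) pr(1)] sub2_preds[OF v(3,2) pr(2)]
  note mp = meet_preds[OF B.prd_ob[OF AD B] sp]
  have \<chi>: "?\<chi> \<in> preds P (prd C ?A ?D)"
    unfolding relational_composite_def Let_def using exq_pr1_preds[OF AD B mp] .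
  have R\<chi>: "Tr s ?\<chi> (pair C a c) \<longleftrightarrow> (\<exists>b. R s f a b \<and> R s g b c)"
    if "stage s" "a \<in> el s ?A" "c \<in> el s ?D" for s a c
  proof -
    have "Tr s ?\<chi> (pair C a c) \<longleftrightarrow> (\<exists>b\<in>el s ?B. Tr s \<phi> (pair C a b) \<and> Tr s \<psi> (pair C b c))"
      unfolding relational_composite_def Let_def
      using that by (simp add: Tr_exq[OF _ _ B mp] Tr_meet[OF _ _ sp]
          Tr_sub2[OF _ v(1,3) pr(1)] Tr_sub2[OF _ v(3,2) pr(2)] var_pair)
    then show ?thesis
      using that by (auto simp: R_def \<phi> \<psi> tripos_to_topos_def)
  qed
  \<comment> \<open>The axioms are checked on the ordinary composite, which yields an arrow
    \<open>h\<close>. It is then recognized as \<open>g \<star> f\<close>, because its predicate and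
    \<open>relational_composite\<close> hold at the same elements.\<close>
  have "\<exists>h\<in>Hom \<T> X Z. \<forall>s a c. stage s \<longrightarrow> R s h a c = (\<exists>b\<in>el s ?B. R s f a b \<and> R s g b c)"
  proof (rule T_HomI[OF X Z, of "\<lambda>s a c. \<exists>b\<in>el s ?B. R s f a b \<and> R s g b c"])
    show "definable (prd C ?A ?D) (\<lambda>s w. \<exists>b\<in>el s ?B. R s f (pr1 C ?A ?D \<cdot> w) b \<and> R s g b (pr2 C ?A ?D \<cdot> w))"
      using A B D
      by (intro definable_intros definable_R[OF f] definable_R[OF g])
    show "E s Z c c" if "stage s" "\<exists>b\<in>el s ?B. R s f a b \<and> R s g b c" for s a c
      using that by (blast intro: R_cod[OF g])
  next
    fix s a assume s: "stage s" and "E s X a a"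
    then obtain b where b: "R s f a b" using R_total[OF f s] by blast
    then obtain c where "R s g b c" using R_total[OF g s] R_cod[OF f s] by blast
    then show "\<exists>c. \<exists>b\<in>el s ?B. R s f a b \<and> R s g b c"
      using b R_el[OF f] by blast
  next
    fix s a c c' assume s: "stage s" and "\<exists>b\<in>el s ?B. R s f a b \<and> R s g b c"
      "\<exists>b\<in>el s ?B. R s f a b \<and> R s g b c'"
    then show "E s Z c c'"
      using R_single[OF f s] R_single[OF g s] R_cong1[OF g s] by blast
  qed (blast intro: R_dom[OF f] R_cong1[OF f] R_cong2[OF g])+
  then obtain h where h: "h \<in> Hom \<T> X Z"
    "\<And>s a c. stage s \<Longrightarrow> R s h a c \<longleftrightarrow> (\<exists>b\<in>el s ?B. R s f a b \<and> R s g b c)"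
    by blast
  have "fst (snd h) = ?\<chi>"
  proof (rule pred_eqI2[OF A D T_Hom_pred[OF h(1)] \<chi>])
    show "Tr s (fst (snd h)) (pair C a c) \<longleftrightarrow> Tr s ?\<chi> (pair C a c)"
      if "stage s" "a \<in> el s ?A" "c \<in> el s ?D" for s a c
      using h(2)[OF that(1), of a c] R\<chi>[OF that] R_el(2)[OF f] R_iff_Tr[OF h(1) that(2,3)] by blast
  qed
  then have "h = g \<star> f"
    using h(1) unfolding T_Hom_iff \<phi> \<psi> by (auto simp: tripos_to_topos_def)
  then show "g \<star> f \<in> Hom \<T> X Z" "stage s \<Longrightarrow> R s (g \<star> f) a c \<longleftrightarrow> (\<exists>b. R s f a b \<and> R s g b c)"
    using h R_el[OF f] by blast+
qed

lemma category_T: "category \<T>"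
proof
  show "src \<T> f \<in> ob \<T>" "tgt \<T> f \<in> ob \<T>" if "f \<in> ar \<T>" for f
    using that by (auto simp: tripos_to_topos_def)
  show "ide \<T> X \<in> Hom \<T> X X" if "X \<in> ob \<T>" for X
    using T_ide_Hom[OF that] .
  show "g \<star> f \<in> Hom \<T> X Z" if "f \<in> Hom \<T> X Y" "g \<in> Hom \<T> Y Z" for f g X Y Z
    using T_cmp_Hom[OF that] .
  show "ide \<T> Y \<star> f = f" if f: "f \<in> Hom \<T> X Y" for f X Y
  proof -
    have Y: "Y \<in> ob \<T>" using f T_Hom_iff by blast
    show ?thesis
      by (rule T_Hom_eqI[OF T_cmp_Hom[OF f T_ide_Hom[OF Y]] f])
        (use R_cmp[OF f T_ide_Hom[OF Y]] R_ide[OF Y] R_cong2[OF f] in blast)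
  qed
  show "f \<star> ide \<T> X = f" if f: "f \<in> Hom \<T> X Y" for f X Y
  proof -
    have X: "X \<in> ob \<T>" using f T_Hom_iff by blast
    show ?thesis
      by (rule T_Hom_eqI[OF T_cmp_Hom[OF T_ide_Hom[OF X] f] f])
        (use R_cmp[OF T_ide_Hom[OF X] f] R_ide[OF X] R_cong1[OF f] E_sym[OF X] in blast)
  qed
  show "h \<star> (g \<star> f) = h \<star> g \<star> f"
    if f: "f \<in> Hom \<T> X Y" and g: "g \<in> Hom \<T> Y Z" and h: "h \<in> Hom \<T> Z W" for f g h X Y Z W
    by (rule T_Hom_eqI[OF T_cmp_Hom[OF T_cmp_Hom[OF f g] h] T_cmp_Hom[OF f T_cmp_Hom[OF g h]]])
      (use R_cmp[OF T_cmp_Hom[OF f g] h] R_cmp[OF f T_cmp_Hom[OF g h]] R_cmp[OF f g] R_cmp[OF g h] in blast)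
qed

sublocale T: category \<T>
  by (rule category_T)

lemma T_HomD: "f \<in> Hom \<T> X Y \<Longrightarrow> X \<in> ob \<T>" "f \<in> Hom \<T> X Y \<Longrightarrow> Y \<in> ob \<T>"
  using T.HomD by blast+

lemma ide_el: "a \<in> el s A \<Longrightarrow> ide C A \<cdot> a = a"
  by (simp add: el_simps)

text \<open>A base arrow that respects the relations has a graph. Legs of pullbacks, inclusions of
  images, projections onto quotients and the arrows \<open>J_map\<close> all arise in this
  way.\<close>

lemma T_Hom_of_arrow:
  assumes X: "X \<in> ob \<T>" and Y: "Y \<in> ob \<T>" and t: "t \<in> Hom C (fst X) (fst Y)"
    and resp: "\<And>s a a'. stage s \<Longrightarrow> E s X a a' \<Longrightarrow> E s Y (t \<cdot> a) (t \<cdot> a')"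
  shows "\<exists>f\<in>Hom \<T> X Y. \<forall>s a b. stage s \<longrightarrow> R s f a b = (E s X a a \<and> E s Y (t \<cdot> a) b)"
proof (rule T_HomI[OF X Y])
  show "definable (prd C (fst X) (fst Y))
      (\<lambda>s w. E s X (pr1 C (fst X) (fst Y) \<cdot> w) (pr1 C (fst X) (fst Y) \<cdot> w) \<and>
        E s Y (t \<cdot> (pr1 C (fst X) (fst Y) \<cdot> w)) (pr2 C (fst X) (fst Y) \<cdot> w))"
    using T_obD(1)[OF X] T_obD(1)[OF Y]
    by (intro definable_intros definable_E[OF X] definable_E[OF Y] trm_cmp[OF t])
  show "E s X a a" if "E s X a a \<and> E s Y (t \<cdot> a) b" for s a b
    using that by blast
  show "E s Y b b" if "stage s" "E s X a a \<and> E s Y (t \<cdot> a) b" for s a b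
    using that E_refl2[OF Y] by blast
  show "E s X a' a' \<and> E s Y (t \<cdot> a') b"
    if s: "stage s" and "E s X a a'" "E s X a a \<and> E s Y (t \<cdot> a) b" for s a a' b
    using that E_refl2[OF X s] E_trans[OF Y s] E_sym[OF Y s] resp[OF s] by blast
  show "E s X a a \<and> E s Y (t \<cdot> a) b'"
    if s: "stage s" and "E s Y b b'" "E s X a a \<and> E s Y (t \<cdot> a) b" for s a b b'
    using that E_trans[OF Y s] by blast
  show "E s Y b b'"
    if s: "stage s" and "E s X a a \<and> E s Y (t \<cdot> a) b" "E s X a a \<and> E s Y (t \<cdot> a) b'" for s a b b'
    using that E_trans[OF Y s] E_sym[OF Y s] by blast
  show "\<exists>b. E s X a a \<and> E s Y (t \<cdot> a) b" if "stage s" "E s X a a" for s a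
    using that resp by blast
qed

text \<open>By single-valuedness of \<open>f\<close> the composite may be evaluated at any value
  \<open>b\<close>, not only at the one that witnesses it.\<close>

lemma R_cmp_apply:
  assumes f: "f \<in> Hom \<T> X Y" and g: "g \<in> Hom \<T> Y Z" and s: "stage s"
    and "R s (g \<star> f) a c" "R s f a b"
  shows "R s g b c"
proof -
  obtain b' where "R s f a b'" "R s g b' c"
    using assms(4) R_cmp[OF f g s] by blast
  then show ?thesis
    using R_single[OF f s] R_cong1[OF g s] assms(5) by blast
qed

text \<open>The elementwise use of a commuting square: when \<open>x\<close> and \<open>y\<close>
  come from one \<open>w\<close>, a value of \<open>f\<close> at \<open>x\<close> is a value of
  \<open>g\<close> at \<open>y\<close>.\<close>

lemma R_commute:
  assumes f: "f \<in> Hom \<T> X Z" and g: "g \<in> Hom \<T> Y Z" and h: "h \<in> Hom \<T> W X" and k: "k \<in> Hom \<T> W Y"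
    and eq: "f \<star> h = g \<star> k" and s: "stage s" and "R s h w x" "R s k w y" "R s f x z"
  shows "R s g y z"
proof -
  have "R s (g \<star> k) w z"
    using eq R_cmp[OF h f s] assms(7,9) by metis
  then show ?thesis
    using R_cmp_apply[OF k g s] assms(8) by blast
qed

text \<open>A pointwise criterion: elements of \<open>W\<close> correspond to the pairs identified
  by \<open>f\<close> and \<open>g\<close>, existence being \<open>surj\<close> and uniqueness up to
  \<open>E\<close> being \<open>inj\<close>.\<close>

lemma T_pullbackI:
  assumes f: "f \<in> Hom \<T> X Z" and g: "g \<in> Hom \<T> Y Z" and h: "h \<in> Hom \<T> W X" and k: "k \<in> Hom \<T> W Y"
    and eq: "f \<star> h = g \<star> k"
    and surj: "\<And>s x y z. stage s \<Longrightarrow> R s f x z \<Longrightarrow> R s g y z \<Longrightarrow> \<exists>w. R s h w x \<and> R s k w y"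
    and inj: "\<And>s x y w w'. stage s \<Longrightarrow> R s h w x \<Longrightarrow> R s k w y \<Longrightarrow> R s h w' x \<Longrightarrow> R s k w' y \<Longrightarrow> E s W w w'"
  shows "is_pullback \<T> f g h k"
proof (rule T.pullbackI[OF f g h k eq])
  note W = T_HomD(1)[OF h]
  note ob = T_obD(1)[OF T_HomD(1)[OF f]] T_obD(1)[OF T_HomD(1)[OF g]] T_obD(1)[OF T_HomD(1)[OF h]]
  fix V u v
  assume u: "u \<in> Hom \<T> V X" and v: "v \<in> Hom \<T> V Y" and uv: "f \<star> u = g \<star> v"
  note V = T_HomD(1)[OF u]
  note oV = T_obD(1)[OF V]
  \<comment> \<open>The mediating arrow relates \<open>a\<close> to those \<open>w\<close> whose two
    projections are the values of \<open>u\<close> and \<open>v\<close> at \<open>a\<close>;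
    \<open>surj\<close> makes it total and \<open>inj\<close> single-valued.\<close>
  let ?S = "\<lambda>s a w. (\<exists>x\<in>el s (fst X). R s u a x \<and> R s h w x) \<and> (\<exists>y\<in>el s (fst Y). R s v a y \<and> R s k w y)"
  have "\<exists>t\<in>Hom \<T> V W. \<forall>s a w. stage s \<longrightarrow> R s t a w = ?S s a w"
  proof (rule T_HomI[OF V W])
    show "definable (prd C (fst V) (fst W))
      (\<lambda>s a. (\<exists>x\<in>el s (fst X). R s u (pr1 C (fst V) (fst W) \<cdot> a) x \<and> R s h (pr2 C (fst V) (fst W) \<cdot> a) x) \<and>
        (\<exists>y\<in>el s (fst Y). R s v (pr1 C (fst V) (fst W) \<cdot> a) y \<and> R s k (pr2 C (fst V) (fst W) \<cdot> a) y))"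
      using ob oV
      by (intro definable_intros definable_R[OF u] definable_R[OF v] definable_R[OF h] definable_R[OF k])
    fix s a w assume s: "stage s" and S: "?S s a w"
    show "E s V a a" using S R_dom[OF u s] by blast
    show "E s W w w" using S R_dom[OF h s] by blast
    show "?S s a' w" if "E s V a a'" for a'
      using S that R_cong1[OF u s] R_cong1[OF v s] by blast
    show "?S s a w'" if "E s W w w'" for w'
      using S that R_cong1[OF h s] R_cong1[OF k s] by blast
    show "E s W w w'" if S': "?S s a w'" for w'
    proof -
      obtain x y where xy: "R s u a x" "R s h w x" "R s v a y" "R s k w y"
        using S by blast
      obtain x' y' where xy': "R s u a x'" "R s h w' x'" "R s v a y'" "R s k w' y'"
        using S' by blast
      have "E s X x' x" "E s Y y' y"
        using xy xy' R_single[OF u s] R_single[OF v s] by blast+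
      then have "R s h w' x" "R s k w' y"
        using xy' R_cong2[OF h s] R_cong2[OF k s] by blast+
      then show ?thesis
        using inj[OF s] xy by blast
    qed
  next
    fix s a assume s: "stage s" and a: "E s V a a"
    obtain x where x: "R s u a x" using R_total[OF u s a] by blast
    obtain y where y: "R s v a y" using R_total[OF v s a] by blast
    obtain z where z: "R s f x z" using R_total[OF f s R_cod[OF u s x]] by blast
    have "R s g y z"
      using R_commute[OF f g u v uv s x y z] .
    then obtain w where "R s h w x" "R s k w y"
      using surj[OF s z] by blast
    then show "\<exists>w. ?S s a w"
      using x y R_el(2)[OF u x] R_el(2)[OF v y] by blast
  qed
  then obtain t where t: "t \<in> Hom \<T> V W" and Rt: "\<And>s a w. stage s \<Longrightarrow> R s t a w = ?S s a w"
    by blast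
  have "h \<star> t = u"
  proof (rule T_Hom_eqI[OF T_cmp_Hom[OF t h] u])
    fix s a b assume s: "stage s" and "R s (h \<star> t) a b"
    then obtain w where w: "R s t a w" "R s h w b"
      using R_cmp[OF t h s] by blast
    then obtain x where "R s u a x" "R s h w x"
      using Rt[OF s] by blast
    then show "R s u a b"
      using R_single[OF h s] w R_cong2[OF u s] by blast
  qed
  moreover have "k \<star> t = v"
  proof (rule T_Hom_eqI[OF T_cmp_Hom[OF t k] v])
    fix s a b assume s: "stage s" and "R s (k \<star> t) a b"
    then obtain w where w: "R s t a w" "R s k w b"
      using R_cmp[OF t k s] by blast
    then obtain x where "R s v a x" "R s k w x"
      using Rt[OF s] by blast
    then show "R s v a b"
      using R_single[OF k s] w R_cong2[OF v s] by blast
  qed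
  ultimately show "\<exists>w\<in>Hom \<T> V W. h \<star> w = u \<and> k \<star> w = v"
    using t by blast
next
  fix V t t'
  assume t: "t \<in> Hom \<T> V W" and t': "t' \<in> Hom \<T> V W"
    and e: "h \<star> t = h \<star> t'" "k \<star> t = k \<star> t'"
  show "t = t'"
  proof (rule T_Hom_eqI[OF t t'])
    fix s a w assume s: "stage s" and w: "R s t a w"
    obtain w' where w': "R s t' a w'"
      using R_total[OF t' s R_dom[OF t s w]] by blast
    obtain x where x: "R s h w x" using R_total[OF h s R_cod[OF t s w]] by blast
    obtain y where y: "R s k w y" using R_total[OF k s R_cod[OF t s w]] by blast
    have "R s h w' x" "R s k w' y"
      using R_commute[OF h h t t' e(1) s w w' x] R_commute[OF k k t t' e(2) s w w' y] by blast+
    then have "E s W w' w"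
      using inj[OF s] x y by blast
    then show "R s t' a w"
      using R_cong2[OF t' s] w' by blast
  qed
qed

text \<open>A relation between \<open>X\<close> and \<open>Y\<close> is represented by the product
  carrier with its equality restricted to \<Phi>. Besides pullbacks this supplies the test objects
  that turn joint monicity into a statement about elements.\<close>

lemma T_tabulation:
  assumes X: "X \<in> ob \<T>" and Y: "Y \<in> ob \<T>"
    and def: "definable (prd C (fst X) (fst Y))
      (\<lambda>s w. \<Phi> s (pr1 C (fst X) (fst Y) \<cdot> w) (pr2 C (fst X) (fst Y) \<cdot> w))"
    and cong: "\<And>s x x' y y'. stage s \<Longrightarrow> E s X x x' \<Longrightarrow> E s Y y y' \<Longrightarrow> \<Phi> s x y \<Longrightarrow> \<Phi> s x' y'"
  obtains W h k where "h \<in> Hom \<T> W X" "k \<in> Hom \<T> W Y"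
    "\<And>s x y. stage s \<Longrightarrow> (\<exists>w. R s h w x \<and> R s k w y) \<longleftrightarrow> \<Phi> s x y \<and> E s X x x \<and> E s Y y y"
    "\<And>s x y w w'. stage s \<Longrightarrow> R s h w x \<Longrightarrow> R s k w y \<Longrightarrow> R s h w' x \<Longrightarrow> R s k w' y \<Longrightarrow> E s W w w'"
proof -
  let ?A = "fst X" and ?B = "fst Y"
  note ob = T_obD(1)[OF X] T_obD(1)[OF Y]
  let ?p = "pr1 C ?A ?B" and ?q = "pr2 C ?A ?B"
  note p = B.pr1_Hom[OF ob(1,2)] and q = B.pr2_Hom[OF ob(1,2)]
  \<comment> \<open>Imposing \<Phi> on \<open>w\<close> is enough, as \<open>cong\<close> passes it
    on to every related \<open>w'\<close>.\<close>
  let ?M = "\<lambda>s w w'. E s X (?p \<cdot> w) (?p \<cdot> w') \<and> E s Y (?q \<cdot> w) (?q \<cdot> w') \<and>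
    \<Phi> s (?p \<cdot> w) (?q \<cdot> w)"
  have "\<exists>W\<in>ob \<T>. fst W = prd C ?A ?B \<and> (\<forall>s w w'. stage s \<longrightarrow>
      E s W w w' = (w \<in> el s (prd C ?A ?B) \<and> w' \<in> el s (prd C ?A ?B) \<and> ?M s w w'))"
  proof (rule T_obI[OF B.prd_ob[OF ob(1,2)]])
    \<comment> \<open>Definability of \<Phi> is given over \<open>A x B\<close>, whereas
      \<open>?M\<close> lives over the square of that product; the representing predicate \<phi> is
      evaluated at the first projection.\<close>
    obtain \<phi> where \<phi>: "\<phi> \<in> preds P (prd C ?A ?B)"
      "\<And>s w. stage s \<Longrightarrow> w \<in> el s (prd C ?A ?B) \<Longrightarrow> Tr s \<phi> w \<longleftrightarrow> \<Phi> s (?p \<cdot> w) (?q \<cdot> w)"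
      using def unfolding definable_def by blast
    let ?AB = "prd C ?A ?B"
    note AB = B.prd_ob[OF ob(1,2)]
    have "definable (prd C ?AB ?AB)
      (\<lambda>s w. E s X (?p \<cdot> (pr1 C ?AB ?AB \<cdot> w)) (?p \<cdot> (pr2 C ?AB ?AB \<cdot> w)) \<and>
        E s Y (?q \<cdot> (pr1 C ?AB ?AB \<cdot> w)) (?q \<cdot> (pr2 C ?AB ?AB \<cdot> w)) \<and>
        Tr s \<phi> (pr1 C ?AB ?AB \<cdot> w))"
      using ob
      by (intro definable_conj definable_E[OF X] definable_E[OF Y] definable_Tr[OF \<phi>(1)]
          trm_pr1 trm_pr2 trm_id B.prd_ob)
    then show "definable (prd C ?AB ?AB) (\<lambda>s w. ?M s (pr1 C ?AB ?AB \<cdot> w) (pr2 C ?AB ?AB \<cdot> w))"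
      by (rule definable_cong) (simp add: \<phi>(2) AB)
    fix s w w' assume s: "stage s" and M: "?M s w w'"
    show "?M s w' w"
      using M E_sym[OF X s] E_sym[OF Y s] cong[OF s] by blast
    show "?M s w w''" if "?M s w' w''" for w''
      using M that E_trans[OF X s] E_trans[OF Y s] by blast
  qed
  then obtain W where W: "W \<in> ob \<T>" "fst W = prd C ?A ?B"
    and EW: "\<And>s w w'. stage s \<Longrightarrow> E s W w w' = (w \<in> el s (prd C ?A ?B) \<and> w' \<in> el s (prd C ?A ?B) \<and> ?M s w w')"
    by blast
  have "\<exists>h\<in>Hom \<T> W X. \<forall>s w x. stage s \<longrightarrow> R s h w x = (E s W w w \<and> E s X (?p \<cdot> w) x)"
    using p W(2) EW by (intro T_Hom_of_arrow[OF W(1) X]) auto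
  then obtain h where h: "h \<in> Hom \<T> W X"
    and Rh: "\<And>s w x. stage s \<Longrightarrow> R s h w x = (E s W w w \<and> E s X (?p \<cdot> w) x)"
    by blast
  have "\<exists>k\<in>Hom \<T> W Y. \<forall>s w y. stage s \<longrightarrow> R s k w y = (E s W w w \<and> E s Y (?q \<cdot> w) y)"
    using q W(2) EW by (intro T_Hom_of_arrow[OF W(1) Y]) auto
  then obtain k where k: "k \<in> Hom \<T> W Y"
    and Rk: "\<And>s w y. stage s \<Longrightarrow> R s k w y = (E s W w w \<and> E s Y (?q \<cdot> w) y)"
    by blast
  show thesis
  proof (rule that[OF h k])
    show "(\<exists>w. R s h w x \<and> R s k w y) \<longleftrightarrow> \<Phi> s x y \<and> E s X x x \<and> E s Y y y" if s: "stage s" for s x y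
    proof
      assume "\<exists>w. R s h w x \<and> R s k w y"
      then obtain w where w: "R s h w x" "R s k w y" by blast
      then have "E s X (?p \<cdot> w) x" "E s Y (?q \<cdot> w) y" "\<Phi> s (?p \<cdot> w) (?q \<cdot> w)"
        using Rh[OF s] Rk[OF s] EW[OF s] by blast+
      then show "\<Phi> s x y \<and> E s X x x \<and> E s Y y y"
        using cong[OF s] R_cod[OF h s w(1)] R_cod[OF k s w(2)] by blast
    next
      assume *: "\<Phi> s x y \<and> E s X x x \<and> E s Y y y"
      then have "x \<in> el s ?A" "y \<in> el s ?B"
        using E_el by blast+
      then have "R s h (pair C x y) x \<and> R s k (pair C x y) y"
        unfolding Rh[OF s] Rk[OF s] EW[OF s] using * by simp
      then show "\<exists>w. R s h w x \<and> R s k w y" by blast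
    qed
    show "E s W w w'"
      if s: "stage s" and R: "R s h w x" "R s k w y" "R s h w' x" "R s k w' y" for s x y w w'
    proof -
      have e: "E s W w w" "E s W w' w'" "E s X (?p \<cdot> w) x" "E s X (?p \<cdot> w') x"
        "E s Y (?q \<cdot> w) y" "E s Y (?q \<cdot> w') y"
        using R Rh[OF s] Rk[OF s] by blast+
      have "E s X (?p \<cdot> w) (?p \<cdot> w')" "E s Y (?q \<cdot> w) (?q \<cdot> w')"
        using E_trans[OF X s e(3) E_sym[OF X s e(4)]] E_trans[OF Y s e(5) E_sym[OF Y s e(6)]] by blast+
      then show ?thesis
        using e(1,2) EW[OF s] by blast
    qed
  qed
qed

lemma T_pullback_exists:
  assumes f: "f \<in> Hom \<T> X Z" and g: "g \<in> Hom \<T> Y Z"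
  obtains W h k where "h \<in> Hom \<T> W X" "k \<in> Hom \<T> W Y" "is_pullback \<T> f g h k"
    "\<And>s x y z. stage s \<Longrightarrow> R s f x z \<Longrightarrow> R s g y z \<Longrightarrow> \<exists>w. R s h w x \<and> R s k w y"
proof -
  note X = T_HomD(1)[OF f] and Y = T_HomD(1)[OF g] and Z = T_HomD(2)[OF f]
  note ob = T_obD(1)[OF X] T_obD(1)[OF Y] T_obD(1)[OF Z]
  let ?\<Phi> = "\<lambda>s x y. \<exists>z\<in>el s (fst Z). R s f x z \<and> R s g y z"
  obtain W h k where h: "h \<in> Hom \<T> W X" and k: "k \<in> Hom \<T> W Y"
    and hk: "\<And>s x y. stage s \<Longrightarrow> (\<exists>w. R s h w x \<and> R s k w y) \<longleftrightarrow> ?\<Phi> s x y \<and> E s X x x \<and> E s Y y y"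
    and inj: "\<And>s x y w w'. stage s \<Longrightarrow> R s h w x \<Longrightarrow> R s k w y \<Longrightarrow> R s h w' x \<Longrightarrow> R s k w' y \<Longrightarrow> E s W w w'"
  proof (rule T_tabulation[OF X Y])
    show "definable (prd C (fst X) (fst Y)) (\<lambda>s w. ?\<Phi> s (pr1 C (fst X) (fst Y) \<cdot> w) (pr2 C (fst X) (fst Y) \<cdot> w))"
      using ob by (intro definable_intros definable_R[OF f] definable_R[OF g])
    show "?\<Phi> s x' y'" if s: "stage s" and "E s X x x'" "E s Y y y'" "?\<Phi> s x y" for s x x' y y'
      using that R_cong1[OF f s] R_cong1[OF g s] by blast
  qed (rule that)
  have surj: "\<exists>w. R s h w x \<and> R s k w y" if s: "stage s" and x: "R s f x z" and y: "R s g y z" for s x y z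
    using hk[OF s] x y R_dom[OF f s x] R_dom[OF g s y] R_el[OF f x] by blast
  have "f \<star> h = g \<star> k"
  proof (rule T_Hom_eqI[OF T_cmp_Hom[OF h f] T_cmp_Hom[OF k g]])
    fix s w z assume s: "stage s" and "R s (f \<star> h) w z"
    then obtain x where x: "R s h w x" "R s f x z"
      using R_cmp[OF h f s] by blast
    obtain y where y: "R s k w y"
      using R_total[OF k s R_dom[OF h s x(1)]] by blast
    obtain z' where z': "R s f x z'" "R s g y z'"
      using hk[OF s] x(1) y by blast
    then have "R s g y z"
      using R_single[OF f s] x(2) R_cong2[OF g s] by blast
    then show "R s (g \<star> k) w z"
      using R_cmp[OF k g s] y by blast
  qed
  then have "is_pullback \<T> f g h k"
    by (rule T_pullbackI[OF f g h k]) (use surj inj in blast)+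
  then show thesis
    using that h k surj by blast
qed

text \<open>Joint monicity speaks of arrows and is tested on the object of all pairs
  \<open>(w, w')\<close> with common images under \<open>h\<close> and \<open>k\<close>. Its
  projections agree after \<open>h\<close> and after \<open>k\<close>, hence coincide, which relates
  the components.\<close>

lemma T_jointly_monic_inj:
  assumes h: "h \<in> Hom \<T> W X" and k: "k \<in> Hom \<T> W Y"
    and jm: "\<And>V t t'. t \<in> Hom \<T> V W \<Longrightarrow> t' \<in> Hom \<T> V W \<Longrightarrow> h \<star> t = h \<star> t' \<Longrightarrow> k \<star> t = k \<star> t'
      \<Longrightarrow> t = t'"
    and s: "stage s" and R: "R s h w x" "R s k w y" "R s h w' x" "R s k w' y"
  shows "E s W w w'"
proof -
  note W = T_HomD(1)[OF h]
  note ob = T_obD(1)[OF W] T_obD(1)[OF T_HomD(2)[OF h]] T_obD(1)[OF T_HomD(2)[OF k]]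
  let ?\<Phi> = "\<lambda>s w w'. (\<exists>x\<in>el s (fst X). R s h w x \<and> R s h w' x) \<and> (\<exists>y\<in>el s (fst Y). R s k w y \<and> R s k w' y)"
  obtain V t t' where t: "t \<in> Hom \<T> V W" and t': "t' \<in> Hom \<T> V W"
    and tt: "\<And>s w w'. stage s \<Longrightarrow> (\<exists>v. R s t v w \<and> R s t' v w') \<longleftrightarrow> ?\<Phi> s w w' \<and> E s W w w \<and> E s W w' w'"
  proof (rule T_tabulation[OF W W])
    show "definable (prd C (fst W) (fst W)) (\<lambda>s w. ?\<Phi> s (pr1 C (fst W) (fst W) \<cdot> w) (pr2 C (fst W) (fst W) \<cdot> w))"
      using ob by (intro definable_intros definable_R[OF h] definable_R[OF k])
    show "?\<Phi> s v v'" if s: "stage s" and "E s W w v" "E s W w' v'" "?\<Phi> s w w'" for s w v w' v'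
      using that R_cong1[OF h s] R_cong1[OF k s] by blast
  qed (rule that)
  have "h \<star> t = h \<star> t'"
  proof (rule T_Hom_eqI[OF T_cmp_Hom[OF t h] T_cmp_Hom[OF t' h]])
    fix s v x assume s: "stage s" and "R s (h \<star> t) v x"
    then obtain w where w: "R s t v w" "R s h w x"
      using R_cmp[OF t h s] by blast
    obtain w' where w': "R s t' v w'"
      using R_total[OF t' s R_dom[OF t s w(1)]] by blast
    obtain x' where "R s h w x'" "R s h w' x'"
      using tt[OF s] w(1) w' by blast
    then have "R s h w' x"
      using R_single[OF h s] w(2) R_cong2[OF h s] by blast
    then show "R s (h \<star> t') v x"
      using R_cmp[OF t' h s] w' by blast
  qed
  moreover have "k \<star> t = k \<star> t'"
  proof (rule T_Hom_eqI[OF T_cmp_Hom[OF t k] T_cmp_Hom[OF t' k]])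
    fix s v x assume s: "stage s" and "R s (k \<star> t) v x"
    then obtain w where w: "R s t v w" "R s k w x"
      using R_cmp[OF t k s] by blast
    obtain w' where w': "R s t' v w'"
      using R_total[OF t' s R_dom[OF t s w(1)]] by blast
    obtain x' where "R s k w x'" "R s k w' x'"
      using tt[OF s] w(1) w' by blast
    then have "R s k w' x"
      using R_single[OF k s] w(2) R_cong2[OF k s] by blast
    then show "R s (k \<star> t') v x"
      using R_cmp[OF t' k s] w' by blast
  qed
  ultimately have "t = t'"
    using jm[OF t t'] by blast
  moreover have "\<exists>v. R s t v w \<and> R s t' v w'"
    unfolding tt[OF s]
    using R R_el(2)[OF h R(1)] R_el(2)[OF k R(2)] R_dom[OF h s] by blast
  ultimately show ?thesis
    using R_single[OF t s] by blast
qed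

text \<open>The explicit pullback has an arrow \<open>t\<close> into the given one that is
  compatible with the legs; elements found in the former are pushed along \<open>t\<close>.\<close>

lemma T_pullbackD:
  assumes pb: "is_pullback \<T> f g h k" and f: "f \<in> Hom \<T> X Z" and g: "g \<in> Hom \<T> Y Z"
  obtains W where "h \<in> Hom \<T> W X" "k \<in> Hom \<T> W Y" "f \<star> h = g \<star> k"
    "\<And>s x y z. stage s \<Longrightarrow> R s f x z \<Longrightarrow> R s g y z \<Longrightarrow> \<exists>w. R s h w x \<and> R s k w y"
proof (rule T.pullbackE[OF pb])
  fix X' Y' Z' W
  assume f': "f \<in> Hom \<T> X' Z'" and g': "g \<in> Hom \<T> Y' Z'" and h: "h \<in> Hom \<T> W X'" and k: "k \<in> Hom \<T> W Y'"
    and eq: "f \<star> h = g \<star> k"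
    and ex: "\<And>V u v. u \<in> Hom \<T> V X' \<Longrightarrow> v \<in> Hom \<T> V Y' \<Longrightarrow> f \<star> u = g \<star> v
      \<Longrightarrow> \<exists>w\<in>Hom \<T> V W. h \<star> w = u \<and> k \<star> w = v"
  have XY: "X' = X" "Y' = Y"
    using T.HomD(2)[OF f] T.HomD(2)[OF f'] T.HomD(2)[OF g] T.HomD(2)[OF g'] by auto
  note h = h[unfolded XY] and k = k[unfolded XY] and ex = ex[unfolded XY]
  obtain V h0 k0 where h0: "h0 \<in> Hom \<T> V X" and k0: "k0 \<in> Hom \<T> V Y"
    and pb0: "is_pullback \<T> f g h0 k0"
    and surj: "\<And>s x y z. stage s \<Longrightarrow> R s f x z \<Longrightarrow> R s g y z \<Longrightarrow> \<exists>w. R s h0 w x \<and> R s k0 w y"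
    using T_pullback_exists[OF f g] by metis
  have "f \<star> h0 = g \<star> k0"
    using pb0 unfolding is_pullback_def by blast
  then obtain t where t: "t \<in> Hom \<T> V W" "h \<star> t = h0" "k \<star> t = k0"
    using ex[OF h0 k0] by blast
  show thesis
  proof (rule that[OF h k eq])
    fix s x y z assume s: "stage s" and "R s f x z" "R s g y z"
    then obtain v where v: "R s h0 v x" "R s k0 v y"
      using surj[OF s] by blast
    obtain w where w: "R s t v w" "R s h w x"
      using v(1) R_cmp[OF t(1) h s] t(2) by blast
    have "R s k w y"
      using R_cmp_apply[OF t(1) k s _ w(1)] v(2) t(3) by blast
    then show "\<exists>w. R s h w x \<and> R s k w y"
      using w(2) by blast
  qed
qed

text \<open>The preimage is demanded at the same stage. Agreement with regular epimorphisms is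
  \<open>T_surjective_regular_epi\<close> and \<open>T_regular_epi_surjective\<close>.\<close>

definition surjective :: "('o, 'p) per_ar \<Rightarrow> ('o, 'p) per_ob \<Rightarrow> bool" where
  "surjective e Y \<longleftrightarrow> (\<forall>s y. stage s \<longrightarrow> E s Y y y \<longrightarrow> (\<exists>x. R s e x y))"

text \<open>An arrow \<open>u\<close> descends by taking any preimage \<open>x\<close> of
  \<open>y\<close>: \<open>ker\<close> connects two preimages by an element of \<open>W\<close>, and
  \<open>u\<close> agrees on its two images.\<close>

lemma T_surjective_coequalizer:
  assumes e: "e \<in> Hom \<T> X Y" and p: "p \<in> Hom \<T> W X" and q: "q \<in> Hom \<T> W X"
    and eq: "e \<star> p = e \<star> q" and surj: "surjective e Y"
    and ker: "\<And>s x x' y. stage s \<Longrightarrow> R s e x y \<Longrightarrow> R s e x' y \<Longrightarrow> \<exists>w. R s p w x \<and> R s q w x'"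
  shows "is_coequalizer \<T> p q e"
proof (rule T.coequalizerI[OF p q e eq])
  note X = T_HomD(1)[OF e] and Y = T_HomD(2)[OF e]
  have surj: "\<exists>x. R s e x y" if "stage s" "E s Y y y" for s y
    using surj that unfolding surjective_def by blast
  show "\<exists>w\<in>Hom \<T> Y Z. w \<star> e = u" if u: "u \<in> Hom \<T> X Z" and upq: "u \<star> p = u \<star> q" for Z u
  proof -
    note Z = T_HomD(2)[OF u]
    note ob = T_obD(1)[OF X] T_obD(1)[OF Y] T_obD(1)[OF Z]
    let ?S = "\<lambda>s y z. \<exists>x\<in>el s (fst X). R s e x y \<and> R s u x z"
    have uu: "R s u x' z" if s: "stage s" and x: "R s e x y" "R s e x' y" "R s u x z" for s x x' y z
    proof -
      obtain w where w: "R s p w x" "R s q w x'" using ker[OF s x(1,2)] by blast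
      show ?thesis
        using R_commute[OF u u p q upq s w x(3)] .
    qed
    have "\<exists>w\<in>Hom \<T> Y Z. \<forall>s y z. stage s \<longrightarrow> R s w y z = ?S s y z"
    proof (rule T_HomI[OF Y Z])
      show "definable (prd C (fst Y) (fst Z)) (\<lambda>s w. ?S s (pr1 C (fst Y) (fst Z) \<cdot> w) (pr2 C (fst Y) (fst Z) \<cdot> w))"
        using ob by (intro definable_intros definable_R[OF e] definable_R[OF u])
      fix s y z assume s: "stage s" and S: "?S s y z"
      show "E s Y y y" using S R_cod[OF e s] by blast
      show "E s Z z z" using S R_cod[OF u s] by blast
      show "?S s y' z" if "E s Y y y'" for y' using S that R_cong2[OF e s] by blast
      show "?S s y z'" if "E s Z z z'" for z' using S that R_cong2[OF u s] by blast
      show "E s Z z z'" if "?S s y z'" for z'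
        using S that uu[OF s] R_single[OF u s] by blast
    next
      fix s y assume s: "stage s" and y: "E s Y y y"
      obtain x where x: "R s e x y" using surj[OF s y] by blast
      obtain z where "R s u x z" using R_total[OF u s R_dom[OF e s x]] by blast
      then show "\<exists>z. ?S s y z" using x R_el(1)[OF e x] by blast
    qed
    then obtain w where w: "w \<in> Hom \<T> Y Z" and Rw: "\<And>s y z. stage s \<Longrightarrow> R s w y z = ?S s y z"
      by blast
    have "w \<star> e = u"
    proof (rule T_Hom_eqI[OF T_cmp_Hom[OF e w] u])
      fix s x z assume s: "stage s" and "R s (w \<star> e) x z"
      then obtain y where y: "R s e x y" "R s w y z" using R_cmp[OF e w s] by blast
      then obtain x' where "R s e x' y" "R s u x' z" using Rw[OF s] by blast
      then show "R s u x z" using uu[OF s] y(1) by blast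
    qed
    then show ?thesis using w by blast
  qed
  show "w = w'"
    if w: "w \<in> Hom \<T> Y Z" and w': "w' \<in> Hom \<T> Y Z" and ww: "w \<star> e = w' \<star> e" for Z w w'
  proof (rule T_Hom_eqI[OF w w'])
    fix s y z assume s: "stage s" and yz: "R s w y z"
    obtain x where x: "R s e x y" using surj[OF s R_dom[OF w s yz]] by blast
    show "R s w' y z"
      using R_commute[OF w w' e e ww s x x yz] .
  qed
qed

lemma T_surjective_regular_epi:
  assumes e: "e \<in> Hom \<T> X Y" and "surjective e Y"
  shows "regular_epi \<T> e"
proof -
  obtain W p q where pq: "p \<in> Hom \<T> W X" "q \<in> Hom \<T> W X" "is_pullback \<T> e e p q"
    "\<And>s x y z. stage s \<Longrightarrow> R s e x z \<Longrightarrow> R s e y z \<Longrightarrow> \<exists>w. R s p w x \<and> R s q w y"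
    using T_pullback_exists[OF e e] by metis
  have "e \<star> p = e \<star> q"
    using pq(3) unfolding is_pullback_def by blast
  then have "is_coequalizer \<T> p q e"
    by (rule T_surjective_coequalizer[OF e pq(1,2) _ assms(2)]) (rule pq(4))
  then show ?thesis
    unfolding regular_epi_def by blast
qed

text \<open>The image has the carrier of \<open>Y\<close> with the relation restricted to values of
  \<open>f\<close>. The arrow \<open>e\<close> is the same relation as \<open>f\<close>, so it is
  surjective by construction.\<close>

lemma T_image:
  assumes f: "f \<in> Hom \<T> X Y"
  obtains I e m where "e \<in> Hom \<T> X I" "m \<in> Hom \<T> I Y" "m \<star> e = f" "surjective e I"
    "\<And>s x y. stage s \<Longrightarrow> R s e x y \<longleftrightarrow> R s f x y"
    "\<And>s y y'. stage s \<Longrightarrow> R s m y y' \<longleftrightarrow> E s I y y \<and> E s Y y y'"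
    "\<And>s y. stage s \<Longrightarrow> E s I y y \<longleftrightarrow> (\<exists>x. R s f x y)"
proof -
  note X = T_HomD(1)[OF f] and Y = T_HomD(2)[OF f]
  note ob = T_obD(1)[OF X] T_obD(1)[OF Y]
  let ?B = "fst Y"
  let ?M = "\<lambda>s y y'. E s Y y y' \<and> (\<exists>x\<in>el s (fst X). R s f x y)"
  have "\<exists>I\<in>ob \<T>. fst I = ?B \<and> (\<forall>s y y'. stage s \<longrightarrow> E s I y y' = (y \<in> el s ?B \<and> y' \<in> el s ?B \<and> ?M s y y'))"
  proof (rule T_obI[OF ob(2)])
    show "definable (prd C ?B ?B) (\<lambda>s w. ?M s (pr1 C ?B ?B \<cdot> w) (pr2 C ?B ?B \<cdot> w))"
      using ob by (intro definable_intros definable_R[OF f] definable_E[OF Y])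
    fix s y y' assume s: "stage s" and M: "?M s y y'"
    show "?M s y' y" using M E_sym[OF Y s] R_cong2[OF f s] by blast
    show "?M s y y''" if "?M s y' y''" for y'' using M that E_trans[OF Y s] by blast
  qed
  then obtain I where I: "I \<in> ob \<T>" "fst I = ?B"
    and EI: "\<And>s y y'. stage s \<Longrightarrow> E s I y y' = (y \<in> el s ?B \<and> y' \<in> el s ?B \<and> ?M s y y')"
    by blast
  have EI1: "E s I y y \<longleftrightarrow> (\<exists>x. R s f x y)" if s: "stage s" for s y
    unfolding EI[OF s] using R_el[OF f] R_cod[OF f s] by blast
  have EI2: "E s I y y'" if s: "stage s" and "R s f x y" "E s Y y y'" for s x y y'
    unfolding EI[OF s] using that R_el[OF f] E_el by blast
  have "\<exists>e\<in>Hom \<T> X I. \<forall>s x y. stage s \<longrightarrow> R s e x y = R s f x y"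
  proof (rule T_HomI[OF X I(1)])
    show "definable (prd C (fst X) (fst I)) (\<lambda>s w. R s f (pr1 C (fst X) (fst I) \<cdot> w) (pr2 C (fst X) (fst I) \<cdot> w))"
      unfolding I(2) using ob by (intro definable_intros definable_R[OF f])
    fix s x y assume s: "stage s" and S: "R s f x y"
    show "E s X x x" using R_dom[OF f s S] .
    show "E s I y y" using EI1[OF s] S by blast
    show "R s f x' y" if "E s X x x'" for x' using R_cong1[OF f s that S] .
    show "R s f x y'" if "E s I y y'" for y' using that EI[OF s] R_cong2[OF f s _ S] by blast
    show "E s I y y'" if "R s f x y'" for y' using EI2[OF s S R_single[OF f s S that]] .
  qed (rule R_total[OF f])
  then obtain e where e: "e \<in> Hom \<T> X I" and Re: "\<And>s x y. stage s \<Longrightarrow> R s e x y = R s f x y"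
    by blast
  have "\<exists>m\<in>Hom \<T> I Y. \<forall>s y y'. stage s \<longrightarrow> R s m y y' = (E s I y y \<and> E s Y (ide C ?B \<cdot> y) y')"
  proof (rule T_Hom_of_arrow[OF I(1) Y])
    show "ide C ?B \<in> Hom C (fst I) ?B" using B.ide_Hom ob(2) I(2) by simp
    show "E s Y (ide C ?B \<cdot> y) (ide C ?B \<cdot> y')" if s: "stage s" and "E s I y y'" for s y y'
    proof -
      have "y \<in> el s ?B" "y' \<in> el s ?B" "E s Y y y'"
        using that EI[OF s] by blast+
      then show ?thesis by (simp add: ide_el)
    qed
  qed
  then obtain m where m: "m \<in> Hom \<T> I Y"
    and Rm': "\<And>s y y'. stage s \<Longrightarrow> R s m y y' = (E s I y y \<and> E s Y (ide C ?B \<cdot> y) y')"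
    by blast
  have Rm: "R s m y y' \<longleftrightarrow> E s I y y \<and> E s Y y y'" if s: "stage s" for s y y'
    using Rm'[OF s, of y y'] E_el(1)[of s I y y] by (auto simp: I(2) ide_el)
  have "m \<star> e = f"
  proof (rule T_Hom_eqI[OF T_cmp_Hom[OF e m] f])
    fix s x y assume s: "stage s" and "R s (m \<star> e) x y"
    then show "R s f x y" using R_cmp[OF e m s] Re[OF s] Rm[OF s] R_cong2[OF f s] by blast
  qed
  moreover have "surjective e I"
    unfolding surjective_def using EI1 Re by blast
  ultimately show thesis
    using that e m Re Rm EI1 by blast
qed

text \<open>The first factor \<open>e1\<close> of the image factorization is the same relation as
  \<open>e\<close>, so it coequalizes the same pair and equals \<open>w \<star> e\<close> for some
  \<open>w\<close>. Then \<open>w\<close> is a section of \<open>m\<close>, and every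
  \<open>y\<close> lies in the image.\<close>

lemma T_regular_epi_surjective:
  assumes e: "e \<in> Hom \<T> X Y" and "regular_epi \<T> e"
  shows "surjective e Y"
proof -
  note Y = T_HomD(2)[OF e]
  obtain f g where "is_coequalizer \<T> f g e"
    using assms(2) unfolding regular_epi_def by blast
  then show ?thesis
  proof (rule T.coequalizerE)
    fix A X' Y'
    assume f: "f \<in> Hom \<T> A X'" and g: "g \<in> Hom \<T> A X'" and e': "e \<in> Hom \<T> X' Y'"
      and eq: "e \<star> f = e \<star> g"
      and ex: "\<And>Z u. u \<in> Hom \<T> X' Z \<Longrightarrow> u \<star> f = u \<star> g \<Longrightarrow> \<exists>w\<in>Hom \<T> Y' Z. w \<star> e = u"
      and un: "\<And>Z w w'. w \<in> Hom \<T> Y' Z \<Longrightarrow> w' \<in> Hom \<T> Y' Z \<Longrightarrow> w \<star> e = w' \<star> e \<Longrightarrow> w = w'"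
    have XY: "X' = X" "Y' = Y"
      using T.HomD(2,3)[OF e] T.HomD(2,3)[OF e'] by auto
    note f = f[unfolded XY] and g = g[unfolded XY] and ex = ex[unfolded XY] and un = un[unfolded XY]
    obtain I e1 m where e1: "e1 \<in> Hom \<T> X I" and m: "m \<in> Hom \<T> I Y" and me: "m \<star> e1 = e"
      and Re1: "\<And>s x y. stage s \<Longrightarrow> R s e1 x y \<longleftrightarrow> R s e x y"
      and Rm: "\<And>s y y'. stage s \<Longrightarrow> R s m y y' \<longleftrightarrow> E s I y y \<and> E s Y y y'"
      and EI: "\<And>s y. stage s \<Longrightarrow> E s I y y \<longleftrightarrow> (\<exists>x. R s e x y)"
      by (rule T_image[OF e]) (rule that)
    have "e1 \<star> f = e1 \<star> g"
    proof (rule T_Hom_eqI[OF T_cmp_Hom[OF f e1] T_cmp_Hom[OF g e1]])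
      fix s a y assume s: "stage s" and "R s (e1 \<star> f) a y"
      then have "R s (e \<star> f) a y"
        using R_cmp[OF f e1 s] R_cmp[OF f e s] Re1[OF s] by blast
      then show "R s (e1 \<star> g) a y"
        unfolding eq using R_cmp[OF g e1 s] R_cmp[OF g e s] Re1[OF s] by blast
    qed
    then obtain w where w: "w \<in> Hom \<T> Y I" "w \<star> e = e1"
      using ex[OF e1] by blast
    have "m \<star> w = ide \<T> Y"
    proof (rule un[OF T_cmp_Hom[OF w(1) m] T_ide_Hom[OF Y]])
      show "m \<star> w \<star> e = ide \<T> Y \<star> e"
        using T.cmp_assoc[OF e w(1) m] w(2) me T.cmp_ide_left[OF e] by simp
    qed
    then show ?thesis
      unfolding surjective_def
      using R_ide[OF Y] R_cmp[OF w(1) m] Rm EI R_cong2[OF e] by metis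
  qed
qed

text \<open>The quotient keeps the carrier of \<open>X\<close> and takes relatedness by
  \<open>r1\<close>, \<open>r2\<close> as its equality. It serves both equivalence relations in the
  topos and images of pseudo-equivalence relations.\<close>

lemma T_quotient:
  assumes r1: "r1 \<in> Hom \<T> W X" and r2: "r2 \<in> Hom \<T> W X"
    and refl: "\<And>s x. stage s \<Longrightarrow> E s X x x \<Longrightarrow> \<exists>w. R s r1 w x \<and> R s r2 w x"
    and sym: "\<And>s w x x'. stage s \<Longrightarrow> R s r1 w x \<Longrightarrow> R s r2 w x' \<Longrightarrow> \<exists>w. R s r1 w x' \<and> R s r2 w x"
    and trans: "\<And>s w w' x x' x''. stage s \<Longrightarrow> R s r1 w x \<Longrightarrow> R s r2 w x' \<Longrightarrow> R s r1 w' x' \<Longrightarrow> R s r2 w' x''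
      \<Longrightarrow> \<exists>w. R s r1 w x \<and> R s r2 w x''"
  obtains Q q where "q \<in> Hom \<T> X Q" "surjective q Q" "q \<star> r1 = q \<star> r2"
    "\<And>s x x' y. stage s \<Longrightarrow> R s q x y \<Longrightarrow> R s q x' y \<Longrightarrow> \<exists>w. R s r1 w x \<and> R s r2 w x'"
proof -
  note W = T_HomD(1)[OF r1] and X = T_HomD(2)[OF r1]
  note ob = T_obD(1)[OF W] T_obD(1)[OF X]
  let ?A = "fst X"
  let ?M = "\<lambda>s x x'. \<exists>w\<in>el s (fst W). R s r1 w x \<and> R s r2 w x'"
  have "\<exists>Q\<in>ob \<T>. fst Q = ?A \<and> (\<forall>s x x'. stage s \<longrightarrow> E s Q x x' = (x \<in> el s ?A \<and> x' \<in> el s ?A \<and> ?M s x x'))"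
  proof (rule T_obI[OF ob(2)])
    show "definable (prd C ?A ?A) (\<lambda>s w. ?M s (pr1 C ?A ?A \<cdot> w) (pr2 C ?A ?A \<cdot> w))"
      using ob by (intro definable_intros definable_R[OF r1] definable_R[OF r2])
    fix s x x' assume s: "stage s" and M: "?M s x x'"
    show "?M s x' x" using M sym[OF s] R_el(1)[OF r1] by blast
    show "?M s x x''" if "?M s x' x''" for x'' using M that trans[OF s] R_el(1)[OF r1] by blast
  qed
  then obtain Q where Q: "Q \<in> ob \<T>" "fst Q = ?A"
    and EQ': "\<And>s x x'. stage s \<Longrightarrow> E s Q x x' = (x \<in> el s ?A \<and> x' \<in> el s ?A \<and> ?M s x x')"
    by blast
  have EQ: "E s Q x x' \<longleftrightarrow> (\<exists>w. R s r1 w x \<and> R s r2 w x')" if s: "stage s" for s x x'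
    unfolding EQ'[OF s] using R_el[OF r1] R_el[OF r2] by blast
  \<comment> \<open>By reflexivity the relation of \<open>Q\<close> is coarser than that of
    \<open>X\<close>, and by \<open>QX\<close> the extents agree; so the identity of the base tracks
    the quotient map.\<close>
  have XQ: "E s Q x x'" if s: "stage s" and "E s X x x'" for s x x'
    unfolding EQ[OF s] using that refl[OF s E_refl[OF X s that(2)]] R_cong2[OF r2 s] by blast
  have QX: "E s X x x" if s: "stage s" and "E s Q x x" for s x
    using that EQ[OF s] R_cod[OF r1 s] by blast
  have "\<exists>q\<in>Hom \<T> X Q. \<forall>s x x'. stage s \<longrightarrow> R s q x x' = (E s X x x \<and> E s Q (ide C ?A \<cdot> x) x')"
  proof (rule T_Hom_of_arrow[OF X Q(1)])
    show "ide C ?A \<in> Hom C (fst X) (fst Q)" using B.ide_Hom ob(2) Q(2) by simp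
    show "E s Q (ide C ?A \<cdot> x) (ide C ?A \<cdot> x')" if s: "stage s" and "E s X x x'" for s x x'
      using XQ[OF that] E_el[OF that(2)] by (simp add: ide_el)
  qed
  then obtain q where q: "q \<in> Hom \<T> X Q"
    and Rq': "\<And>s x x'. stage s \<Longrightarrow> R s q x x' = (E s X x x \<and> E s Q (ide C ?A \<cdot> x) x')"
    by blast
  have Rq: "R s q x x' \<longleftrightarrow> E s Q x x'" if s: "stage s" for s x x'
    using Rq'[OF s, of x x'] E_el(1)[of s X x x] E_el(1)[of s Q x x'] QX[OF s] E_refl[OF Q(1) s, of x x']
    by (auto simp: Q(2) ide_el)
  show thesis
  proof (rule that[OF q])
    show "surjective q Q"
      unfolding surjective_def using Rq by blast
    show "q \<star> r1 = q \<star> r2"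
    proof (rule T_Hom_eqI[OF T_cmp_Hom[OF r1 q] T_cmp_Hom[OF r2 q]])
      fix s w y assume s: "stage s" and "R s (q \<star> r1) w y"
      then obtain x where x: "R s r1 w x" "E s Q x y"
        using R_cmp[OF r1 q s] Rq[OF s] by blast
      obtain x' where x': "R s r2 w x'"
        using R_total[OF r2 s R_dom[OF r1 s x(1)]] by blast
      have "E s Q x x'"
        using EQ[OF s] x(1) x' by blast
      then have "E s Q x' y"
        using x(2) E_sym[OF Q(1) s] E_trans[OF Q(1) s] by blast
      then show "R s (q \<star> r2) w y"
        using R_cmp[OF r2 q s] Rq[OF s] x' by blast
    qed
    show "\<exists>w. R s r1 w x \<and> R s r2 w x'" if s: "stage s" and "R s q x y" "R s q x' y" for s x x' y
      using that E_sym[OF Q(1) s] E_trans[OF Q(1) s] unfolding Rq[OF s] EQ[OF s, symmetric] by blast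
  qed
qed

lemma exact_T: "exact_category \<T>"
proof -
  have "\<exists>X. is_terminal \<T> X"
  proof -
    have one: "one C \<in> ob C" and uniq: "\<And>A. A \<in> ob C \<Longrightarrow> \<exists>!f. f \<in> Hom C A (one C)"
      using B.one_terminal unfolding is_terminal_def by auto
    \<comment> \<open>The terminal object is \<open>one C\<close> with the total relation, which the
      top predicate defines.\<close>
    have "\<exists>X\<in>ob \<T>. fst X = one C \<and> (\<forall>s a b. stage s \<longrightarrow>
        E s X a b = (a \<in> el s (one C) \<and> b \<in> el s (one C) \<and> True))"
    proof (rule T_obI[OF one])
      show "definable (prd C (one C) (one C)) (\<lambda>s w. True)"
        unfolding definable_def using top_preds Tr_top B.prd_ob[OF one one] by blast
    qed blast+
    then obtain X where X: "X \<in> ob \<T>" "fst X = one C"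
      and EX: "\<And>s a b. stage s \<Longrightarrow> E s X a b = (a \<in> el s (one C) \<and> b \<in> el s (one C))"
      by blast
    have "\<exists>!f. f \<in> Hom \<T> Y X" if Y: "Y \<in> ob \<T>" for Y
    proof -
      obtain t where t: "t \<in> Hom C (fst Y) (one C)"
        using uniq T_obD(1)[OF Y] by blast
      have "\<exists>f\<in>Hom \<T> Y X. \<forall>s a b. stage s \<longrightarrow> R s f a b = (E s Y a a \<and> E s X (t \<cdot> a) b)"
      proof (rule T_Hom_of_arrow[OF Y X(1)])
        show "E s X (t \<cdot> a) (t \<cdot> a')" if s: "stage s" and "E s Y a a'" for s a a'
          unfolding EX[OF s] using E_el[OF that(2)] t by simp
      qed (use t X in simp)
      moreover have "f = g" if f: "f \<in> Hom \<T> Y X" and g: "g \<in> Hom \<T> Y X" for f g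
      proof (rule T_Hom_eqI[OF f g])
        fix s a b assume s: "stage s" and ab: "R s f a b"
        obtain b' where b': "R s g a b'"
          using R_total[OF g s R_dom[OF f s ab]] by blast
        have "E s X b' b"
          unfolding EX[OF s] using R_el(2)[OF f ab] R_el(2)[OF g b'] X(2) by simp
        then show "R s g a b"
          using R_cong2[OF g s] b' by blast
      qed
      ultimately show ?thesis by blast
    qed
    then show ?thesis
      unfolding is_terminal_def using X(1) by blast
  qed
  moreover have "\<exists>h k. is_pullback \<T> f g h k"
    if f: "f \<in> ar \<T>" and g: "g \<in> ar \<T>" and fg: "tgt \<T> f = tgt \<T> g" for f g
    using T_pullback_exists[OF T.ar_Hom[OF f] T.ar_Hom[OF g, folded fg]] by metis
  ultimately have "has_finite_limits \<T>"
    unfolding has_finite_limits_def by blast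
  moreover have "\<exists>e. is_coequalizer \<T> p q e" if pb: "is_pullback \<T> f f p q" for f p q
  proof -
    have "f \<in> ar \<T>" using pb unfolding is_pullback_def by blast
    then obtain X Y where f: "f \<in> Hom \<T> X Y" using T.ar_Hom by blast
    obtain W where p: "p \<in> Hom \<T> W X" and q: "q \<in> Hom \<T> W X" and eq: "f \<star> p = f \<star> q"
      and surj: "\<And>s x y z. stage s \<Longrightarrow> R s f x z \<Longrightarrow> R s f y z \<Longrightarrow> \<exists>w. R s p w x \<and> R s q w y"
      by (rule T_pullbackD[OF pb f f]) (rule that)
    \<comment> \<open>The coequalizer of the kernel pair of \<open>f\<close> is the surjective part
      of its image factorization: \<open>e\<close> and \<open>f\<close> are the same relation and so
      identify the same elements.\<close>
    obtain I e m where e: "e \<in> Hom \<T> X I" and m: "m \<in> Hom \<T> I Y" and me: "m \<star> e = f"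
      and se: "surjective e I" and Re: "\<And>s x y. stage s \<Longrightarrow> R s e x y \<longleftrightarrow> R s f x y"
      by (rule T_image[OF f]) (rule that)
    have "e \<star> p = e \<star> q"
    proof (rule T_Hom_eqI[OF T_cmp_Hom[OF p e] T_cmp_Hom[OF q e]])
      fix s a y assume s: "stage s" and "R s (e \<star> p) a y"
      then have "R s (f \<star> p) a y"
        using R_cmp[OF p e s] R_cmp[OF p f s] Re[OF s] by blast
      then show "R s (e \<star> q) a y"
        unfolding eq using R_cmp[OF q e s] R_cmp[OF q f s] Re[OF s] by blast
    qed
    then have "is_coequalizer \<T> p q e"
      using surj Re by (intro T_surjective_coequalizer[OF e p q _ se]) blast+
    then show ?thesis by blast
  qed
  moreover have "regular_epi \<T> k" if re: "regular_epi \<T> e" and pb: "is_pullback \<T> e f h k" for e f h k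
  proof -
    have ef: "e \<in> ar \<T>" "f \<in> ar \<T>" "tgt \<T> e = tgt \<T> f"
      using pb unfolding is_pullback_def by blast+
    then obtain X Y Z where e: "e \<in> Hom \<T> X Z" and f: "f \<in> Hom \<T> Y Z"
      using T.ar_Hom by metis
    obtain W where k: "k \<in> Hom \<T> W Y"
      and surj: "\<And>s x y z. stage s \<Longrightarrow> R s e x z \<Longrightarrow> R s f y z \<Longrightarrow> \<exists>w. R s h w x \<and> R s k w y"
      by (rule T_pullbackD[OF pb e f]) (rule that)
    have "\<exists>w. R s k w y" if s: "stage s" and y: "E s Y y y" for s y
    proof -
      obtain z where z: "R s f y z" using R_total[OF f s y] by blast
      then obtain x where "R s e x z"
        using T_regular_epi_surjective[OF e re] R_cod[OF f s] s unfolding surjective_def by blast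
      then show ?thesis using surj[OF s _ z] by blast
    qed
    then show ?thesis
      using T_surjective_regular_epi[OF k] unfolding surjective_def by blast
  qed
  moreover have "\<exists>f. is_pullback \<T> f f r1 r2" if er: "equivalence_relation \<T> r1 r2" for r1 r2
  proof -
    have per: "pseudo_equivalence_relation \<T> r1 r2" and jm: "jointly_monic \<T> r1 r2"
      using er unfolding equivalence_relation_def by blast+
    obtain W X where r1: "r1 \<in> Hom \<T> W X" and r2: "r2 \<in> Hom \<T> W X"
      and refl: "\<exists>d\<in>Hom \<T> X W. r1 \<star> d = ide \<T> X \<and> r2 \<star> d = ide \<T> X"
      and sym: "\<exists>s\<in>Hom \<T> W W. r1 \<star> s = r2 \<and> r2 \<star> s = r1"
      and trans: "\<And>Z u v. u \<in> Hom \<T> Z W \<Longrightarrow> v \<in> Hom \<T> Z W \<Longrightarrow> r2 \<star> u = r1 \<star> v \<Longrightarrow>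
        \<exists>t\<in>Hom \<T> Z W. r1 \<star> t = r1 \<star> u \<and> r2 \<star> t = r2 \<star> v"
      by (rule T.pseudo_equivalence_relationE[OF per]) (rule that)
    note X = T_HomD(2)[OF r1]
    obtain Q q where q: "q \<in> Hom \<T> X Q" and sq: "surjective q Q" and eq: "q \<star> r1 = q \<star> r2"
      and ker: "\<And>s x x' y. stage s \<Longrightarrow> R s q x y \<Longrightarrow> R s q x' y \<Longrightarrow> \<exists>w. R s r1 w x \<and> R s r2 w x'"
    proof (rule T_quotient[OF r1 r2])
      obtain d where d: "d \<in> Hom \<T> X W" "r1 \<star> d = ide \<T> X" "r2 \<star> d = ide \<T> X"
        using refl by blast
      show "\<exists>w. R s r1 w x \<and> R s r2 w x" if s: "stage s" and x: "E s X x x" for s x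
        using R_total[OF d(1) s x] R_cmp_apply[OF d(1) r1 s] R_cmp_apply[OF d(1) r2 s] R_ide[OF X] x d by metis
      obtain i where i: "i \<in> Hom \<T> W W" "r1 \<star> i = r2" "r2 \<star> i = r1"
        using sym by blast
      show "\<exists>w. R s r1 w x' \<and> R s r2 w x" if s: "stage s" and w: "R s r1 w x" "R s r2 w x'" for s w x x'
        using R_total[OF i(1) s R_dom[OF r1 s w(1)]] R_cmp_apply[OF i(1) r1 s] R_cmp_apply[OF i(1) r2 s] w i by metis
      show "\<exists>w. R s r1 w x \<and> R s r2 w x''"
        if s: "stage s" and w: "R s r1 w x" "R s r2 w x'" "R s r1 w' x'" "R s r2 w' x''" for s w w' x x' x''
      proof -
        \<comment> \<open>The pullback of \<open>r2\<close> along \<open>r1\<close> carries the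
          generic chain of two related pairs. Transitivity is applied once there and then read off
          at the given \<open>w\<close> and \<open>w'\<close>.\<close>
        obtain V u v where u: "u \<in> Hom \<T> V W" and v: "v \<in> Hom \<T> V W" and pb: "is_pullback \<T> r2 r1 u v"
          and surj: "\<And>s x y z. stage s \<Longrightarrow> R s r2 x z \<Longrightarrow> R s r1 y z \<Longrightarrow> \<exists>w. R s u w x \<and> R s v w y"
          by (rule T_pullback_exists[OF r2 r1]) (rule that)
        obtain t where t: "t \<in> Hom \<T> V W" "r1 \<star> t = r1 \<star> u" "r2 \<star> t = r2 \<star> v"
          using trans[OF u v] pb unfolding is_pullback_def by blast
        obtain a where a: "R s u a w" "R s v a w'" using surj[OF s w(2,3)] by blast
        obtain b where b: "R s t a b" using R_total[OF t(1) s R_dom[OF u s a(1)]] by blast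
        have "R s r1 b x" "R s r2 b x''"
          using R_commute[OF r1 r1 u t(1) t(2)[symmetric] s a(1) b w(1)]
            R_commute[OF r2 r2 v t(1) t(3)[symmetric] s a(2) b w(4)] by blast+
        then show ?thesis by blast
      qed
    qed (rule that)
    have "is_pullback \<T> q q r1 r2"
    proof (rule T_pullbackI[OF q q r1 r2 eq])
      show "\<exists>w. R s r1 w x \<and> R s r2 w y" if "stage s" "R s q x z" "R s q y z" for s x y z
        using ker that by blast
      show "E s W w w'"
        if "stage s" "R s r1 w x" "R s r2 w y" "R s r1 w' x" "R s r2 w' y" for s x y w w'
        using jm[unfolded jointly_monic_def T.HomD(2)[OF r1]] that
        by (intro T_jointly_monic_inj[OF r1 r2 _ that]) blast
    qed
    then show ?thesis by blast
  qed
  ultimately show ?thesis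
    unfolding exact_category_def regular_category_def using category_T by blast
qed

end


section \<open>Equality and the functor from existential-free predicates\<close>

lemma (in category) pullback_sym: "is_pullback C f g h k \<Longrightarrow> is_pullback C g f k h"
  by (erule pullbackE) (rule pullbackI; force)

context goedel_hyperdoctrine
begin

abbreviation \<delta> where "\<delta> \<equiv> eq_pred P"

section \<open>The equality predicate and Leibniz' law\<close>

lemma eq_pred_preds: "A \<in> ob C \<Longrightarrow> \<delta> A \<in> preds P (prd C A A)"
  unfolding eq_pred_def
  using exq_preds[OF B.pair_Hom[OF B.ide_Hom B.ide_Hom] Ex_adjoint[OF B.HomD(1)[OF B.pair_Hom[OF B.ide_Hom B.ide_Hom]]]
      top_preds] by blast

text \<open>Reflexivity is the unit of the adjunction along the diagonal.\<close>

lemma eq_pred_refl: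
  assumes s: "stage s" and a: "a \<in> el s A"
  shows "Tr s (\<delta> A) (pair C a a)"
proof -
  have A: "A \<in> ob C" using a el_simps by blast
  note d = B.pair_Hom[OF B.ide_Hom[OF A] B.ide_Hom[OF A]]
  have "\<delta> A \<le>[prd C A A] \<delta> A"
    using le_refl[OF B.prd_ob[OF A A] eq_pred_preds[OF A]] .
  then have "\<top>\<^bsub>fib P A\<^esub> \<le>[A] rei P (pair C (ide C A) (ide C A)) (\<delta> A)"
    using exq_le_iff[OF d Ex_adjoint[OF B.HomD(1)[OF d]] top_preds[OF A] eq_pred_preds[OF A]]
    by (simp add: eq_pred_def)
  then have "Tr s (rei P (pair C (ide C A) (ide C A)) (\<delta> A)) a"
    using Tr_le[OF s a top_preds[OF A] rei_preds[OF d eq_pred_preds[OF A]]] Tr_top[OF s a] by blast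
  then show ?thesis
    using Tr_rei[OF a d eq_pred_preds[OF A]] pair_cmp_el[OF a B.ide_Hom[OF A] B.ide_Hom[OF A]]
    by (simp add: ide_el[OF a])
qed

text \<open>Leibniz' law with a parameter: Beck-Chevalley presents the weakening of \<open>\<delta> A\<close> to \<open>(A \<times> A) \<times> B\<close> as
  the existential image of truth along the diagonal in that context.\<close>

lemma leibniz:
  assumes s: "stage s" and a: "a \<in> el s A" and a': "a' \<in> el s A" and b: "b \<in> el s B"
    and \<phi>: "\<phi> \<in> preds P (prd C A B)" and eq: "Tr s (\<delta> A) (pair C a a')" and "Tr s \<phi> (pair C a b)"
  shows "Tr s \<phi> (pair C a' b)"
proof -
  have A: "A \<in> ob C" and B: "B \<in> ob C" using a b el_simps by blast+
  let ?d = "pair C (ide C A) (ide C A)"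
  let ?AAB = "prd C (prd C A A) B"
  let ?k = "pair C (?d \<cdot> pr1 C A B) (pr2 C A B)"
  note d = B.pair_Hom[OF B.ide_Hom[OF A] B.ide_Hom[OF A]]
  note AA = B.prd_ob[OF A A] and AB = B.prd_ob[OF A B]
  note AAB = B.prd_ob[OF AA B] and p = B.pr1_Hom[OF AA B]
  note v = var_Hom[OF A A B]
  have k: "?k \<in> Hom C (prd C A B) ?AAB"
    using d A B by (simp add: Hom_def)
  note s1 = sub2_preds[OF v(1,3) \<phi>] and s2 = sub2_preds[OF v(2,3) \<phi>]
  \<comment> \<open>With the substitution property packed into an implication on the right, the
    adjunction along \<open>?k\<close> applies directly and \<phi> does not have to be carried
    across the quantifier.\<close>
  let ?i = "implication (fib P ?AAB) (sub2 P \<phi> (var1 C A A B) (var3 C A A B)) (sub2 P \<phi> (var2 C A A B) (var3 C A A B))"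
  note i = implication_preds[OF AAB s1 s2]
  have tp: "rei P (pr1 C A B) \<top>\<^bsub>fib P A\<^esub> \<in> preds P (prd C A B)"
    using rei_preds[OF B.pr1_Hom[OF A B] top_preds[OF A]] .
  \<comment> \<open>On the diagonal both variables coincide, so premise and conclusion of
    \<open>?i\<close> become the same predicate, and the reindexed implication is valid.\<close>
  have kv: "rei P ?k (sub2 P \<phi> (var1 C A A B) (var3 C A A B)) = rei P ?k (sub2 P \<phi> (var2 C A A B) (var3 C A A B))"
  proof (rule pred_eqI2[OF A B rei_preds[OF k s1] rei_preds[OF k s2]])
    fix t x y assume t: "stage t" and x: "x \<in> el t A" and y: "y \<in> el t B"
    have "?k \<cdot> pair C x y = pair C (pair C x x) y"
      using d A B x y by (simp add: B.pair_cmp B.assocr el_simps Hom_def)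
    then show "Tr t (rei P ?k (sub2 P \<phi> (var1 C A A B) (var3 C A A B))) (pair C x y) =
        Tr t (rei P ?k (sub2 P \<phi> (var2 C A A B) (var3 C A A B))) (pair C x y)"
      using x y by (simp add: Tr_rei[OF _ k s1] Tr_rei[OF _ k s2] Tr_sub2[OF _ v(1,3) \<phi>] Tr_sub2[OF _ v(2,3) \<phi>] var_pair)
  qed
  have "rei P (pr1 C A B) \<top>\<^bsub>fib P A\<^esub> \<le>[prd C A B] rei P ?k ?i"
    unfolding rei_implication[OF k s1 s2] kv
    using le_implication_iff[OF AB rei_preds[OF k s2] rei_preds[OF k s2] tp]
      le_meet_iff[OF AB tp rei_preds[OF k s2] meet_preds[OF AB tp rei_preds[OF k s2]]]
      le_refl[OF AB meet_preds[OF AB tp rei_preds[OF k s2]]] by blast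
  then have "exq P ?k (rei P (pr1 C A B) \<top>\<^bsub>fib P A\<^esub>) \<le>[?AAB] ?i"
    using exq_le_iff[OF k Ex_adjoint[OF B.HomD(1)[OF k]] tp i] by blast
  \<comment> \<open>The square is transposed here: quantification runs along the diagonal,
    reindexing along the projection.\<close>
  moreover have "exq P ?k (rei P (pr1 C A B) \<top>\<^bsub>fib P A\<^esub>) = rei P (pr1 C (prd C A A) B) (\<delta> A)"
    unfolding eq_pred_def
    using Ex_beck_chevalley[OF B.pullback_sym[OF B.pullback_pr1[OF d B]]] top_preds[OF A] A by simp
  ultimately have le: "rei P (pr1 C (prd C A A) B) (\<delta> A) \<le>[?AAB] ?i"
    by simp
  have w: "pair C (pair C a a') b \<in> el s ?AAB"
    using a a' b by simp
  have "Tr s (rei P (pr1 C (prd C A A) B) (\<delta> A)) (pair C (pair C a a') b)"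
    using Tr_rei[OF w p eq_pred_preds[OF A]] eq pr_pair_el[OF el_pair[OF a a'] b] by simp
  then have "Tr s ?i (pair C (pair C a a') b)"
    using Tr_le[OF s w rei_preds[OF p eq_pred_preds[OF A]] i le] by blast
  moreover have "Tr s (sub2 P \<phi> (var1 C A A B) (var3 C A A B)) (pair C (pair C a a') b)"
    using Tr_sub2[OF w v(1,3) \<phi>] var_pair[OF a a' b] assms(7) by simp
  ultimately have "Tr s (?i \<sqinter>\<^bsub>fib P ?AAB\<^esub> sub2 P \<phi> (var1 C A A B) (var3 C A A B)) (pair C (pair C a a') b)"
    using Tr_meet[OF s w i s1] by blast
  moreover have "?i \<sqinter>\<^bsub>fib P ?AAB\<^esub> sub2 P \<phi> (var1 C A A B) (var3 C A A B) \<le>[?AAB] sub2 P \<phi> (var2 C A A B) (var3 C A A B)"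
    using le_implication_iff[OF AAB s1 s2 i] le_refl[OF AAB i] by blast
  ultimately have "Tr s (sub2 P \<phi> (var2 C A A B) (var3 C A A B)) (pair C (pair C a a') b)"
    using Tr_le[OF s w meet_preds[OF AAB i s1] s2] by blast
  then show ?thesis
    using Tr_sub2[OF w v(2,3) \<phi>] var_pair[OF a a' b] by simp
qed

lemma leibniz_definable:
  assumes s: "stage s" and a: "a \<in> el s A" and a': "a' \<in> el s A" and b: "b \<in> el s B"
    and def: "definable (prd C A B) (\<lambda>s w. S s (pr1 C A B \<cdot> w) (pr2 C A B \<cdot> w))"
    and eq: "Tr s (\<delta> A) (pair C a a')" and S: "S s a b"
  shows "S s a' b"
proof -
  obtain \<phi> where \<phi>: "\<phi> \<in> preds P (prd C A B)" "\<And>s w. stage s \<Longrightarrow> w \<in> el s (prd C A B) \<Longrightarrow>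
      Tr s \<phi> w \<longleftrightarrow> S s (pr1 C A B \<cdot> w) (pr2 C A B \<cdot> w)"
    using def unfolding definable_def by blast
  have *: "Tr s \<phi> (pair C x b) \<longleftrightarrow> S s x b" if "x \<in> el s A" for x
    using \<phi>(2)[OF s el_pair[OF that b]] pr_pair_el[OF that b] by simp
  show ?thesis
    using leibniz[OF s a a' b \<phi>(1) eq] *[OF a] *[OF a'] S by blast
qed

text \<open>Leibniz' law for \<delta> itself with second argument \<open>a\<close>, starting from
  reflexivity at \<open>a\<close>.\<close>

lemma eq_pred_sym:
  assumes s: "stage s" and a: "a \<in> el s A" and b: "b \<in> el s A" and "Tr s (\<delta> A) (pair C a b)"
  shows "Tr s (\<delta> A) (pair C b a)"
  using leibniz[OF s a b a eq_pred_preds assms(4)] eq_pred_refl[OF s a] el_simps(4)[OF a] by blast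

text \<open>In the equality of \<open>b\<close> and \<open>c\<close>, Leibniz' law replaces
  \<open>b\<close> by \<open>a\<close>, along the reversed first equality.\<close>

lemma eq_pred_trans:
  assumes s: "stage s" and a: "a \<in> el s A" and b: "b \<in> el s A" and c: "c \<in> el s A"
    and "Tr s (\<delta> A) (pair C a b)" "Tr s (\<delta> A) (pair C b c)"
  shows "Tr s (\<delta> A) (pair C a c)"
  using leibniz[OF s b a c eq_pred_preds eq_pred_sym[OF s a b]] assms(5,6) el_simps(4)[OF a] by blast

lemma leibniz1:
  assumes s: "stage s" and a: "a \<in> el s A" and b: "b \<in> el s A" and \<phi>: "\<phi> \<in> preds P A"
    and eq: "Tr s (\<delta> A) (pair C a b)" and "Tr s \<phi> a"
  shows "Tr s \<phi> b"
proof -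
  have A: "A \<in> ob C" using a el_simps by blast
  have "definable (prd C A A) (\<lambda>s w. Tr s \<phi> (pr1 C A A \<cdot> w))"
    using A by (intro definable_Tr[OF \<phi>] trm_pr1 trm_id B.prd_ob)
  then show ?thesis
    using leibniz_definable[OF s a b a, where S = "\<lambda>s x y. Tr s \<phi> x"] eq assms(6) by blast
qed

text \<open>Leibniz' law moves \<open>x\<close> from \<open>a\<close> to \<open>b\<close> in the
  equality of \<open>f \<cdot> x\<close> and \<open>f \<cdot> a\<close>; the result comes out
  reversed, hence the final use of symmetry.\<close>

lemma eq_pred_cong:
  assumes s: "stage s" and a: "a \<in> el s A" and b: "b \<in> el s A" and f: "f \<in> Hom C A B"
    and eq: "Tr s (\<delta> A) (pair C a b)"
  shows "Tr s (\<delta> B) (pair C (f \<cdot> a) (f \<cdot> b))"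
proof -
  note A = B.HomD(4)[OF f] and B = B.HomD(5)[OF f]
  have "definable (prd C A A) (\<lambda>s w. Tr s (\<delta> B) (pair C (f \<cdot> (pr1 C A A \<cdot> w)) (f \<cdot> (pr2 C A A \<cdot> w))))"
    using A by (intro definable_intros definable_Tr2[OF eq_pred_preds[OF B]] trm_cmp[OF f])
  then have "Tr s (\<delta> B) (pair C (f \<cdot> b) (f \<cdot> a))"
    using leibniz_definable[OF s a b a, where S = "\<lambda>s x y. Tr s (\<delta> B) (pair C (f \<cdot> x) (f \<cdot> y))"]
      eq eq_pred_refl[OF s el_cmp[OF a f]] by blast
  then show ?thesis
    using eq_pred_sym[OF s el_cmp[OF b f] el_cmp[OF a f]] by blast
qed

section \<open>Change of stage and the functor from existential-free predicates\<close>

lemma E_mono: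
  assumes s: "stage s" and t: "stage t" and X: "X \<in> ob \<T>" and h: "h \<in> el t (fst s)" "Tr t (snd s) h"
    and E: "E s X a b"
  shows "E t X (a \<cdot> h) (b \<cdot> h)"
proof -
  have ab: "a \<in> el s (fst X)" "b \<in> el s (fst X)" "Tr s (snd X) (pair C a b)"
    using E unfolding E_def by auto
  have "a \<cdot> h \<in> el t (fst X)" "b \<cdot> h \<in> el t (fst X)"
    using el_cmp[OF h(1)] ab unfolding el_def[of s] by blast+
  moreover have "pair C a b \<cdot> h = pair C (a \<cdot> h) (b \<cdot> h)"
    using pair_cmp_el[OF h(1)] ab(1,2) unfolding el_def[of s] by blast
  ultimately show ?thesis
    using Tr_mono[OF s t el_pair[OF ab(1,2)] T_obD(2)[OF X] h ab(3)] unfolding E_def by simp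
qed

lemma R_mono:
  assumes s: "stage s" and t: "stage t" and f: "f \<in> Hom \<T> X Y" and h: "h \<in> el t (fst s)" "Tr t (snd s) h"
    and R: "R s f a b"
  shows "R t f (a \<cdot> h) (b \<cdot> h)"
proof -
  note el = R_el[OF f R]
  have el': "a \<cdot> h \<in> el t (fst X)" "b \<cdot> h \<in> el t (fst Y)"
    using el_cmp[OF h(1)] el unfolding el_def[of s] by blast+
  have "pair C a b \<cdot> h = pair C (a \<cdot> h) (b \<cdot> h)"
    using pair_cmp_el[OF h(1)] el unfolding el_def[of s] by blast
  then show ?thesis
    using Tr_mono[OF s t el_pair[OF el] T_Hom_pred[OF f] h] R R_iff_Tr[OF f el] R_iff_Tr[OF f el'] by simp
qed

text \<open>Only \<open>a\<close> is asked to satisfy the predicate, since Leibniz' law transfers it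
  to \<open>b\<close>. The choice is needed because \<open>T_obI\<close> describes its object by
  \<open>E\<close> alone.\<close>

definition Jo :: "('o, 'p) pred_ob \<Rightarrow> ('o, 'p) per_ob" where
  "Jo X = (SOME Z. Z \<in> ob \<T> \<and> fst Z = fst X \<and> (\<forall>s a b. stage s \<longrightarrow>
    E s Z a b = (a \<in> el s (fst X) \<and> b \<in> el s (fst X) \<and> Tr s (snd X) a \<and> Tr s (\<delta> (fst X)) (pair C a b))))"

lemma
  assumes X: "stage X"
  shows Jo_ob: "Jo X \<in> ob \<T>" and fst_Jo: "fst (Jo X) = fst X"
    and E_Jo: "stage s \<Longrightarrow> E s (Jo X) a b \<longleftrightarrow>
      a \<in> el s (fst X) \<and> b \<in> el s (fst X) \<and> Tr s (snd X) a \<and> Tr s (\<delta> (fst X)) (pair C a b)"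
proof -
  let ?A = "fst X"
  note A = stageD(1)[OF X] and \<alpha> = stageD(2)[OF X]
  have "\<exists>Z\<in>ob \<T>. fst Z = ?A \<and> (\<forall>s a b. stage s \<longrightarrow>
    E s Z a b = (a \<in> el s ?A \<and> b \<in> el s ?A \<and> Tr s (snd X) a \<and> Tr s (\<delta> ?A) (pair C a b)))"
  proof (rule T_obI[OF A])
    show "definable (prd C ?A ?A) (\<lambda>s w. Tr s (snd X) (pr1 C ?A ?A \<cdot> w) \<and>
        Tr s (\<delta> ?A) (pair C (pr1 C ?A ?A \<cdot> w) (pr2 C ?A ?A \<cdot> w)))"
      using A by (intro definable_intros definable_Tr[OF \<alpha>] definable_Tr2[OF eq_pred_preds[OF A]])
    fix s a b assume s: "stage s" and a: "a \<in> el s ?A" and b: "b \<in> el s ?A"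
      and ab: "Tr s (snd X) a \<and> Tr s (\<delta> ?A) (pair C a b)"
    show "Tr s (snd X) b \<and> Tr s (\<delta> ?A) (pair C b a)"
      using leibniz1[OF s a b \<alpha>] eq_pred_sym[OF s a b] ab by blast
    show "Tr s (snd X) a \<and> Tr s (\<delta> ?A) (pair C a c)"
      if "c \<in> el s ?A" "Tr s (snd X) b \<and> Tr s (\<delta> ?A) (pair C b c)" for c
      using eq_pred_trans[OF s a b that(1)] ab that(2) by blast
  qed
  then have "Jo X \<in> ob \<T> \<and> fst (Jo X) = ?A \<and> (\<forall>s a b. stage s \<longrightarrow>
    E s (Jo X) a b = (a \<in> el s ?A \<and> b \<in> el s ?A \<and> Tr s (snd X) a \<and> Tr s (\<delta> ?A) (pair C a b)))"
    unfolding Jo_def Bex_def by (rule someI_ex)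
  then show "Jo X \<in> ob \<T>" "fst (Jo X) = fst X" "stage s \<Longrightarrow> E s (Jo X) a b \<longleftrightarrow>
      a \<in> el s (fst X) \<and> b \<in> el s (fst X) \<and> Tr s (snd X) a \<and> Tr s (\<delta> (fst X)) (pair C a b)"
    by blast+
qed

lemma E_Jo_refl:
  assumes "stage X" "stage s"
  shows "E s (Jo X) a a \<longleftrightarrow> a \<in> el s (fst X) \<and> Tr s (snd X) a"
  using E_Jo[OF assms] eq_pred_refl[OF assms(2)] by blast

lemma pred_maps_iff: "f \<in> pred_maps P X Y \<longleftrightarrow> f \<in> Hom C (fst X) (fst Y) \<and> snd X \<le>[fst X] rei P f (snd Y)"
  by (cases X; cases Y) simp

lemma pred_eq_iff: "(f, g) \<in> pred_eq P X Y \<longleftrightarrow> f \<in> pred_maps P X Y \<and> g \<in> pred_maps P X Y \<and>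
    snd X \<le>[fst X] sub2 P (\<delta> (fst Y)) f g"
  by (cases X; cases Y) simp

definition J_map :: "('o, 'p) pred_ob \<Rightarrow> ('o, 'p) pred_ob \<Rightarrow> 'm \<Rightarrow> ('o, 'p) per_ar" where
  "J_map X Y f = (SOME h. h \<in> Hom \<T> (Jo X) (Jo Y) \<and>
    (\<forall>s a b. stage s \<longrightarrow> R s h a b = (E s (Jo X) a a \<and> E s (Jo Y) (f \<cdot> a) b)))"

lemma pred_maps_Tr:
  assumes X: "stage X" and Y: "stage Y" and f: "f \<in> pred_maps P X Y" and s: "stage s"
    and a: "a \<in> el s (fst X)" "Tr s (snd X) a"
  shows "Tr s (snd Y) (f \<cdot> a)"
proof -
  have f: "f \<in> Hom C (fst X) (fst Y)" "snd X \<le>[fst X] rei P f (snd Y)"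
    using f unfolding pred_maps_iff by auto
  show ?thesis
    using Tr_le[OF s a(1) stageD(2)[OF X] rei_preds[OF f(1) stageD(2)[OF Y]] f(2) a(2)]
      Tr_rei[OF a(1) f(1) stageD(2)[OF Y]] by blast
qed

lemma
  assumes X: "stage X" and Y: "stage Y" and f: "f \<in> pred_maps P X Y"
  shows J_map_Hom: "J_map X Y f \<in> Hom \<T> (Jo X) (Jo Y)"
    and R_J_map: "stage s \<Longrightarrow> R s (J_map X Y f) a b \<longleftrightarrow> E s (Jo X) a a \<and> E s (Jo Y) (f \<cdot> a) b"
proof -
  have f': "f \<in> Hom C (fst X) (fst Y)"
    using f unfolding pred_maps_iff by auto
  have "\<exists>h\<in>Hom \<T> (Jo X) (Jo Y). \<forall>s a b. stage s \<longrightarrow> R s h a b = (E s (Jo X) a a \<and> E s (Jo Y) (f \<cdot> a) b)"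
  proof (rule T_Hom_of_arrow[OF Jo_ob[OF X] Jo_ob[OF Y]])
    show "f \<in> Hom C (fst (Jo X)) (fst (Jo Y))"
      using f' fst_Jo X Y by simp
    fix s a a' assume s: "stage s" and "E s (Jo X) a a'"
    then have *: "a \<in> el s (fst X)" "a' \<in> el s (fst X)" "Tr s (snd X) a" "Tr s (\<delta> (fst X)) (pair C a a')"
      using E_Jo[OF X s] by blast+
    show "E s (Jo Y) (f \<cdot> a) (f \<cdot> a')"
      unfolding E_Jo[OF Y s]
      using el_cmp[OF *(1) f'] el_cmp[OF *(2) f'] pred_maps_Tr[OF X Y f s *(1,3)] eq_pred_cong[OF s *(1,2) f' *(4)]
      by blast
  qed
  then have "J_map X Y f \<in> Hom \<T> (Jo X) (Jo Y) \<and>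
    (\<forall>s a b. stage s \<longrightarrow> R s (J_map X Y f) a b = (E s (Jo X) a a \<and> E s (Jo Y) (f \<cdot> a) b))"
    unfolding J_map_def Bex_def by (rule someI_ex)
  then show "J_map X Y f \<in> Hom \<T> (Jo X) (Jo Y)"
    "stage s \<Longrightarrow> R s (J_map X Y f) a b \<longleftrightarrow> E s (Jo X) a a \<and> E s (Jo Y) (f \<cdot> a) b"
    by blast+
qed

text \<open>The predicate of \<open>X\<close> holds tautologically of the identity at the stage
  \<open>X\<close> itself; this is the generic element.\<close>

lemma Jo_generic: "stage X \<Longrightarrow> E X (Jo X) (ide C (fst X)) (ide C (fst X))"
  using E_Jo_refl stage_el_ide stage_Tr_ide by blast

lemma ide_cmp_el: "a \<in> el s A \<Longrightarrow> a \<cdot> ide C (fst s) = a"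
  unfolding el_def by (rule B.cmp_ide_right)

text \<open>The existential-free predicate \<open>X\<close> is itself a stage, so an arrow out of \<open>Jo X\<close> is determined by its
  value at the generic element, the identity; this gives both fullness of \<open>J\<close> and projectivity of \<open>Jo X\<close>.\<close>

lemma J_full:
  assumes X: "stage X" and Y: "stage Y" and h: "h \<in> Hom \<T> (Jo X) (Jo Y)"
  shows "\<exists>f\<in>pred_maps P X Y. J_map X Y f = h"
proof -
  \<comment> \<open>The value of \<open>h\<close> at the generic element is an element of the
    carrier of \<open>Jo Y\<close> at stage \<open>X\<close>, that is, an arrow of the base.\<close>
  obtain f where f: "R X h (ide C (fst X)) f"
    using R_total[OF h X Jo_generic[OF X]] by blast
  have fY: "E X (Jo Y) f f" using R_cod[OF h X f] .
  then have f': "f \<in> Hom C (fst X) (fst Y)" "snd X \<le>[fst X] rei P f (snd Y)"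
    unfolding E_Jo_refl[OF Y X] unfolding el_def Tr_def by auto
  then have fm: "f \<in> pred_maps P X Y"
    unfolding pred_maps_iff by blast
  have "J_map X Y f = h"
  proof (rule T_Hom_eqI[OF J_map_Hom[OF X Y fm] h])
    fix s a b assume s: "stage s" and "R s (J_map X Y f) a b"
    then have a: "a \<in> el s (fst X)" "Tr s (snd X) a" and b: "E s (Jo Y) (f \<cdot> a) b"
      using R_J_map[OF X Y fm s] E_Jo_refl[OF X s] by blast+
    \<comment> \<open>An element \<open>a\<close> satisfying the predicate of \<open>X\<close> is a
      change of stage from \<open>s\<close> to \<open>X\<close>, along which the generic value
      specializes.\<close>
    have "R s h (ide C (fst X) \<cdot> a) (f \<cdot> a)"
      using R_mono[OF X s h a f] .
    then show "R s h a b"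
      using R_cong2[OF h s b] ide_el[OF a(1)] by simp
  qed
  then show ?thesis using fm by blast
qed

text \<open>Provable equality is instantiated at each element to compare the two graphs. Conversely
  the graphs are compared at the generic element, where truth of equality of \<open>f\<close> and
  \<open>g\<close> is literally the entailment in \<open>pred_eq\<close>.\<close>

lemma J_kernel:
  assumes X: "stage X" and Y: "stage Y"
  shows "pred_eq P X Y = {(f, g). f \<in> pred_maps P X Y \<and> g \<in> pred_maps P X Y \<and> J_map X Y f = J_map X Y g}"
proof -
  have "snd X \<le>[fst X] sub2 P (\<delta> (fst Y)) f g \<longleftrightarrow> J_map X Y f = J_map X Y g"
    if f: "f \<in> pred_maps P X Y" and g: "g \<in> pred_maps P X Y" for f g
  proof -
    note A = stageD(1)[OF X] and B = stageD(1)[OF Y]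
    have f': "f \<in> Hom C (fst X) (fst Y)" and g': "g \<in> Hom C (fst X) (fst Y)"
      using f g unfolding pred_maps_iff by auto
    have fg: "f \<in> el X (fst Y)" "g \<in> el X (fst Y)"
      using f' g' unfolding el_def by auto
    note \<delta>B = eq_pred_preds[OF B]
    show ?thesis
    proof
      assume le: "snd X \<le>[fst X] sub2 P (\<delta> (fst Y)) f g"
      show "J_map X Y f = J_map X Y g"
      proof (rule T_Hom_eqI[OF J_map_Hom[OF X Y f] J_map_Hom[OF X Y g]])
        fix s a b assume s: "stage s" and "R s (J_map X Y f) a b"
        then have a: "E s (Jo X) a a" "a \<in> el s (fst X)" "Tr s (snd X) a" and b: "E s (Jo Y) (f \<cdot> a) b"
          using R_J_map[OF X Y f s] E_Jo_refl[OF X s] by blast+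
        have "Tr s (\<delta> (fst Y)) (pair C (f \<cdot> a) (g \<cdot> a))"
          using Tr_le[OF s a(2) stageD(2)[OF X] sub2_preds[OF f' g' \<delta>B] le a(3)] Tr_sub2[OF a(2) f' g' \<delta>B] by blast
        then have "E s (Jo Y) (f \<cdot> a) (g \<cdot> a)"
          using E_Jo[OF Y s] el_cmp[OF a(2) f'] el_cmp[OF a(2) g'] pred_maps_Tr[OF X Y f s a(2,3)] by blast
        then have "E s (Jo Y) (g \<cdot> a) b"
          using b E_sym[OF Jo_ob[OF Y] s] E_trans[OF Jo_ob[OF Y] s] by blast
        then show "R s (J_map X Y g) a b"
          using R_J_map[OF X Y g s] a(1) by blast
      qed
    next
      assume eq: "J_map X Y f = J_map X Y g"
      have "E X (Jo Y) f f"
        unfolding E_Jo_refl[OF Y X] using fg(1) f unfolding pred_maps_iff Tr_def by blast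
      then have "R X (J_map X Y f) (ide C (fst X)) f"
        using R_J_map[OF X Y f X] Jo_generic[OF X] ide_cmp_el[OF fg(1)] by simp
      then have "E X (Jo Y) g f"
        unfolding eq using R_J_map[OF X Y g X] ide_cmp_el[OF fg(2)] by simp
      then have "Tr X (\<delta> (fst Y)) (pair C f g)"
        using E_Jo[OF Y X] eq_pred_sym[OF X] by blast
      then show "snd X \<le>[fst X] sub2 P (\<delta> (fst Y)) f g"
        unfolding Tr_def sub2_def .
    qed
  qed
  then show ?thesis
    using pred_eq_iff by blast
qed

text \<open>The congruence on \<open>Pred_existential_free\<close> is the kernel of
  \<open>J_map\<close>, so its category laws and the full and faithful functor to the topos come
  from the general construction.\<close>

sublocale J: quotient_presentation \<T> "{X. stage X}" "pred_maps P" "pred_eq P" "\<lambda>X. ide C (fst X)"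
  "\<lambda>g f. g \<cdot> f" Jo J_map
proof
  show "ide C (fst X) \<in> pred_maps P X X" if "X \<in> {X. stage X}" for X
    using that stageD[of X] B.ide_Hom le_refl rei_ide by (simp add: pred_maps_iff)
  show "J_map X X (ide C (fst X)) = ide \<T> (Jo X)" if "X \<in> {X. stage X}" for X
  proof -
    have X: "stage X" using that by simp
    have i: "ide C (fst X) \<in> pred_maps P X X"
      using stageD[OF X] B.ide_Hom le_refl rei_ide by (simp add: pred_maps_iff)
    show ?thesis
    proof (rule T_Hom_eqI[OF J_map_Hom[OF X X i] T_ide_Hom[OF Jo_ob[OF X]]])
      fix s a b assume s: "stage s" and "R s (J_map X X (ide C (fst X))) a b"
      then have "E s (Jo X) a a" "E s (Jo X) (ide C (fst X) \<cdot> a) b"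
        using R_J_map[OF X X i s] by blast+
      then show "R s (ide \<T> (Jo X)) a b"
        using R_ide[OF Jo_ob[OF X]] ide_el E_Jo_refl[OF X s] by metis
    qed
  qed
  fix X Y Z f g
  assume "X \<in> {X. stage X}" "Y \<in> {X. stage X}" "Z \<in> {X. stage X}"
    and f: "f \<in> pred_maps P X Y" and g: "g \<in> pred_maps P Y Z"
  then have X: "stage X" and Y: "stage Y" and Z: "stage Z" by auto
  have f': "f \<in> Hom C (fst X) (fst Y)" and g': "g \<in> Hom C (fst Y) (fst Z)"
    using f g unfolding pred_maps_iff by auto
  \<comment> \<open>Evaluated at the generic element, truth of \<open>snd Z\<close> is the
    entailment required of an arrow of predicates.\<close>
  have "Tr X (snd Z) (g \<cdot> (f \<cdot> ide C (fst X)))"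
    using pred_maps_Tr[OF Y Z g X] pred_maps_Tr[OF X Y f X stage_el_ide[OF X] stage_Tr_ide[OF X]]
      el_cmp[OF stage_el_ide[OF X] f'] by blast
  then show c: "g \<cdot> f \<in> pred_maps P X Z"
    unfolding pred_maps_iff Tr_def using B.cmp_Hom[OF f' g'] B.cmp_ide_right[OF f'] by simp
  show "J_map X Z (g \<cdot> f) = J_map Y Z g \<star> J_map X Y f"
  proof (rule T_Hom_eqI[OF J_map_Hom[OF X Z c] T_cmp_Hom[OF J_map_Hom[OF X Y f] J_map_Hom[OF Y Z g]]])
    fix s a b assume s: "stage s" and "R s (J_map X Z (g \<cdot> f)) a b"
    then have a: "E s (Jo X) a a" "a \<in> el s (fst X)" "Tr s (snd X) a" and b: "E s (Jo Z) ((g \<cdot> f) \<cdot> a) b"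
      using R_J_map[OF X Z c s] E_Jo_refl[OF X s] by blast+
    have fa: "E s (Jo Y) (f \<cdot> a) (f \<cdot> a)"
      using E_Jo_refl[OF Y s] el_cmp[OF a(2) f'] pred_maps_Tr[OF X Y f s a(2,3)] by blast
    then have "R s (J_map X Y f) a (f \<cdot> a)" "R s (J_map Y Z g) (f \<cdot> a) b"
      using R_J_map[OF X Y f s] R_J_map[OF Y Z g s] a(1) b cmp_assoc_el[OF a(2) f' g'] by auto
    then show "R s (J_map Y Z g \<star> J_map X Y f) a b"
      using R_cmp[OF J_map_Hom[OF X Y f] J_map_Hom[OF Y Z g] s] by blast
  qed
qed (use Jo_ob J_map_Hom J_full J_kernel in blast)+

lemma Pred_eq: "Pred_existential_free P = J.Q"
  by (simp add: Pred_existential_free_def quot_cat_def Let_def stage_def case_prod_unfold)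

text \<open>Let \<open>z\<close> be the value of \<open>u\<close> at the generic element.
  Surjectivity at the stage \<open>X\<close> gives a preimage \<open>y\<close>, which is a base
  arrow, and \<open>h\<close> is its graph. The choice is made once, generically, and
  \<open>R_mono\<close> spreads it to all elements.\<close>

lemma J_projective:
  assumes X: "stage X" and p: "p \<in> Hom \<T> Y Z" and surj: "surjective p Z" and u: "u \<in> Hom \<T> (Jo X) Z"
  shows "\<exists>h\<in>Hom \<T> (Jo X) Y. p \<star> h = u"
proof -
  note Y = T_HomD(1)[OF p] and A = stageD(1)[OF X]
  obtain z where z: "R X u (ide C (fst X)) z"
    using R_total[OF u X Jo_generic[OF X]] by blast
  obtain y where y: "R X p y z"
    using surj X R_cod[OF u X z] unfolding surjective_def by blast
  have y': "y \<in> Hom C (fst X) (fst Y)"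
    using R_el(1)[OF p y] unfolding el_def .
  have "\<exists>h\<in>Hom \<T> (Jo X) Y. \<forall>s a b. stage s \<longrightarrow> R s h a b = (E s (Jo X) a a \<and> E s Y (y \<cdot> a) b)"
  proof (rule T_Hom_of_arrow[OF Jo_ob[OF X] Y])
    show "y \<in> Hom C (fst (Jo X)) (fst Y)" using y' fst_Jo[OF X] by simp
    fix s a a' assume s: "stage s" and "E s (Jo X) a a'"
    then have *: "a \<in> el s (fst X)" "a' \<in> el s (fst X)" "Tr s (snd X) a" "Tr s (\<delta> (fst X)) (pair C a a')"
      using E_Jo[OF X s] by blast+
    have "E s Y (y \<cdot> a) (y \<cdot> a)"
      using E_mono[OF X s Y *(1,3) R_dom[OF p X y]] .
    \<comment> \<open>That \<open>y\<close> sends equal elements to related ones follows from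
      Leibniz' law, since relatedness of the images is definable.\<close>
    moreover have "definable (prd C (fst X) (fst X)) (\<lambda>s w.
        E s Y (y \<cdot> (pr1 C (fst X) (fst X) \<cdot> w)) (y \<cdot> (pr2 C (fst X) (fst X) \<cdot> w)))"
      using A by (intro definable_intros definable_E[OF Y] trm_cmp[OF y'])
    ultimately have "E s Y (y \<cdot> a') (y \<cdot> a)"
      using leibniz_definable[OF s *(1,2,1), where S = "\<lambda>s x b. E s Y (y \<cdot> x) (y \<cdot> b)"] *(4) by blast
    then show "E s Y (y \<cdot> a) (y \<cdot> a')"
      using E_sym[OF Y s] by blast
  qed
  then obtain h where h: "h \<in> Hom \<T> (Jo X) Y"
    and Rh: "\<And>s a b. stage s \<Longrightarrow> R s h a b = (E s (Jo X) a a \<and> E s Y (y \<cdot> a) b)"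
    by blast
  have "p \<star> h = u"
  proof (rule T_Hom_eqI[OF T_cmp_Hom[OF h p] u])
    fix s a c assume s: "stage s" and "R s (p \<star> h) a c"
    then obtain b where b: "R s h a b" "R s p b c" using R_cmp[OF h p s] by blast
    then have a: "a \<in> el s (fst X)" "Tr s (snd X) a" and yb: "E s Y (y \<cdot> a) b"
      using Rh[OF s] E_Jo_refl[OF X s] by blast+
    have "R s p (y \<cdot> a) (z \<cdot> a)"
      using R_mono[OF X s p a y] .
    then have "R s p b (z \<cdot> a)"
      using R_cong1[OF p s yb] by blast
    then have zc: "E s Z (z \<cdot> a) c"
      using R_single[OF p s] b(2) by blast
    have "R s u (ide C (fst X) \<cdot> a) (z \<cdot> a)"
      using R_mono[OF X s u a z] .
    then show "R s u a c"
      using R_cong2[OF u s zc] ide_el[OF a(1)] by simp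
  qed
  then show ?thesis using h by blast
qed

text \<open>The extent of \<open>Z\<close> is the existential of an existential-free \<epsilon> over
  \<open>A x B\<close>. The first projection covers \<open>Z\<close> by the stage
  \<open>(A x B, \<epsilon>)\<close>, as witnesses \<open>b\<close> exist exactly over the elements
  of the extent.\<close>

lemma J_cover:
  assumes Z: "Z \<in> ob \<T>"
  shows "\<exists>X p. stage X \<and> p \<in> Hom \<T> (Jo X) Z \<and> surjective p Z"
proof -
  let ?A = "fst Z"
  note A = T_obD(1)[OF Z] and \<rho> = T_obD(2)[OF Z]
  note i = B.ide_Hom[OF A]
  obtain B \<epsilon> where B: "B \<in> ob C" and \<epsilon>: "existential_free P (prd C ?A B) \<epsilon>"
    and eq: "sub2 P (snd Z) (ide C ?A) (ide C ?A) = exq P (pr1 C ?A B) \<epsilon>"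
    using enough[OF A sub2_preds[OF i i \<rho>]] by blast
  let ?X = "(prd C ?A B, \<epsilon>)"
  have X: "stage ?X"
    unfolding stage_def using B.prd_ob[OF A B] \<epsilon> by simp
  have \<epsilon>': "\<epsilon> \<in> preds P (prd C ?A B)"
    using stageD(2)[OF X] by simp
  note p = B.pr1_Hom[OF A B]
  have ex: "E s Z a a \<longleftrightarrow> a \<in> el s ?A \<and> (\<exists>b\<in>el s B. Tr s \<epsilon> (pair C a b))" if s: "stage s" for s a
  proof (cases "a \<in> el s ?A")
    case True
    then show ?thesis
      using Tr_exq[OF s True B \<epsilon>'] Tr_sub2[OF True i i \<rho>] unfolding eq[symmetric] E_def by (simp add: ide_el)
  qed (simp add: E_def)
  have "\<exists>f\<in>Hom \<T> (Jo ?X) Z. \<forall>s w a. stage s \<longrightarrow> R s f w a = (E s (Jo ?X) w w \<and> E s Z (pr1 C ?A B \<cdot> w) a)"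
  proof (rule T_Hom_of_arrow[OF Jo_ob[OF X] Z])
    show "pr1 C ?A B \<in> Hom C (fst (Jo ?X)) ?A" using p fst_Jo[OF X] by simp
    fix s w w' assume s: "stage s" and "E s (Jo ?X) w w'"
    then have *: "w \<in> el s (prd C ?A B)" "w' \<in> el s (prd C ?A B)" "Tr s \<epsilon> w" "Tr s (\<delta> (prd C ?A B)) (pair C w w')"
      using E_Jo[OF X s] by auto
    let ?AB = "prd C ?A B"
    have "pair C (pr1 C ?A B \<cdot> w) (pr2 C ?A B \<cdot> w) = w"
      using pair_eta_el[OF *(1) A B] .
    then have "E s Z (pr1 C ?A B \<cdot> w) (pr1 C ?A B \<cdot> w)"
      using ex[OF s] *(3) el_pr[OF *(1) A B] by metis
    moreover have "definable (prd C ?AB ?AB) (\<lambda>s v.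
        E s Z (pr1 C ?A B \<cdot> (pr1 C ?AB ?AB \<cdot> v)) (pr1 C ?A B \<cdot> (pr2 C ?AB ?AB \<cdot> v)))"
      using A B by (intro definable_intros definable_E[OF Z])
    ultimately have "E s Z (pr1 C ?A B \<cdot> w') (pr1 C ?A B \<cdot> w)"
      using leibniz_definable[OF s *(1,2,1),
          where S = "\<lambda>s x b. E s Z (pr1 C ?A B \<cdot> x) (pr1 C ?A B \<cdot> b)"] *(4) by blast
    then show "E s Z (pr1 C ?A B \<cdot> w) (pr1 C ?A B \<cdot> w')"
      using E_sym[OF Z s] by blast
  qed
  then obtain f where f: "f \<in> Hom \<T> (Jo ?X) Z"
    and Rf: "\<And>s w a. stage s \<Longrightarrow> R s f w a = (E s (Jo ?X) w w \<and> E s Z (pr1 C ?A B \<cdot> w) a)"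
    by blast
  have "\<exists>w. R s f w a" if s: "stage s" and a: "E s Z a a" for s a
  proof -
    obtain b where b: "a \<in> el s ?A" "b \<in> el s B" "Tr s \<epsilon> (pair C a b)"
      using ex[OF s] a by blast
    have "E s (Jo ?X) (pair C a b) (pair C a b)"
      unfolding E_Jo_refl[OF X s] using b by simp
    then have "R s f (pair C a b) a"
      unfolding Rf[OF s] using a pr_pair_el[OF b(1,2)] by simp
    then show ?thesis by blast
  qed
  then show ?thesis
    using X f unfolding surjective_def by blast
qed

sublocale J: ff_functor "Pred_existential_free P" \<T> Jo J.Ga
  unfolding Pred_eq by (rule J.ff_functor_Q)

lemma Pred_ob: "X \<in> ob (Pred_existential_free P) \<longleftrightarrow> stage X"
  unfolding Pred_eq by (simp add: quot_cat_def)

text \<open>In the clause \<open>quotient\<close>, transitivity of the given relation is tested only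
  on objects of \<open>Pred_existential_free\<close>, so a pullback formed in the topos must be
  covered by some \<open>Jo N\<close> before it can be applied.\<close>

sublocale J: projective_cover "Pred_existential_free P" \<T> Jo J.Ga
proof
  show "exact_category \<T>" by (rule exact_T)
  show proj: "\<exists>h\<in>Hom \<T> (Jo X) Y. p \<star> h = u"
    if "X \<in> ob (Pred_existential_free P)" "p \<in> Hom \<T> Y Z" "regular_epi \<T> p" "u \<in> Hom \<T> (Jo X) Z" for X Y Z p u
    using J_projective[OF _ that(2) T_regular_epi_surjective[OF that(2,3)] that(4)] that(1) Pred_ob by blast
  show cov: "\<exists>X\<in>ob (Pred_existential_free P). \<exists>p\<in>Hom \<T> (Jo X) Z. regular_epi \<T> p" if "Z \<in> ob \<T>" for Z
    using J_cover[OF that] T_surjective_regular_epi Pred_ob by blast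
  let ?D = "Pred_existential_free P"
  fix r1 r2 A B
  assume per: "pseudo_equivalence_relation ?D r1 r2" and r1: "r1 \<in> Hom ?D A B" and r2: "r2 \<in> Hom ?D A B"
  note j1 = J.F_Hom[OF r1] and j2 = J.F_Hom[OF r2]
  have eqs: "src ?D r1 = A" "tgt ?D r1 = B"
    using J.S.HomD[OF r1] by auto
  have refl: "\<exists>d\<in>Hom ?D B A. r1 \<odot>\<^bsub>?D\<^esub> d = ide ?D B \<and> r2 \<odot>\<^bsub>?D\<^esub> d = ide ?D B"
    and sym: "\<exists>s\<in>Hom ?D A A. r1 \<odot>\<^bsub>?D\<^esub> s = r2 \<and> r2 \<odot>\<^bsub>?D\<^esub> s = r1"
    and trans: "\<And>Z u v. u \<in> Hom ?D Z A \<Longrightarrow> v \<in> Hom ?D Z A \<Longrightarrow> r2 \<odot>\<^bsub>?D\<^esub> u = r1 \<odot>\<^bsub>?D\<^esub> v \<Longrightarrow>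
        \<exists>t\<in>Hom ?D Z A. r1 \<odot>\<^bsub>?D\<^esub> t = r1 \<odot>\<^bsub>?D\<^esub> u \<and> r2 \<odot>\<^bsub>?D\<^esub> t = r2 \<odot>\<^bsub>?D\<^esub> v"
    using per unfolding pseudo_equivalence_relation_def Let_def eqs by blast+
  have B: "B \<in> ob ?D" and A: "A \<in> ob ?D"
    using J.S.HomD[OF r1] by auto
  obtain Q q where q: "q \<in> Hom \<T> (Jo B) Q" and sq: "surjective q Q"
    and eq: "q \<star> J.Ga r1 = q \<star> J.Ga r2"
    and ker: "\<And>s x x' y. stage s \<Longrightarrow> R s q x y \<Longrightarrow> R s q x' y \<Longrightarrow> \<exists>w. R s (J.Ga r1) w x \<and> R s (J.Ga r2) w x'"
  proof (rule T_quotient[OF j1 j2])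
    obtain d where d: "d \<in> Hom ?D B A" "r1 \<odot>\<^bsub>?D\<^esub> d = ide ?D B" "r2 \<odot>\<^bsub>?D\<^esub> d = ide ?D B"
      using refl by blast
    have jd: "J.Ga r1 \<star> J.Ga d = ide \<T> (Jo B)" "J.Ga r2 \<star> J.Ga d = ide \<T> (Jo B)"
      using J.F_cmp[OF d(1) r1] J.F_cmp[OF d(1) r2] d(2,3) J.F_ide[OF B] by auto
    show "\<exists>w. R s (J.Ga r1) w x \<and> R s (J.Ga r2) w x" if s: "stage s" and x: "E s (Jo B) x x" for s x
      using R_total[OF J.F_Hom[OF d(1)] s x] R_cmp_apply[OF J.F_Hom[OF d(1)] j1 s]
        R_cmp_apply[OF J.F_Hom[OF d(1)] j2 s] R_ide[OF J.F_ob[OF B]] x jd by metis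
    obtain i where i: "i \<in> Hom ?D A A" "r1 \<odot>\<^bsub>?D\<^esub> i = r2" "r2 \<odot>\<^bsub>?D\<^esub> i = r1"
      using sym by blast
    have ji: "J.Ga r1 \<star> J.Ga i = J.Ga r2" "J.Ga r2 \<star> J.Ga i = J.Ga r1"
      using J.F_cmp[OF i(1) r1] J.F_cmp[OF i(1) r2] i(2,3) by auto
    show "\<exists>w. R s (J.Ga r1) w x' \<and> R s (J.Ga r2) w x"
      if s: "stage s" and w: "R s (J.Ga r1) w x" "R s (J.Ga r2) w x'" for s w x x'
      using R_total[OF J.F_Hom[OF i(1)] s R_dom[OF j1 s w(1)]] R_cmp_apply[OF J.F_Hom[OF i(1)] j1 s]
        R_cmp_apply[OF J.F_Hom[OF i(1)] j2 s] w ji by metis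
    show "\<exists>w. R s (J.Ga r1) w x \<and> R s (J.Ga r2) w x''"
      if s: "stage s" and w: "R s (J.Ga r1) w x" "R s (J.Ga r2) w x'" "R s (J.Ga r1) w' x'" "R s (J.Ga r2) w' x''"
      for s w w' x x' x''
    proof -
      obtain V u v where u: "u \<in> Hom \<T> V (Jo A)" and v: "v \<in> Hom \<T> V (Jo A)"
        and pb: "is_pullback \<T> (J.Ga r2) (J.Ga r1) u v"
        and surj: "\<And>s x y z. stage s \<Longrightarrow> R s (J.Ga r2) x z \<Longrightarrow> R s (J.Ga r1) y z \<Longrightarrow> \<exists>w. R s u w x \<and> R s v w y"
        by (rule T_pullback_exists[OF j2 j1]) (rule that)
      obtain N c where N: "N \<in> ob ?D" and c: "c \<in> Hom \<T> (Jo N) V" "regular_epi \<T> c"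
        using cov[OF T_HomD(1)[OF u]] by blast
      obtain u' where u': "u' \<in> Hom ?D N A" "J.Ga u' = u \<star> c"
        using J.full[OF N A T_cmp_Hom[OF c(1) u]] by blast
      obtain v' where v': "v' \<in> Hom ?D N A" "J.Ga v' = v \<star> c"
        using J.full[OF N A T_cmp_Hom[OF c(1) v]] by blast
      have "J.Ga r2 \<star> u = J.Ga r1 \<star> v"
        using pb unfolding is_pullback_def by blast
      then have "J.Ga r2 \<star> J.Ga u' = J.Ga r1 \<star> J.Ga v'"
        unfolding u'(2) v'(2) using T.cmp_assoc[OF c(1) u j2] T.cmp_assoc[OF c(1) v j1] by simp
      then obtain t where t: "t \<in> Hom ?D N A" "r1 \<odot>\<^bsub>?D\<^esub> t = r1 \<odot>\<^bsub>?D\<^esub> u'" "r2 \<odot>\<^bsub>?D\<^esub> t = r2 \<odot>\<^bsub>?D\<^esub> v'"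
        using trans[OF u'(1) v'(1)] J.reflect_eq[OF u'(1) r2 v'(1) r1] by blast
      have jt: "J.Ga r1 \<star> J.Ga u' = J.Ga r1 \<star> J.Ga t" "J.Ga r2 \<star> J.Ga v' = J.Ga r2 \<star> J.Ga t"
        using J.F_cmp[OF t(1) r1] J.F_cmp[OF u'(1) r1] J.F_cmp[OF t(1) r2] J.F_cmp[OF v'(1) r2] t(2,3) by auto
      \<comment> \<open>The pair \<open>w\<close>, \<open>w'\<close> is given by an element
        \<open>a\<close> of the pullback, which lifts to \<open>n\<close> along the surjective
        \<open>c\<close>; the value of \<open>J.Ga t\<close> at \<open>n\<close> then relates
        \<open>x\<close> to \<open>x''\<close>.\<close>
      obtain a where a: "R s u a w" "R s v a w'" using surj[OF s w(2,3)] by blast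
      obtain n where n: "R s c n a"
        using T_regular_epi_surjective[OF c] s R_dom[OF u s a(1)] unfolding surjective_def by blast
      have n1: "R s (J.Ga u') n w" "R s (J.Ga v') n w'"
        unfolding u'(2) v'(2) using R_cmp[OF c(1) u s] R_cmp[OF c(1) v s] n a by blast+
      obtain b where b: "R s (J.Ga t) n b"
        using R_total[OF J.F_Hom[OF t(1)] s R_dom[OF c(1) s n]] by blast
      have "R s (J.Ga r1) b x" "R s (J.Ga r2) b x''"
        using R_commute[OF j1 j1 J.F_Hom[OF u'(1)] J.F_Hom[OF t(1)] jt(1) s n1(1) b w(1)]
          R_commute[OF j2 j2 J.F_Hom[OF v'(1)] J.F_Hom[OF t(1)] jt(2) s n1(2) b w(4)] by blast+
      then show ?thesis by blast
    qed
  qed (rule that)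
  have "\<exists>h\<in>Hom \<T> (Jo Z) (Jo A). J.Ga r1 \<star> h = u \<and> J.Ga r2 \<star> h = v"
    if Z: "Z \<in> ob ?D" and u: "u \<in> Hom \<T> (Jo Z) (Jo B)" and v: "v \<in> Hom \<T> (Jo Z) (Jo B)"
      and uv: "q \<star> u = q \<star> v" for Z u v
  proof -
    \<comment> \<open>The relation is compared with the kernel pair \<open>K\<close> of
      \<open>q\<close>. The comparison \<open>c\<close> from \<open>Jo A\<close> to \<open>K\<close>
      is surjective by \<open>ker\<close>, so arrows from the projective \<open>Jo Z\<close> into
      \<open>K\<close> lift through it.\<close>
    obtain K k1 k2 where k1: "k1 \<in> Hom \<T> K (Jo B)" and k2: "k2 \<in> Hom \<T> K (Jo B)"
      and pb: "is_pullback \<T> q q k1 k2"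
      by (rule T_pullback_exists[OF q q]) (rule that)
    have src: "src \<T> q = Jo B" "src \<T> k1 = K"
      using T.HomD(2)[OF q] T.HomD(2)[OF k1] by auto
    obtain c where c: "c \<in> Hom \<T> (Jo A) K" "k1 \<star> c = J.Ga r1" "k2 \<star> c = J.Ga r2"
      using pb j1 j2 eq unfolding is_pullback_def src by blast
    obtain w where w: "w \<in> Hom \<T> (Jo Z) K" "k1 \<star> w = u" "k2 \<star> w = v"
      using pb u v uv unfolding is_pullback_def src by blast
    have "surjective c K"
      unfolding surjective_def
    proof (intro allI impI)
      fix s y assume s: "stage s" and y: "E s K y y"
      obtain x where x: "R s k1 y x" using R_total[OF k1 s y] by blast
      obtain x' where x': "R s k2 y x'" using R_total[OF k2 s y] by blast
      obtain z where z: "R s q x z" using R_total[OF q s R_cod[OF k1 s x]] by blast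
      have "q \<star> k1 = q \<star> k2"
        using pb unfolding is_pullback_def by blast
      then have "R s q x' z"
        using R_commute[OF q q k1 k2 _ s x x' z] by blast
      then obtain a where a: "R s (J.Ga r1) a x" "R s (J.Ga r2) a x'"
        using ker[OF s z] by blast
      obtain y' where y': "R s c a y'"
        using R_total[OF c(1) s R_dom[OF j1 s a(1)]] by blast
      have "R s k1 y' x" "R s k2 y' x'"
        using R_cmp_apply[OF c(1) k1 s _ y'] R_cmp_apply[OF c(1) k2 s _ y'] a c(2,3) by auto
      \<comment> \<open>The legs of \<open>K\<close> are jointly monic; converted to elements, this
        identifies \<open>y'\<close> with \<open>y\<close>, whose legs have the same values.\<close>
      moreover have "t = t'" if t: "t \<in> Hom \<T> V K" and t': "t' \<in> Hom \<T> V K"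
        and e: "k1 \<star> t = k1 \<star> t'" "k2 \<star> t = k2 \<star> t'" for V t t'
      proof (rule T.pullbackE[OF pb])
        fix X1 X2 X3 W
        assume k: "k1 \<in> Hom \<T> W X1"
          and un: "\<And>V w w'. w \<in> Hom \<T> V W \<Longrightarrow> w' \<in> Hom \<T> V W \<Longrightarrow> k1 \<star> w = k1 \<star> w'
            \<Longrightarrow> k2 \<star> w = k2 \<star> w' \<Longrightarrow> w = w'"
        have "W = K" using T.HomD(2)[OF k] src by simp
        then show "t = t'" using un t t' e by blast
      qed
      ultimately have "E s K y' y"
        using T_jointly_monic_inj[OF k1 k2 _ s _ _ x x'] by blast
      then show "\<exists>a. R s c a y"
        using R_cong2[OF c(1) s] y' by blast
    qed
    then obtain h where h: "h \<in> Hom \<T> (Jo Z) (Jo A)" "c \<star> h = w"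
      using J_projective[OF _ c(1) _ w(1)] Z Pred_ob by blast
    then show ?thesis
      using T.cmp_assoc[OF h(1) c(1) k1] T.cmp_assoc[OF h(1) c(1) k2] c(2,3) w(2,3) by auto
  qed
  then show "\<exists>Q. \<exists>q\<in>Hom \<T> (Jo B) Q. regular_epi \<T> q \<and> q \<star> J.Ga r1 = q \<star> J.Ga r2 \<and>
        (\<forall>Z u v. Z \<in> ob ?D \<longrightarrow> u \<in> Hom \<T> (Jo Z) (Jo B) \<longrightarrow> v \<in> Hom \<T> (Jo Z) (Jo B) \<longrightarrow>
          q \<star> u = q \<star> v \<longrightarrow> (\<exists>h\<in>Hom \<T> (Jo Z) (Jo A). J.Ga r1 \<star> h = u \<and> J.Ga r2 \<star> h = v))"
    using q T_surjective_regular_epi[OF q sq] eq by blast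
qed

end

theorem theorem6p5:
  fixes P :: "('o, 'm, 'p) doctr"
  assumes "goedel_first_order_hyperdoctrine P"
  shows "equivalent_exact_categories (tripos_to_topos P) (ex_lex (Pred_existential_free P))"
proof -
  interpret goedel_hyperdoctrine P
    using assms unfolding goedel_first_order_hyperdoctrine_def goedel_hyperdoctrine_def
      goedel_hyperdoctrine_axioms_def .
  show ?thesis
    by (rule J.equivalent_ex_lex)
qed

end
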